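(* Let $m$ be an even positive integer, $0\le k\le m/2$ an integer, $q_A,q_B>0$ fixed real numbers, and $q_{AB}=q_Aq_B$. Consider the matrix $M^{(m)}_k(q_A)M^{(m)}_k(q_B)$ acting on the standard module $\mathcal V^{(m)}_k$ of the Temperley-Lieb algebra $\mathrm{TL}_m$ with loop parameter $\chi$. In the limit $\chi\to\infty$ (with $m,k,q_A,q_B$ fixed) it has a single nonzero eigenvalue at leading order, given by $$\lambda_{M^{(m)}_k}= (q_{AB})^{-k}\,\chi^{m-2k}\,\big(g_{m/2,k}(q_{AB}^{-1})\big)^2 ,$$ with multiplicity $\chi^{2k}$. Precisely: as $\chi\to\infty$ through the integers, the eigenvalues of $\chi^{-(m-2k)}M^{(m)}_k(q_A)M^{(m)}_k(q_B)$, counted with algebraic multiplicity, converge to $(q_{AB})^{-k}\big(g_{m/2,k}(q_{AB}^{-1})\big)^2$ (once) and to $0$ (all others); and the number $d_k$ of copies of $\mathcal V^{(m)}_k$ in the representation $\bigoplus_{j} d_j\mathcal V^{(m)}_j$ reproducing the trace $\mathrm{Tr}_{\mathrm{TL}_m}$, which is the multiplicity of this eigenvalue in that representation, satisfies $d_k/\chi^{2k}\to 1$.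
   Context: **Temperley-Lieb algebra.** For a positive integer $m$, an $m$-diagram consists of two parallel vertical lines, each carrying $m$ marked points labelled $1,\dots,m$ from top to bottom, together with $m$ pairwise non-crossing strands drawn between the two lines connecting the $2m$ points in pairs. $\mathrm{TL}_m$ is the complex vector space with basis the $m$-diagrams, with product given by concatenation and replacing each closed loop by a factor $\chi$. The trace $\mathrm{Tr}_{\mathrm{TL}_m}$ is the linear functional whose value on a diagram is $\chi^{\#\text{loops}}$, the loops being obtained by joining the $i$-th left point to the $i$-th right point for every $i$. **Standard modules.** Let $m$ be even, $0\le k\le m/2$. An $(m,k)$-link state is a half diagram: $m$ marked points on a vertical line, $2k$ of which are "defects" (open strands extending to infinity on the right), while the other $m-2k$ points are connected in pairs by arcs to the right of the line, with no crossings among arcs and defect strands. $\mathcal B^{(m)}_k$ is the set of $(m,k)$-link states and $\mathcal V^{(m)}_k$ the complex vector space with basis $\mathcal B^{(m)}_k$. An $m$-diagram acts on a link state by concatenation (diagram on the left), each closed loop giving a factor $\chi$, the result being $0$ if the number of defects decreases. This defines the representation $\pi^{(m)}_k$ of $\mathrm{TL}_m$ on $\mathcal V^{(m)}_k$. The coefficients $d_0,\dots,d_{m/2}$ are those determined by $\mathrm{Tr}_{\mathrm{TL}_m}(t)=\sum_{k=0}^{m/2} d_k\,\mathrm{tr}(\pi^{(m)}_k(t))$ for all $t\in\mathrm{TL}_m$ (they do not depend on $m$). **The matrices $M^{(m)}_k(q)$.** Let $\mathrm{NC}_m$ be the set of non-crossing permutations of $\{1,\dots,m\}$ and $\#(h)$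 the number of cycles of $h$ (including fixed points). There is a bijection $h\mapsto D(h)$ from $\mathrm{NC}_m$ to the $m$-diagrams: attach to an $m$-diagram caps joining the points $2i-1$ and $2i$ on the left line for each $i=1,\dots,m/2$, and likewise on the right line; label the left caps $1,\dots,m/2$ from top to bottom and the right caps $m/2+1,\dots,m$ from bottom to top; the resulting closed loops partition the $m$ caps into the blocks of a non-crossing partition, which are the cycles of $h$. In particular $\#(h)$ is the number of closed loops so obtained from $D(h)$. Define $$M^{(m)}_k(q)=\sum_{h\in \mathrm{NC}_m} q^{-\#(h)}\,\pi^{(m)}_k(D(h)).$$ **The polynomials $g_{\mu,k}$.** Let $e_0\in\mathcal B^{(m)}_0$ be the link state with arcs connecting $2i-1$ to $2i$, $i=1,\dots,m/2$. For $x\in\mathcal B^{(m)}_k$ let $\ell(x)$ be the number of closed loops (open components are not counted) obtained by gluing the mirror image of $e_0$ to the left of $x$. Then $g_{m/2,k}(q)=\sum_{x\in\mathcal B^{(m)}_k}q^{\ell(x)}$. Equivalently, $g_{\mu,k}(q)$ is the coefficient of $z^\mu r^k$ in $G(q,r,z)=\frac{1-zC(q,z)}{1-z(q+r)-zC(q,z)}$, where $C(q,z)=\frac{1}{2z}\big(1-z(q-1)-\sqrt{(1+z(q-1))^2-4qz}\big)$. *)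

theory Defs
  imports
    Complex_Main
    "HOL-Library.Disjoint_Sets"
    "HOL-Library.Multiset"
    "HOL-Combinatorics.Permutations"
    "HOL-Combinatorics.Orbits"
    "HOL-Computational_Algebra.Computational_Algebra"
    "Jordan_Normal_Form.Char_Poly"
begin

text \<open>Families of blocks (partitions, matchings) on points placed in the order of \<^typ>\<open>nat\<close> on a line.\<close>

definition noncrossing :: "nat set set \<Rightarrow> bool" where
  "noncrossing P \<longleftrightarrow>
     (\<forall>A\<in>P. \<forall>B\<in>P. A \<noteq> B \<longrightarrow>
        \<not> (\<exists>a b c d. a < b \<and> b < c \<and> c < d \<and> a \<in> A \<and> c \<in> A \<and> b \<in> B \<and> d \<in> B))"

subsection \<open>Gluing of strands\<close>

text \<open>
  A strand (or arc) is the two-element set of its end points. Two systems of pairwise disjoint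
  strands \<open>E\<close> and \<open>F\<close> on common points are glued by taking \<open>E \<union> F\<close>. Every point lies on at most
  one strand of each system, so a connected component is a closed loop iff all of its points are
  end points both of a strand of \<open>E\<close> and of a strand of \<open>F\<close>. A strand belonging to both systems
  is a loop with two points; this is why the test is not phrased in terms of the set \<open>E \<union> F\<close>.
\<close>

definition joined :: "'a set set \<Rightarrow> ('a \<times> 'a) set" where
  "joined E = {(a, b). {a, b} \<in> E}\<^sup>*"

definition closed_loops :: "'a set set \<Rightarrow> 'a set set \<Rightarrow> 'a set set" where
  "closed_loops E F = {C \<in> \<Union>(E \<union> F) // joined (E \<union> F). C \<subseteq> \<Union>E \<inter> \<Union>F}"

definition num_loops :: "'a set set \<Rightarrow> 'a set set \<Rightarrow> nat" where
  "num_loops E F = card (closed_loops E F)"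

subsection \<open>Diagrams and the trace\<close>

text \<open>\<open>Lft i\<close> and \<open>Rgt i\<close> are the \<open>i\<close>-th marked points, from the top, of the left and right line.\<close>

datatype point = Lft nat | Rgt nat

definition points :: "nat \<Rightarrow> point set" where
  "points m = Lft ` {1..m} \<union> Rgt ` {1..m}"

text \<open>
  The rank of a point when walking down the left line and then up the right line. Strands drawn
  between the two lines cross iff their end points interlace in this order.
\<close>

fun boundary_pos :: "nat \<Rightarrow> point \<Rightarrow> nat" where
  "boundary_pos m (Lft i) = i"
| "boundary_pos m (Rgt i) = 2 * m + 1 - i"

definition diagrams :: "nat \<Rightarrow> point set set set" where
  "diagrams m = {D. partition_on (points m) D \<and> (\<forall>s\<in>D. card s = 2)
                    \<and> noncrossing ((`) (boundary_pos m) ` D)}"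

text \<open>
  An element of \<open>TL\<^sub>m\<close> is given by its coefficients in the basis of diagrams. Only the
  trace and the action on link states are needed, so the product of \<open>TL\<^sub>m\<close> is not set up.
\<close>

definition TL :: "nat \<Rightarrow> (point set set \<Rightarrow> complex) set" where
  "TL m = {t. \<forall>D. D \<notin> diagrams m \<longrightarrow> t D = 0}"

definition closure_strands :: "nat \<Rightarrow> point set set" where
  "closure_strands m = (\<lambda>i. {Lft i, Rgt i}) ` {1..m}"

definition TL_trace :: "nat \<Rightarrow> complex \<Rightarrow> (point set set \<Rightarrow> complex) \<Rightarrow> complex" where
  "TL_trace m \<chi> t = (\<Sum>D\<in>diagrams m. t D * \<chi> ^ num_loops D (closure_strands m))"

subsection \<open>Link states and standard modules\<close>

text \<open>A link state on \<open>m\<close> points is the set of its arcs; the defects are the points on no arc.\<close>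

definition defects :: "nat \<Rightarrow> nat set set \<Rightarrow> nat set" where
  "defects m x = {1..m} - \<Union>x"

definition link_states :: "nat \<Rightarrow> nat \<Rightarrow> nat set set set" where
  "link_states m k = {x. \<Union>x \<subseteq> {1..m} \<and> disjoint x \<and> (\<forall>s\<in>x. card s = 2) \<and> noncrossing x
       \<and> (\<forall>s\<in>x. \<forall>p\<in>defects m x. \<not> (\<exists>a\<in>s. \<exists>b\<in>s. a < p \<and> p < b))
       \<and> card (defects m x) = 2 * k}"

text \<open>
  The underlying half diagram of the concatenation of \<open>D\<close> (left) with \<open>x\<close> (right), whose points are
  identified with the right points of \<open>D\<close>. The number of closed loops is
  \<open>num_loops D ((`) Rgt ` x)\<close>; a component ending in a defect of \<open>x\<close> is open.
\<close>

definition concat_link :: "nat \<Rightarrow> point set set \<Rightarrow> nat set set \<Rightarrow> nat set set" where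
  "concat_link m D x = {{i, j} | i j. i \<in> {1..m} \<and> j \<in> {1..m} \<and> i \<noteq> j
                      \<and> (Lft i, Lft j) \<in> joined (D \<union> (`) Rgt ` x)}"

text \<open>The coefficient of \<open>y\<close> in \<open>D x\<close>.\<close>

definition action_coeff :: "nat \<Rightarrow> complex \<Rightarrow> point set set \<Rightarrow> nat set set \<Rightarrow> nat set set \<Rightarrow> complex" where
  "action_coeff m \<chi> D x y =
     (if card (defects m (concat_link m D x)) < card (defects m x) then 0
      else if concat_link m D x = y then \<chi> ^ num_loops D ((`) Rgt ` x)
      else 0)"

text \<open>
  The basis of link states in some fixed order; nothing below depends on the choice, up to
  simultaneous permutation of rows and columns.
\<close>

definition link_basis :: "nat \<Rightarrow> nat \<Rightarrow> nat set set list" where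
  "link_basis m k = (SOME xs. distinct xs \<and> set xs = link_states m k)"

definition dim_std :: "nat \<Rightarrow> nat \<Rightarrow> nat" where
  "dim_std m k = card (link_states m k)"

definition diagram_rep :: "nat \<Rightarrow> nat \<Rightarrow> complex \<Rightarrow> point set set \<Rightarrow> complex mat" where
  "diagram_rep m k \<chi> D = mat (dim_std m k) (dim_std m k)
     (\<lambda>(i, j). action_coeff m \<chi> D (link_basis m k ! j) (link_basis m k ! i))"

definition std_rep :: "nat \<Rightarrow> nat \<Rightarrow> complex \<Rightarrow> (point set set \<Rightarrow> complex) \<Rightarrow> complex mat" where
  "std_rep m k \<chi> t = mat (dim_std m k) (dim_std m k)
     (\<lambda>ij. \<Sum>D\<in>diagrams m. t D * diagram_rep m k \<chi> D $$ ij)"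

definition mat_trace :: "complex mat \<Rightarrow> complex" where
  "mat_trace A = (\<Sum>i<dim_row A. A $$ (i, i))"

text \<open>\<open>trace_coeffs m \<chi> k\<close> is \<open>d\<^sub>k\<close>; values at \<open>k > m div 2\<close> are set to zero to make \<open>d\<close> unique.\<close>

definition trace_coeffs :: "nat \<Rightarrow> complex \<Rightarrow> nat \<Rightarrow> complex" where
  "trace_coeffs m \<chi> = (THE d. (\<forall>j>m div 2. d j = 0) \<and>
     (\<forall>t\<in>TL m. TL_trace m \<chi> t = (\<Sum>j\<le>m div 2. d j * mat_trace (std_rep m j \<chi> t))))"

subsection \<open>Non-crossing permutations\<close>

definition cycle_partition :: "nat \<Rightarrow> (nat \<Rightarrow> nat) \<Rightarrow> nat set set" where
  "cycle_partition m h = orbit h ` {1..m}"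

definition num_cycles :: "nat \<Rightarrow> (nat \<Rightarrow> nat) \<Rightarrow> nat" where
  "num_cycles m h = card (cycle_partition m h)"

text \<open>
  The cycles form a non-crossing partition and each one runs through its block in increasing
  order, from the largest element back to the smallest.
\<close>

definition NC :: "nat \<Rightarrow> (nat \<Rightarrow> nat) set" where
  "NC m = {h. h permutes {1..m} \<and> noncrossing (cycle_partition m h)
     \<and> (\<forall>i\<in>{1..m}. h i = (if \<exists>j\<in>orbit h i. i < j then Min {j \<in> orbit h i. i < j}
                          else Min (orbit h i)))}"

text \<open>
  The cap with label \<open>c\<close>. On the right line the labels grow from bottom to top, so the cap on
  \<open>2i - 1\<close>, \<open>2i\<close> has label \<open>m + 1 - i\<close>.
\<close>

definition cap :: "nat \<Rightarrow> nat \<Rightarrow> point set" where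
  "cap m c = (if c \<le> m div 2 then {Lft (2 * c - 1), Lft (2 * c)}
              else {Rgt (2 * (m + 1 - c) - 1), Rgt (2 * (m + 1 - c))})"

definition cap_partition :: "nat \<Rightarrow> point set set \<Rightarrow> nat set set" where
  "cap_partition m D =
     (\<lambda>C. {c \<in> {1..m}. cap m c \<subseteq> C}) ` closed_loops D (cap m ` {1..m})"

definition diagram_of :: "nat \<Rightarrow> (nat \<Rightarrow> nat) \<Rightarrow> point set set" where
  "diagram_of m h = (THE D. D \<in> diagrams m \<and> cap_partition m D = cycle_partition m h)"

subsection \<open>The matrices and the polynomials\<close>

definition M_mat :: "nat \<Rightarrow> nat \<Rightarrow> complex \<Rightarrow> real \<Rightarrow> complex mat" where
  "M_mat m k \<chi> q = mat (dim_std m k) (dim_std m k)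
     (\<lambda>ij. \<Sum>h\<in>NC m. complex_of_real (q powi (- int (num_cycles m h)))
                       * diagram_rep m k \<chi> (diagram_of m h) $$ ij)"

definition e0 :: "nat \<Rightarrow> nat set set" where
  "e0 m = (\<lambda>i. {2 * i - 1, 2 * i}) ` {1..m div 2}"

definition g_poly :: "nat \<Rightarrow> nat \<Rightarrow> real \<Rightarrow> real" where
  "g_poly \<mu> k q = (\<Sum>x\<in>link_states (2 * \<mu>) k. q ^ num_loops (e0 (2 * \<mu>)) x)"

definition eigenvalue_mset :: "complex mat \<Rightarrow> complex multiset" where
  "eigenvalue_mset A = proots (char_poly A)"

end

theory Submission
  imports Defs "Jordan_Normal_Form.Schur_Decomposition"
begin

text \<open>
  Both halves rest on contracting a pair of points in a matching: gluing a strand onto two points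
  of a planar matching joins their partners, or closes a loop if they were partners, and keeps the
  matching planar when the points are neighbours.

  For the coefficients \<open>d\<^sub>k\<close>: if a diagram ends in a cap on the right, \<open>D = E cap\<close>, then \<open>D\<close> has the same
  closure as \<open>cap E\<close>, a diagram on two points fewer, and the same traces in the standard modules.
  So the trace identity needs to be arranged for identity diagrams only, where it is a recursion for
  \<open>d\<^sub>k\<close> that shows \<open>d\<^sub>k / \<chi>\<^bsup>2k\<^esup> \<longlonglongrightarrow> 1\<close>.

  For the eigenvalue: gluing \<open>D\<close> to a link state \<open>x\<close> produces at most \<open>m/2 - k\<close> loops, with equality only if all
  arcs of \<open>x\<close> are strands of \<open>D\<close>; hence each entry \<open>(y, x)\<close> has one dominant diagram, and its
  permutation has \<open>\<ell>(y) + \<ell>(x) + k\<close> cycles. To leading order the matrix is therefore \<open>q\<^bsup>-k\<^esup> v v\<^sup>T\<close> with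
  \<open>v\<^sub>x = q\<^bsup>-\<ell>(x)\<^esup>\<close>, and the product of two such matrices has rank one.
\<close>

subsection \<open>Matchings and their contraction\<close>

text \<open>Contraction leaves the remaining points under their old names, so every notion is set up
  for arbitrary sets of marked points and not only for an initial interval; relabelling is needed
  only when link states are counted. Cycle numbers become accessible through parity: on the line
  every strand joins points of opposite parity, and cycles are counted by the strands with odd left
  end. This count is additive over left arcs, right arcs and through strands, which splits the
  exponent of \<open>q\<close>. For the spectrum no continuity of polynomial roots is invoked: the
  limit \<open>B\<close> of the scaled products satisfies \<open>B * B = l * B\<close> and has trace
  \<open>l\<close>, so every eigenvalue \<open>a\<close> makes \<open>a * (a - l)\<close> small, and
  convergence of the trace then allows exactly one eigenvalue near \<open>l\<close>. The
  coefficients of the trace are given by a definite description, so their uniqueness has to be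
  proved along with the trace identity.\<close>

definition matching :: "'a set set \<Rightarrow> bool" where
  "matching E \<longleftrightarrow> disjoint E \<and> (\<forall>s\<in>E. card s = 2)"

text \<open>The effect on \<open>F\<close> of gluing the strand \<open>{p, q}\<close> onto it. If
  \<open>p\<close> and \<open>q\<close> are partners, the side conditions produce no new strand, so
  the closed loop disappears and has to be counted separately. If only one of them is matched, its
  partner becomes free; this is what capping a defect of a link state does.\<close>

definition contract :: "'a \<Rightarrow> 'a \<Rightarrow> 'a set set \<Rightarrow> 'a set set" where
  "contract p q F = {s \<in> F. p \<notin> s \<and> q \<notin> s} \<union>
     {{a, b} | a b. {a, p} \<in> F \<and> {b, q} \<in> F \<and> a \<noteq> q \<and> b \<noteq> p}"

text \<open>Meant for \<open>F\<close> whose points all belong to \<open>E\<close>: every open path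
  then has both its ends on \<open>E\<close> alone.\<close>

definition open_strands :: "'a set set \<Rightarrow> 'a set set \<Rightarrow> 'a set set" where
  "open_strands E F = {{a, b} | a b. a \<in> \<Union>E - \<Union>F \<and> b \<in> \<Union>E - \<Union>F \<and> a \<noteq> b \<and> (a, b) \<in> joined (E \<union> F)}"

lemma matching_neq: "matching E \<Longrightarrow> {a, b} \<in> E \<Longrightarrow> a \<noteq> b"
  unfolding matching_def by (cases "a = b") auto

lemma matching_unique: "matching E \<Longrightarrow> {a, b} \<in> E \<Longrightarrow> {a, c} \<in> E \<Longrightarrow> b = c"
  unfolding matching_def disjoint_def by (metis Int_iff doubleton_eq_iff insertI1 empty_iff)

lemma matching_unique':
  assumes "matching E"
  shows "{a, b} \<in> E \<Longrightarrow> {c, a} \<in> E \<Longrightarrow> b = c" "{b, a} \<in> E \<Longrightarrow> {a, c} \<in> E \<Longrightarrow> b = c"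
    "{b, a} \<in> E \<Longrightarrow> {c, a} \<in> E \<Longrightarrow> b = c"
  using matching_unique[OF assms, of a b c] by (simp_all add: insert_commute)

lemma matching_unique_set: "matching E \<Longrightarrow> s \<in> E \<Longrightarrow> t \<in> E \<Longrightarrow> a \<in> s \<Longrightarrow> a \<in> t \<Longrightarrow> s = t"
  unfolding matching_def disjoint_def by blast

lemma matching_edge: "matching E \<Longrightarrow> s \<in> E \<Longrightarrow> a \<in> s \<Longrightarrow> \<exists>b. b \<noteq> a \<and> s = {a, b}"
  unfolding matching_def by (metis card_2_iff empty_iff insert_iff insert_commute)

lemma matching_partner:
  assumes "matching E" "a \<in> \<Union>E"
  obtains b where "b \<noteq> a" "{a, b} \<in> E"
  using assms matching_edge by (metis UnionE)

lemma matchingI: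
  assumes "\<And>s. s \<in> E \<Longrightarrow> \<exists>a b. a \<noteq> b \<and> s = {a, b}"
    and "\<And>a b c. {a, b} \<in> E \<Longrightarrow> {a, c} \<in> E \<Longrightarrow> b = c"
  shows "matching E"
  unfolding matching_def disjoint_def
proof (intro conjI ballI impI)
  fix s t assume st: "s \<in> E" "t \<in> E" "s \<noteq> t"
  show "s \<inter> t = {}"
  proof (rule ccontr)
    assume "s \<inter> t \<noteq> {}"
    then obtain a where a: "a \<in> s" "a \<in> t" by blast
    obtain b where "s = {a, b}" using assms(1)[OF st(1)] a by (metis empty_iff insert_iff insert_commute)
    moreover obtain c where "t = {a, c}" using assms(1)[OF st(2)] a by (metis empty_iff insert_iff insert_commute)
    ultimately show False using assms(2) st by blast
  qed
next
  fix s assume "s \<in> E" then show "card s = 2" using assms(1) by (metis card_2_iff)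
qed

lemma matching_subset: "matching E \<Longrightarrow> F \<subseteq> E \<Longrightarrow> matching F"
  unfolding matching_def disjoint_def by blast

lemma matching_image:
  assumes "matching E" "inj_on f (\<Union>E)"
  shows "matching ((`) f ` E)"
proof (rule matchingI)
  fix s assume "s \<in> (`) f ` E"
  then obtain t where t: "t \<in> E" "s = f ` t" by blast
  then obtain a b where ab: "t = {a, b}" "a \<noteq> b" using assms(1) unfolding matching_def by (meson card_2_iff)
  then have "f a \<noteq> f b" using t assms(2) by (metis UnionI inj_onD insertCI)
  then show "\<exists>a b. a \<noteq> b \<and> s = {a, b}" using t ab by auto
next
  fix a b c assume "{a, b} \<in> (`) f ` E" "{a, c} \<in> (`) f ` E"
  then obtain s t where st: "s \<in> E" "t \<in> E" "{a, b} = f ` s" "{a, c} = f ` t" by blast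
  then obtain a1 a2 where a: "a1 \<in> s" "a2 \<in> t" "f a1 = a" "f a2 = a"
    by (metis image_iff insertI1)
  then have "a1 = a2" using assms(2) st by (metis UnionI inj_onD)
  then have "s = t" using matching_unique_set[OF assms(1)] st a by metis
  then show "b = c" using st by (metis doubleton_eq_iff)
qed

lemma Union_matching_image: "\<Union>((`) f ` E) = f ` \<Union>E"
  by blast

lemma finite_matching: "matching E \<Longrightarrow> finite (\<Union>E) \<Longrightarrow> finite E"
  by (rule finite_UnionD)

lemma card_Union_matching: "matching E \<Longrightarrow> finite (\<Union>E) \<Longrightarrow> card (\<Union>E) = 2 * card E"
  using card_partition[of E 2] finite_matching[of E] unfolding matching_def disjoint_def by simp

lemma contract_cases:
  assumes "s \<in> contract p q F"
  obtains "s \<in> F" "p \<notin> s" "q \<notin> s"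
  | a b where "s = {a, b}" "{a, p} \<in> F" "{b, q} \<in> F" "a \<noteq> q" "b \<noteq> p"
  using assms unfolding contract_def by (elim UnE CollectE exE conjE) simp_all

lemma contract_oldI: "s \<in> F \<Longrightarrow> p \<notin> s \<Longrightarrow> q \<notin> s \<Longrightarrow> s \<in> contract p q F"
  unfolding contract_def by simp

lemma contract_newI: "{a, p} \<in> F \<Longrightarrow> {b, q} \<in> F \<Longrightarrow> a \<noteq> q \<Longrightarrow> b \<noteq> p \<Longrightarrow> {a, b} \<in> contract p q F"
  unfolding contract_def by (intro UnI2 CollectI exI conjI) auto

text \<open>For end points away from \<open>p\<close> and \<open>q\<close> the side conditions of
  the definition are automatic; both orders of the joined strands appear because
  \<open>{u, v}\<close> is unordered.\<close>

lemma mem_contract: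
  assumes "matching F" "u \<noteq> p" "u \<noteq> q" "v \<noteq> p" "v \<noteq> q"
  shows "{u, v} \<in> contract p q F \<longleftrightarrow>
    {u, v} \<in> F \<or> ({u, p} \<in> F \<and> {v, q} \<in> F) \<or> ({v, p} \<in> F \<and> {u, q} \<in> F)"
proof
  assume "{u, v} \<in> contract p q F"
  then show "{u, v} \<in> F \<or> ({u, p} \<in> F \<and> {v, q} \<in> F) \<or> ({v, p} \<in> F \<and> {u, q} \<in> F)"
    by (cases rule: contract_cases) (auto simp: doubleton_eq_iff)
next
  assume "{u, v} \<in> F \<or> ({u, p} \<in> F \<and> {v, q} \<in> F) \<or> ({v, p} \<in> F \<and> {u, q} \<in> F)"
  then show "{u, v} \<in> contract p q F"
    using assms contract_newI[of u p F v q] contract_newI[of v p F u q] contract_oldI[of "{u, v}" F p q]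
    by (auto simp: insert_commute)
qed

lemma contract_edgeE:
  assumes "matching F" "p \<noteq> q" "s \<in> contract p q F"
  obtains u v where "s = {u, v}" "u \<noteq> v" "u \<noteq> p" "u \<noteq> q" "v \<noteq> p" "v \<noteq> q"
    "{u, v} \<in> F \<or> {u, p} \<in> F \<and> {v, q} \<in> F"
proof -
  from assms(3) show ?thesis
  proof (cases rule: contract_cases)
    case 1
    then obtain a b where "s = {a, b}" "a \<noteq> b" using assms(1) unfolding matching_def by (meson card_2_iff)
    then show ?thesis using that[of a b] 1 by auto
  next
    case (2 a b)
    have "a \<noteq> p" "b \<noteq> q" using 2 matching_neq[OF assms(1)] by auto
    moreover have "a \<noteq> b" using 2 matching_unique[OF assms(1)] assms(2) by blast
    ultimately show ?thesis using that[of a b] 2 by auto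
  qed
qed

lemma contract_avoid:
  assumes "matching F" "p \<noteq> q" "{u, v} \<in> contract p q F"
  shows "u \<noteq> p" "u \<noteq> q" "v \<noteq> p" "v \<noteq> q" "u \<noteq> v"
  using contract_edgeE[OF assms] by (metis doubleton_eq_iff)+

lemma matching_contract:
  assumes "matching F" "p \<noteq> q"
  shows "matching (contract p q F)"
proof (rule matchingI)
  fix s assume "s \<in> contract p q F"
  then show "\<exists>a b. a \<noteq> b \<and> s = {a, b}" using contract_edgeE[OF assms] by metis
next
  fix a b c assume *: "{a, b} \<in> contract p q F" "{a, c} \<in> contract p q F"
  note 1 = contract_avoid[OF assms *(1)] and 2 = contract_avoid[OF assms *(2)]
  from * have "{a, b} \<in> F \<or> ({a, p} \<in> F \<and> {b, q} \<in> F) \<or> ({b, p} \<in> F \<and> {a, q} \<in> F)"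
     "{a, c} \<in> F \<or> ({a, p} \<in> F \<and> {c, q} \<in> F) \<or> ({c, p} \<in> F \<and> {a, q} \<in> F)"
    using mem_contract[OF assms(1)] 1 2 by auto
  then show "b = c" using 1 2 assms(2)
    by (elim disjE conjE) (auto dest: matching_unique[OF assms(1)] matching_unique'[OF assms(1)])
qed

text \<open>Only an inclusion, since the partner of a matched \<open>p\<close> is lost when
  \<open>q\<close> is unmatched, and conversely. \<open>Union_contract\<close> has equality when
  both are matched.\<close>

lemma Union_contract_subset:
  assumes "matching F" "p \<noteq> q" shows "\<Union>(contract p q F) \<subseteq> \<Union>F - {p, q}"
proof
  fix u assume "u \<in> \<Union>(contract p q F)"
  then obtain v where "{u, v} \<in> contract p q F" by (rule matching_partner[OF matching_contract[OF assms]])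
  note av = contract_avoid[OF assms this]
  from \<open>{u, v} \<in> contract p q F\<close> have "u \<in> \<Union>F" unfolding mem_contract[OF assms(1) av(1-4)]
    by (elim disjE conjE) (erule UnionI, simp)+
  then show "u \<in> \<Union>F - {p, q}" using av by auto
qed

lemma Union_contract:
  assumes "matching F" "p \<noteq> q" "p \<in> \<Union>F" "q \<in> \<Union>F"
  shows "\<Union>(contract p q F) = \<Union>F - {p, q}"
proof
  show "\<Union>F - {p, q} \<subseteq> \<Union>(contract p q F)"
  proof
    fix u assume u: "u \<in> \<Union>F - {p, q}"
    then obtain v where v: "v \<noteq> u" "{u, v} \<in> F" using matching_partner[OF assms(1)] by blast
    obtain a where a: "{p, a} \<in> F" using matching_partner[OF assms(1,3)] by blast
    obtain b where b: "{q, b} \<in> F" using matching_partner[OF assms(1,4)] by blast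
    consider "v = p" | "v = q" | "v \<noteq> p" "v \<noteq> q" by blast
    then show "u \<in> \<Union>(contract p q F)"
    proof cases
      case 1
      then have "b \<noteq> p" using u v b matching_unique'(3)[OF assms(1), of u p q] by auto
      moreover have "b \<noteq> q" using b matching_neq[OF assms(1)] by blast
      ultimately have "{u, b} \<in> contract p q F"
        using 1 u v b mem_contract[OF assms(1), of u p q b] by (auto simp: insert_commute)
      then show ?thesis by blast
    next
      case 2
      then have "a \<noteq> q" using u v a matching_unique'(3)[OF assms(1), of u q p] by auto
      moreover have "a \<noteq> p" using a matching_neq[OF assms(1)] by blast
      ultimately have "{u, a} \<in> contract p q F"
        using 2 u v a mem_contract[OF assms(1), of u p q a] by (auto simp: insert_commute)
      then show ?thesis by blast
    next
      case 3
      then have "{u, v} \<in> contract p q F" using u v mem_contract[OF assms(1), of u p q v] by auto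
      then show ?thesis by blast
    qed
  qed
qed (rule Union_contract_subset[OF assms(1,2)])

lemma contract_edge:
  assumes "matching F" "p \<noteq> q" "{p, q} \<in> F"
  shows "contract p q F = F - {{p, q}}"
proof -
  have "a = q" if "{a, p} \<in> F" for a using that assms(3) matching_unique'(2)[OF assms(1)] by blast
  moreover have "s = {p, q}" if "s \<in> F" "p \<in> s \<or> q \<in> s" for s
    using that assms matching_unique_set[OF assms(1)] by (metis insertCI)
  ultimately show ?thesis unfolding contract_def by auto
qed

lemma contract_image:
  assumes "inj f"
  shows "contract (f p) (f q) ((`) f ` F) = (`) f ` contract p q F"
proof -
  have e: "{f a, f b} \<in> (`) f ` F \<longleftrightarrow> {a, b} \<in> F" for a b
    using assms by (metis (no_types, lifting) image_empty image_insert inj_image_eq_iff image_iff)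
  have e2: "\<exists>a'. a = f a'" if "{a, f b} \<in> (`) f ` F" for a b
  proof -
    from that obtain t where "{a, f b} = f ` t" by auto
    then have "a \<in> f ` t" by blast
    then show ?thesis by blast
  qed
  show ?thesis
  proof
    show "contract (f p) (f q) ((`) f ` F) \<subseteq> (`) f ` contract p q F"
    proof
      fix s assume "s \<in> contract (f p) (f q) ((`) f ` F)"
      then show "s \<in> (`) f ` contract p q F"
      proof (cases rule: contract_cases)
        case 1
        then obtain t where "s = f ` t" "t \<in> F" "p \<notin> t" "q \<notin> t" by blast
        then show ?thesis by (simp add: contract_oldI)
      next
        case (2 a b)
        then obtain a' b' where ab: "a = f a'" "b = f b'" using e2 by meson
        have "{a', p} \<in> F" "{b', q} \<in> F" using 2(2,3) unfolding ab e .
        moreover have "a' \<noteq> q" "b' \<noteq> p" using 2(4,5) ab by auto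
        ultimately have "{a', b'} \<in> contract p q F" by (rule contract_newI)
        then have "f ` {a', b'} \<in> (`) f ` contract p q F" by (rule imageI)
        then show ?thesis unfolding 2(1) ab by simp
      qed
    qed
    show "(`) f ` contract p q F \<subseteq> contract (f p) (f q) ((`) f ` F)"
    proof
      fix s assume "s \<in> (`) f ` contract p q F"
      then obtain t where t: "s = f ` t" "t \<in> contract p q F" by blast
      from t(2) show "s \<in> contract (f p) (f q) ((`) f ` F)"
      proof (cases rule: contract_cases)
        case 1 then show ?thesis using t assms
          by (intro contract_oldI) (auto simp: inj_image_mem_iff)
      next
        case (2 a b)
        have "{f a, f p} \<in> (`) f ` F" "{f b, f q} \<in> (`) f ` F" unfolding e by (rule 2)+
        moreover have "f a \<noteq> f q" "f b \<noteq> f p" using 2 assms by (auto simp: inj_eq)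
        ultimately have "{f a, f b} \<in> contract (f p) (f q) ((`) f ` F)" by (rule contract_newI)
        then show ?thesis unfolding t(1) 2(1) by simp
      qed
    qed
  qed
qed

subsection \<open>Closed loops under contraction\<close>

lemma joined_refl [simp]: "(a, a) \<in> joined E"
  unfolding joined_def by simp

lemma joined_edge: "{a, b} \<in> E \<Longrightarrow> (a, b) \<in> joined E"
  unfolding joined_def by (rule r_into_rtrancl) simp

lemma joined_trans: "(a, b) \<in> joined E \<Longrightarrow> (b, c) \<in> joined E \<Longrightarrow> (a, c) \<in> joined E"
  unfolding joined_def by (rule rtrancl_trans)

lemma joined_sym:
  assumes "(a, b) \<in> joined E"
  shows "(b, a) \<in> joined E"
proof -
  have "sym {(a, b). {a, b} \<in> E}"
    by (rule symI) (simp add: insert_commute[of _ _ "{}"])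
  then have "sym (joined E)" unfolding joined_def by (rule sym_rtrancl)
  then show ?thesis using assms by (rule symD)
qed

lemma joined_induct [consumes 1, case_names refl step]:
  assumes "(a, b) \<in> joined E" "P a"
    and "\<And>c d. (a, c) \<in> joined E \<Longrightarrow> {c, d} \<in> E \<Longrightarrow> P c \<Longrightarrow> P d"
  shows "P b"
  using assms(1) unfolding joined_def
  by (induction rule: rtrancl_induct) (use assms(2,3) in \<open>auto simp: joined_def\<close>)

lemma joined_closed:
  assumes "(a, b) \<in> joined E" "a \<in> S" "\<And>c d. c \<in> S \<Longrightarrow> {c, d} \<in> E \<Longrightarrow> d \<in> S"
  shows "b \<in> S"
  using assms(1) by (induction rule: joined_induct) (use assms in auto)

lemma joined_subset:
  assumes "(a, b) \<in> joined E" "\<And>c d. {c, d} \<in> E \<Longrightarrow> (c, d) \<in> joined E'"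
  shows "(a, b) \<in> joined E'"
  using assms(1)
proof (induction rule: joined_induct)
  case (step c d)
  show ?case by (rule joined_trans[OF step(3) assms(2)[OF step(2)]])
qed simp

lemma joined_in_Union: "(a, b) \<in> joined E \<Longrightarrow> a \<noteq> b \<Longrightarrow> a \<in> \<Union>E \<and> b \<in> \<Union>E"
proof -
  have "a = b \<or> b \<in> \<Union>E" if "(a, b) \<in> joined E" for a b
    using that by (induction rule: joined_induct) auto
  from this[of a b] this[of b a] show "(a, b) \<in> joined E \<Longrightarrow> a \<noteq> b \<Longrightarrow> a \<in> \<Union>E \<and> b \<in> \<Union>E"
    using joined_sym[of a b] by auto
qed

lemma joined_matching:
  assumes "matching E" "(a, b) \<in> joined E"
  shows "a = b \<or> {a, b} \<in> E"
  using assms(2) by (induction rule: joined_induct) (auto dest: matching_unique'[OF assms(1)])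

lemma Image_joined_eq: "b \<in> joined E `` {a} \<Longrightarrow> joined E `` {b} = joined E `` {a}"
proof -
  assume "b \<in> joined E `` {a}"
  then have ab: "(a, b) \<in> joined E" by simp
  then have "(a, c) \<in> joined E \<longleftrightarrow> (b, c) \<in> joined E" for c
    using joined_trans[OF ab] joined_trans[OF joined_sym[OF ab]] by metis
  then show ?thesis by auto
qed

context
  fixes E F :: "'a set set" and p q
  assumes E: "matching E" and F: "matching F" and pq: "p \<noteq> q" "{p, q} \<in> E"
begin

text \<open>Follows a path of \<open>E \<union> F\<close> from a point outside
  \<open>{p, q}\<close>. While the path sits at \<open>p\<close> or \<open>q\<close>, the predicate
  remembers the point \<open>u\<close> from which it entered; the entry was by a strand of
  \<open>F\<close>, since \<open>E\<close> has only \<open>{p, q}\<close> there. Leaving again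
  either returns to \<open>u\<close> or runs along the contracted strand.\<close>

lemma joined_contract_reach:
  assumes "(a, c) \<in> joined (E \<union> F)" "a \<noteq> p" "a \<noteq> q"
  shows "if c = p \<or> c = q then
      \<exists>u. u \<noteq> p \<and> u \<noteq> q \<and> (a, u) \<in> joined (E - {{p, q}} \<union> contract p q F) \<and> ({u, p} \<in> F \<or> {u, q} \<in> F)
    else (a, c) \<in> joined (E - {{p, q}} \<union> contract p q F)"
    (is "?P c")
  using assms(1)
proof (induction rule: joined_induct)
  case refl
  then show ?case using assms by simp
next
  case (step c d)
  let ?J = "joined (E - {{p, q}} \<union> contract p q F)"
  show ?case
  proof (cases "c = p \<or> c = q")
    case False
    then have ac: "(a, c) \<in> ?J" using step by simp
    show ?thesis
    proof (cases "d = p \<or> d = q")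
      case True
      then have "{c, d} \<notin> E" using False pq matching_unique'[OF E] by blast
      then show ?thesis using True False step ac by auto
    next
      case d: False
      then have "{c, d} \<in> E - {{p, q}} \<union> contract p q F"
        using step(2) False by (auto intro: contract_oldI)
      then show ?thesis using d ac joined_trans joined_edge by (metis (full_types))
    qed
  next
    case True
    then obtain u where u: "u \<noteq> p" "u \<noteq> q" "(a, u) \<in> ?J" "{u, p} \<in> F \<or> {u, q} \<in> F"
      using step(3) by auto
    show ?thesis
    proof (cases "d = p \<or> d = q")
      case True
      then show ?thesis using u by auto
    next
      case d: False
      have "{c, d} \<in> F"
        using step(2) True d pq(2) matching_unique[OF E, of p q d] matching_unique'(2)[OF E, of p q d] by auto
      then have dF: "{d, c} \<in> F" by (simp add: insert_commute)
      have "u = d \<or> {u, d} \<in> contract p q F"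
      proof (cases "{u, c} \<in> F")
        case True
        then show ?thesis using dF matching_unique'(3)[OF F] by blast
      next
        case False
        then show ?thesis using dF d u True mem_contract[OF F, of u p q d] by blast
      qed
      then have "(u, d) \<in> ?J" by (auto intro: joined_edge)
      then show ?thesis using u(3) d joined_trans by (metis (full_types))
    qed
  qed
qed

lemma joined_contract:
  assumes "a \<noteq> p" "a \<noteq> q" "b \<noteq> p" "b \<noteq> q"
  shows "(a, b) \<in> joined (E \<union> F) \<longleftrightarrow> (a, b) \<in> joined (E - {{p, q}} \<union> contract p q F)"
proof
  assume "(a, b) \<in> joined (E \<union> F)"
  from joined_contract_reach[OF this] assms
  show "(a, b) \<in> joined (E - {{p, q}} \<union> contract p q F)" by simp
next
  assume "(a, b) \<in> joined (E - {{p, q}} \<union> contract p q F)"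
  then show "(a, b) \<in> joined (E \<union> F)"
  proof (rule joined_subset)
    fix c d assume "{c, d} \<in> E - {{p, q}} \<union> contract p q F"
    then consider "{c, d} \<in> E" | "{c, d} \<in> contract p q F" by blast
    then show "(c, d) \<in> joined (E \<union> F)"
    proof cases
      case 1 then show ?thesis by (intro joined_edge) simp
    next
      case 2
      note av = contract_avoid[OF F pq(1) 2]
      have e: "(p, q) \<in> joined (E \<union> F)" "(q, p) \<in> joined (E \<union> F)"
        using pq by (auto intro!: joined_edge simp: insert_commute[of _ _ "{}"])
      have e2: "(x, y) \<in> joined (E \<union> F)" "(y, x) \<in> joined (E \<union> F)" if "{x, y} \<in> F" for x y
        using that by (auto intro!: joined_edge simp: insert_commute[of _ _ "{}"])
      from 2 show ?thesis unfolding mem_contract[OF F av(1-4)]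
      proof (elim disjE conjE)
        assume "{c, p} \<in> F" "{d, q} \<in> F"
        then show ?thesis using e e2 joined_trans by meson
      next
        assume "{d, p} \<in> F" "{c, q} \<in> F"
        then show ?thesis using e e2 joined_trans by meson
      qed (use e2 in blast)
    qed
  qed
qed

lemma Union_remove_edge: "\<Union>(E - {{p, q}}) = \<Union>E - {p, q}"
  using contract_edge[OF E pq] Union_contract[OF E pq(1)] pq(2) by auto

lemma Image_joined_contract:
  assumes "a \<noteq> p" "a \<noteq> q"
  shows "joined (E - {{p, q}} \<union> contract p q F) `` {a} = joined (E \<union> F) `` {a} - {p, q}"
proof -
  let ?J = "joined (E - {{p, q}} \<union> contract p q F)"
  have "p \<notin> \<Union>(E - {{p, q}} \<union> contract p q F)" "q \<notin> \<Union>(E - {{p, q}} \<union> contract p q F)"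
    using Union_remove_edge Union_contract_subset[OF F pq(1)] by auto
  then have "(a, p) \<notin> ?J" "(a, q) \<notin> ?J" using joined_in_Union assms by metis+
  then have "(a, b) \<in> ?J \<longleftrightarrow> (a, b) \<in> joined (E \<union> F) \<and> b \<noteq> p \<and> b \<noteq> q" for b
    using joined_contract[OF assms, of b] by (cases "b = p \<or> b = q") auto
  then show ?thesis by auto
qed

text \<open>A strand of both systems is a component by itself, because the matchings leave
  \<open>p\<close> and \<open>q\<close> no other partner; all other components are
  untouched.\<close>

lemma closed_loops_contract_edge:
  assumes "{p, q} \<in> F"
  shows "closed_loops E F = insert {p, q} (closed_loops (E - {{p, q}}) (contract p q F))"
    "{p, q} \<notin> closed_loops (E - {{p, q}}) (contract p q F)"
proof -
  let ?E' = "E - {{p, q}}" and ?F' = "contract p q F"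
  let ?J = "joined (E \<union> F)" and ?J' = "joined (?E' \<union> ?F')"
  have UE: "\<Union>?E' = \<Union>E - {p, q}" by (rule Union_remove_edge)
  have UF: "\<Union>?F' = \<Union>F - {p, q}" using assms by (intro Union_contract[OF F pq(1)]) auto
  have nb: "d \<in> {p, q}" if "c \<in> {p, q}" "{c, d} \<in> E \<union> F" for c d
    using that pq assms matching_unique[OF E] matching_unique[OF F] matching_unique'[OF E] matching_unique'[OF F] by blast
  have clp: "?J `` {c} = {p, q}" if "c \<in> {p, q}" for c
  proof
    show "?J `` {c} \<subseteq> {p, q}" using joined_closed[of c _ "E \<union> F" "{p, q}"] nb that by blast
    have "(p, q) \<in> ?J" using assms by (intro joined_edge) simp
    then show "{p, q} \<subseteq> ?J `` {c}" using that joined_sym by auto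
  qed
  have nin: "?J `` {a} \<inter> {p, q} = {}" if "a \<notin> {p, q}" for a
  proof (rule ccontr)
    assume "?J `` {a} \<inter> {p, q} \<noteq> {}"
    then obtain x where x: "x \<in> ?J `` {a}" "x \<in> {p, q}" by blast
    have "?J `` {a} = {p, q}" using Image_joined_eq[OF x(1)] clp[OF x(2)] by simp
    moreover have "a \<in> ?J `` {a}" by simp
    ultimately show False using that by simp
  qed
  have cl: "?J' `` {a} = ?J `` {a}" if "a \<notin> {p, q}" for a
    using Image_joined_contract[of a] nin[OF that] that by auto
  show "{p, q} \<notin> closed_loops ?E' ?F'" unfolding closed_loops_def using UE by blast
  show "closed_loops E F = insert {p, q} (closed_loops ?E' ?F')"
  proof (intro subset_antisym subsetI)
    fix C assume "C \<in> closed_loops E F"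
    then obtain a where a: "C = ?J `` {a}" "a \<in> \<Union>(E \<union> F)" "C \<subseteq> \<Union>E \<inter> \<Union>F"
      unfolding closed_loops_def quotient_def by blast
    show "C \<in> insert {p, q} (closed_loops ?E' ?F')"
    proof (cases "a \<in> {p, q}")
      case True then show ?thesis using clp a by simp
    next
      case False
      then have "C = ?J' `` {a}" "a \<in> \<Union>(?E' \<union> ?F')" using cl a UE UF by auto
      moreover have "C \<inter> {p, q} = {}" using nin[OF False] a(1) by simp
      ultimately show ?thesis using a(3) UE UF unfolding closed_loops_def quotient_def by blast
    qed
  next
    fix C assume "C \<in> insert {p, q} (closed_loops ?E' ?F')"
    then consider "C = {p, q}" | a where "C = ?J' `` {a}" "a \<in> \<Union>(?E' \<union> ?F')" "C \<subseteq> \<Union>?E' \<inter> \<Union>?F'"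
      unfolding closed_loops_def quotient_def by blast
    then show "C \<in> closed_loops E F"
    proof cases
      case 1
      then have "C = ?J `` {p}" "p \<in> \<Union>(E \<union> F)" "C \<subseteq> \<Union>E \<inter> \<Union>F" using clp pq assms by auto
      then show ?thesis unfolding closed_loops_def quotient_def by blast
    next
      case 2
      then have "a \<notin> {p, q}" using UE UF by blast
      then have "C = ?J `` {a}" using cl 2(1) by simp
      moreover have "a \<in> \<Union>(E \<union> F)" using 2(2) unfolding Union_Un_distrib UE UF by blast
      moreover have "C \<subseteq> \<Union>E \<inter> \<Union>F" using 2(3) unfolding UE UF by blast
      ultimately have "C = ?J `` {a}" "a \<in> \<Union>(E \<union> F)" "C \<subseteq> \<Union>E \<inter> \<Union>F" by simp_all
      then show ?thesis unfolding closed_loops_def quotient_def by blast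
    qed
  qed
qed

text \<open>Loops are shortened, never created or destroyed: since \<open>{p, q}\<close> is not in
  \<open>F\<close>, a loop through \<open>p\<close> or \<open>q\<close> continues along
  \<open>F\<close> to another point and so survives the deletion of both.\<close>

lemma bij_betw_closed_loops_contract:
  assumes "{p, q} \<notin> F"
  shows "bij_betw (\<lambda>C. C - {p, q}) (closed_loops E F) (closed_loops (E - {{p, q}}) (contract p q F))"
proof -
  let ?E' = "E - {{p, q}}" and ?F' = "contract p q F"
  let ?J = "joined (E \<union> F)" and ?J' = "joined (?E' \<union> ?F')"
  have UE: "\<Union>?E' = \<Union>E - {p, q}" by (rule Union_remove_edge)
  have UF: "\<Union>?F' \<subseteq> \<Union>F - {p, q}" by (rule Union_contract_subset[OF F pq(1)])
  have jpq: "(p, q) \<in> ?J" "(q, p) \<in> ?J" using pq by (auto intro!: joined_edge simp: insert_commute[of _ _ "{}"])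
  have rep: "\<exists>a. a \<notin> {p, q} \<and> C = ?J `` {a}" if C: "C \<in> closed_loops E F" for C
  proof -
    obtain a where a: "C = ?J `` {a}" "a \<in> \<Union>(E \<union> F)" "C \<subseteq> \<Union>E \<inter> \<Union>F"
      using C unfolding closed_loops_def quotient_def by blast
    show ?thesis
    proof (cases "a \<in> {p, q}")
      case True
      then have "a \<in> \<Union>F" using a(1,3) joined_refl[of a "E \<union> F"] by blast
      then obtain u where u: "u \<noteq> a" "{a, u} \<in> F" by (rule matching_partner[OF F])
      then have "u \<notin> {p, q}" using assms True by (auto simp: insert_commute)
      moreover have "u \<in> ?J `` {a}" using u joined_edge[of a u "E \<union> F"] by simp
      ultimately show ?thesis using a(1) Image_joined_eq by metis
    next
      case False then show ?thesis using a by blast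
    qed
  qed
  show ?thesis
  proof (rule bij_betwI')
    fix C1 C2 assume C: "C1 \<in> closed_loops E F" "C2 \<in> closed_loops E F"
    show "(C1 - {p, q} = C2 - {p, q}) = (C1 = C2)"
    proof
      assume eq: "C1 - {p, q} = C2 - {p, q}"
      obtain a b where ab: "a \<notin> {p, q}" "C1 = ?J `` {a}" "C2 = ?J `` {b}" using rep C by meson
      then have "a \<in> C2" using eq joined_refl[of a "E \<union> F"] by blast
      then show "C1 = C2" using ab Image_joined_eq by metis
    qed simp
  next
    fix C assume C: "C \<in> closed_loops E F"
    then have CV: "C \<subseteq> \<Union>E \<inter> \<Union>F" unfolding closed_loops_def by blast
    obtain a where a: "a \<notin> {p, q}" "C = ?J `` {a}" using rep C by blast
    then have eq: "C - {p, q} = ?J' `` {a}" using Image_joined_contract[of a] by simp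
    have "x \<in> \<Union>?F'" if x: "x \<in> C - {p, q}" for x
    proof -
      obtain y where y: "y \<noteq> x" "{x, y} \<in> F" using x CV matching_partner[OF F] by (metis DiffD1 IntD2 subsetD)
      have yC: "y \<in> C" using x a y joined_trans[of a x "E \<union> F" y] joined_edge[of x y "E \<union> F"] by simp
      show ?thesis
      proof (cases "y \<in> {p, q}")
        case True
        then have "p \<in> C" "q \<in> C" using yC a(2) jpq joined_trans[of a _ "E \<union> F"] by auto
        then have "\<Union>?F' = \<Union>F - {p, q}" using CV by (intro Union_contract[OF F pq(1)]) auto
        then show ?thesis using x CV by blast
      next
        case False
        then have "{x, y} \<in> ?F'" using x y by (intro contract_oldI) auto
        then show ?thesis by blast
      qed
    qed
    moreover have "C - {p, q} \<subseteq> \<Union>?E'" using CV UE by blast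
    moreover have "a \<in> C - {p, q}" using a by simp
    ultimately have "C - {p, q} \<subseteq> \<Union>?E' \<inter> \<Union>?F'" "a \<in> \<Union>(?E' \<union> ?F')" by blast+
    then show "C - {p, q} \<in> closed_loops ?E' ?F'" using eq unfolding closed_loops_def quotient_def by blast
  next
    fix C' assume "C' \<in> closed_loops ?E' ?F'"
    then obtain a where a: "C' = ?J' `` {a}" "a \<in> \<Union>(?E' \<union> ?F')" "C' \<subseteq> \<Union>?E' \<inter> \<Union>?F'"
      unfolding closed_loops_def quotient_def by blast
    then have apq: "a \<noteq> p" "a \<noteq> q" using UE UF by auto
    then have eq: "C' = ?J `` {a} - {p, q}" using a Image_joined_contract[of a] by simp
    \<comment> \<open>A loop of the contracted system must be closed before contraction as well. If
      its component runs into \<open>p\<close> or \<open>q\<close> from \<open>u\<close>, the strand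
      of \<open>u\<close> in \<open>contract p q F\<close> is new, and a new strand exists only when
      both \<open>p\<close> and \<open>q\<close> are matched in \<open>F\<close>.\<close>
    have "x \<in> \<Union>F" if "x \<in> ?J `` {a}" "x \<in> {p, q}" for x
    proof -
      have "(a, x) \<in> ?J" using that by simp
      from joined_contract_reach[OF this apq] that(2) obtain u
        where u: "u \<noteq> p" "u \<noteq> q" "(a, u) \<in> ?J'" "{u, p} \<in> F \<or> {u, q} \<in> F" by auto
      then have "u \<in> \<Union>?F'" using a by auto
      then obtain v where v: "v \<noteq> u" "{u, v} \<in> ?F'" by (rule matching_partner[OF matching_contract[OF F pq(1)]])
      note av = contract_avoid[OF F pq(1) v(2)]
      have "{u, v} \<notin> F" using u(4) av matching_unique[OF F, of u] by blast
      then have "p \<in> \<Union>F" "q \<in> \<Union>F" using v(2) unfolding mem_contract[OF F av(1-4)] by auto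
      then show ?thesis using that by blast
    qed
    moreover have "{p, q} \<subseteq> \<Union>E" using pq by blast
    ultimately have "?J `` {a} \<subseteq> \<Union>E \<inter> \<Union>F" using a(3) eq UE UF by blast
    moreover have "a \<in> \<Union>(E \<union> F)" using a(2) UE UF unfolding Union_Un_distrib by blast
    ultimately have "?J `` {a} \<in> closed_loops E F" unfolding closed_loops_def quotient_def by blast
    then show "\<exists>C\<in>closed_loops E F. C' = C - {p, q}" using eq by blast
  qed
qed

lemma num_loops_contract:
  assumes "finite (\<Union>E)"
  shows "num_loops E F = num_loops (E - {{p, q}}) (contract p q F) + of_bool ({p, q} \<in> F)"
proof (cases "{p, q} \<in> F")
  case True
  have "closed_loops (E - {{p, q}}) (contract p q F) \<subseteq> Pow (\<Union>E)" unfolding closed_loops_def by blast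
  then have "finite (closed_loops (E - {{p, q}}) (contract p q F))" using assms finite_subset by blast
  then show ?thesis unfolding num_loops_def closed_loops_contract_edge(1)[OF True]
    using closed_loops_contract_edge(2)[OF True] True by simp
next
  case False
  then show ?thesis using bij_betw_same_card[OF bij_betw_closed_loops_contract] unfolding num_loops_def by simp
qed

end

lemma num_loops_commute: "num_loops E F = num_loops F E"
  unfolding num_loops_def closed_loops_def by (simp add: Un_commute Int_commute)

lemma num_loops_empty: "num_loops E {} = 0"
proof -
  have ne: "C \<noteq> {}" if "C \<in> \<Union>E // joined E" for C
  proof -
    obtain a where "C = joined E `` {a}" using \<open>C \<in> \<Union>E // joined E\<close> unfolding quotient_def by blast
    then have "a \<in> C" by simp
    then show ?thesis by blast
  qed
  have "closed_loops E {} = {}"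
  proof (rule ccontr)
    assume "closed_loops E {} \<noteq> {}"
    then obtain C where "C \<in> \<Union>E // joined E" "C \<subseteq> {}" unfolding closed_loops_def by auto
    then show False using ne by auto
  qed
  then show ?thesis unfolding num_loops_def by simp
qed

lemma contract_id: "p \<notin> \<Union>F \<Longrightarrow> q \<notin> \<Union>F \<Longrightarrow> contract p q F = F"
  unfolding contract_def by auto

subsection \<open>Open strands of two glued matchings\<close>

lemma open_strands_empty:
  assumes "matching E"
  shows "open_strands E {} = E"
proof (intro subset_antisym subsetI)
  fix s assume "s \<in> open_strands E {}"
  then obtain a b where ab: "s = {a, b}" "a \<noteq> b" "(a, b) \<in> joined E" unfolding open_strands_def by auto
  then show "s \<in> E" using joined_matching[OF assms ab(3)] by simp
next
  fix s assume s: "s \<in> E"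
  then obtain a b where ab: "s = {a, b}" "a \<noteq> b" using assms unfolding matching_def by (meson card_2_iff)
  then have "(a, b) \<in> joined E" "a \<in> \<Union>E" "b \<in> \<Union>E" using s by (auto intro: joined_edge)
  then show "s \<in> open_strands E {}" using ab unfolding open_strands_def by auto
qed

lemma open_strands_iff:
  "{a, b} \<in> open_strands E F \<longleftrightarrow> a \<in> \<Union>E - \<Union>F \<and> b \<in> \<Union>E - \<Union>F \<and> a \<noteq> b \<and> (a, b) \<in> joined (E \<union> F)"
proof
  assume "{a, b} \<in> open_strands E F"
  then obtain c d where cd: "{a, b} = {c, d}" "c \<in> \<Union>E - \<Union>F" "d \<in> \<Union>E - \<Union>F" "c \<noteq> d" "(c, d) \<in> joined (E \<union> F)"
    unfolding open_strands_def by (elim CollectE exE conjE) (rule that)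
  from cd(1) have "a = c \<and> b = d \<or> a = d \<and> b = c" by (simp only: doubleton_eq_iff)
  then show "a \<in> \<Union>E - \<Union>F \<and> b \<in> \<Union>E - \<Union>F \<and> a \<noteq> b \<and> (a, b) \<in> joined (E \<union> F)"
  proof (elim disjE conjE)
    assume "a = c" "b = d" then show ?thesis using cd(2-5) by simp
  next
    assume "a = d" "b = c" then show ?thesis using cd(2-4) joined_sym[OF cd(5)] by simp
  qed
next
  assume "a \<in> \<Union>E - \<Union>F \<and> b \<in> \<Union>E - \<Union>F \<and> a \<noteq> b \<and> (a, b) \<in> joined (E \<union> F)"
  then show "{a, b} \<in> open_strands E F" unfolding open_strands_def by (intro CollectI exI conjI) (rule refl, simp_all)
qed

lemma open_strandsE:
  assumes "s \<in> open_strands E F"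
  obtains a b where "s = {a, b}" "a \<noteq> b"
  using assms unfolding open_strands_def by (elim CollectE exE conjE) (rule that)

lemma matching_insertD:
  assumes "matching (insert {p, q} F)" "{p, q} \<notin> F"
  shows "p \<noteq> q" "p \<notin> \<Union>F" "q \<notin> \<Union>F" "matching F"
proof -
  show "p \<noteq> q" using matching_neq[OF assms(1)] by simp
  show "matching F" using matching_subset[OF assms(1)] by auto
  have "s = {p, q}" if "s \<in> F" "x \<in> s" "x \<in> {p, q}" for s x
    using matching_unique_set[OF assms(1), of s "{p, q}" x] that by simp
  then show "p \<notin> \<Union>F" "q \<notin> \<Union>F" using assms(2) by auto
qed

context
  fixes E F :: "'a set set" and p q
  assumes E: "matching E" and F: "matching (insert {p, q} F)" and pqF: "{p, q} \<notin> F" and pqE: "p \<in> \<Union>E" "q \<in> \<Union>E"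
begin

text \<open>The roles are exchanged compared with \<open>num_loops_contract\<close>: the strand is
  taken out of the second system and contracts the first, the form suited to induction over
  \<open>F\<close>.\<close>

lemma num_loops_insert:
  assumes "finite (\<Union>E)" "\<Union>F \<subseteq> \<Union>E"
  shows "num_loops E (insert {p, q} F) = num_loops (contract p q E) F + of_bool ({p, q} \<in> E)"
proof -
  note pq = matching_insertD[OF F pqF]
  have "finite (\<Union>(insert {p, q} F))" using assms finite_subset pqE by auto
  from num_loops_contract[OF F E pq(1) insertI1 this] pqF
  show ?thesis by (simp add: num_loops_commute)
qed

lemma open_strands_insert:
  "open_strands E (insert {p, q} F) = open_strands (contract p q E) F"
proof -
  note pq = matching_insertD[OF F pqF]
  have UE: "\<Union>(contract p q E) = \<Union>E - {p, q}" by (rule Union_contract[OF E pq(1) pqE])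
  have V: "\<Union>E - \<Union>(insert {p, q} F) = \<Union>(contract p q E) - \<Union>F" unfolding UE by auto
  have j: "(a, b) \<in> joined (E \<union> insert {p, q} F) \<longleftrightarrow> (a, b) \<in> joined (contract p q E \<union> F)"
    if "a \<noteq> p" "a \<noteq> q" "b \<noteq> p" "b \<noteq> q" for a b
    using joined_contract[OF F E pq(1) insertI1 that] pqF by (simp add: Un_commute)
  have m: "{a, b} \<in> open_strands E (insert {p, q} F) \<longleftrightarrow> {a, b} \<in> open_strands (contract p q E) F" for a b
  proof (cases "a \<in> {p, q} \<or> b \<in> {p, q}")
    case True
    then show ?thesis unfolding open_strands_iff V UE by blast
  next
    case False
    then show ?thesis unfolding open_strands_iff V using j[of a b] by simp
  qed
  show ?thesis
  proof (rule Set.set_eqI)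
    fix s
    show "s \<in> open_strands E (insert {p, q} F) \<longleftrightarrow> s \<in> open_strands (contract p q E) F"
      using m open_strandsE[of s E "insert {p, q} F"] open_strandsE[of s "contract p q E" F] by metis
  qed
qed

end

text \<open>Attaches the strands of \<open>F\<close> one by one, with \<open>E\<close> generalized
  because each strand contracts it. The many premises of the step are the side conditions of
  contraction, supplied once instead of in every induction.\<close>

lemma matching_insert_induct [consumes 4, case_names empty insert]:
  assumes "finite F" "matching F" "\<Union>F \<subseteq> \<Union>E" "matching E"
    and "\<And>E. matching E \<Longrightarrow> P E {}"
    and "\<And>E F p q. matching E \<Longrightarrow> matching (insert {p, q} F) \<Longrightarrow> {p, q} \<notin> F \<Longrightarrow> p \<in> \<Union>E \<Longrightarrow> q \<in> \<Union>E \<Longrightarrow>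
       finite F \<Longrightarrow> \<Union>F \<subseteq> \<Union>(contract p q E) \<Longrightarrow> \<Union>F \<subseteq> \<Union>E \<Longrightarrow> matching (contract p q E) \<Longrightarrow>
       \<Union>(contract p q E) = \<Union>E - {p, q} \<Longrightarrow>
       P (contract p q E) F \<Longrightarrow> P E (insert {p, q} F)"
  shows "P E F"
  using assms(1-4)
proof (induction F arbitrary: E rule: finite_induct)
  case empty
  then show ?case using assms(5) by simp
next
  case (insert s F)
  then obtain p q where s: "s = {p, q}" unfolding matching_def by (meson card_2_iff insertI1)
  note d = matching_insertD[OF insert.prems(1)[unfolded s] insert.hyps(2)[unfolded s]]
  have pqE: "p \<in> \<Union>E" "q \<in> \<Union>E" using insert.prems(2) s by auto
  have U: "\<Union>(contract p q E) = \<Union>E - {p, q}" by (rule Union_contract[OF insert.prems(3) d(1) pqE])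
  have m: "matching (contract p q E)" by (rule matching_contract[OF insert.prems(3) d(1)])
  have FE: "\<Union>F \<subseteq> \<Union>E" using insert.prems(2) by auto
  have FE': "\<Union>F \<subseteq> \<Union>(contract p q E)" unfolding U using FE d by auto
  show ?case unfolding s
    by (rule assms(6)[OF insert.prems(3) insert.prems(1)[unfolded s] insert.hyps(2)[unfolded s] pqE insert.hyps(1) FE' FE m U insert.IH[OF d(4) FE' m]])
qed

lemma matching_open_strands:
  assumes "finite F" "matching F" "\<Union>F \<subseteq> \<Union>E" "matching E"
  shows "matching (open_strands E F)" "\<Union>(open_strands E F) = \<Union>E - \<Union>F"
proof -
  have "matching (open_strands E F) \<and> \<Union>(open_strands E F) = \<Union>E - \<Union>F"
    using assms
  proof (induction rule: matching_insert_induct)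
    case (empty E)
    then show ?case by (simp add: open_strands_empty)
  next
    case (insert E F p q)
    then show ?case using open_strands_insert[of E p q F] by auto
  qed
  then show "matching (open_strands E F)" "\<Union>(open_strands E F) = \<Union>E - \<Union>F" by auto
qed

text \<open>\<open>open_strands_insert\<close> attaches the new strand before the rest of
  \<open>F\<close>, this lemma afterwards. Equating the two lets a cap on the left of a diagram
  commute with gluing on its right.\<close>

lemma open_strands_add:
  assumes "finite F" "matching F" "\<Union>F \<subseteq> \<Union>E" "matching E"
    and "u \<in> \<Union>E - \<Union>F" "v \<in> \<Union>E - \<Union>F" "u \<noteq> v"
  shows "open_strands E (insert {u, v} F) = contract u v (open_strands E F)"
  using assms
proof (induction rule: matching_insert_induct)
  case (empty E)
  have m: "matching {{u, v}}" using empty by (simp add: matching_def)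
  have "open_strands (contract u v E) {} = contract u v E"
    using empty by (intro open_strands_empty matching_contract)
  then show ?case using empty open_strands_insert[of E u v "{}"] m by (simp add: open_strands_empty)
next
  case (insert E F p q)
  have uv: "u \<notin> {p, q}" "v \<notin> {p, q}" "{u, v} \<notin> F" "{u, v} \<noteq> {p, q}"
    using insert.prems by auto
  have m: "matching (insert {p, q} (insert {u, v} F))"
    using insert.hyps(2) insert.prems unfolding matching_def
    by (auto simp: disjoint_def)
  have "{p, q} \<notin> insert {u, v} F" using insert.hyps(3) uv by auto
  then have "open_strands E (insert {p, q} (insert {u, v} F)) = open_strands (contract p q E) (insert {u, v} F)"
    using open_strands_insert[OF insert.hyps(1) m _ insert.hyps(4,5)] by blast
  also have "\<dots> = contract u v (open_strands (contract p q E) F)"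
    using insert.IH insert.prems insert.hyps uv by auto
  also have "open_strands (contract p q E) F = open_strands E (insert {p, q} F)"
    using open_strands_insert[OF insert.hyps(1-5)] by simp
  finally show ?case by (simp add: insert_commute)
qed

lemma num_loops_add:
  assumes "finite F" "matching F" "\<Union>F \<subseteq> \<Union>E" "matching E"
    and "finite (\<Union>E)" "u \<in> \<Union>E - \<Union>F" "v \<in> \<Union>E - \<Union>F" "u \<noteq> v"
  shows "num_loops E (insert {u, v} F) = num_loops E F + of_bool ({u, v} \<in> open_strands E F)"
  using assms
proof (induction rule: matching_insert_induct)
  case (empty E)
  have m: "matching {{u, v}}" using empty by (simp add: matching_def)
  show ?case using empty num_loops_insert[of E u v "{}"] m by (simp add: open_strands_empty num_loops_empty)
next
  case (insert E F p q)
  have uv: "u \<notin> {p, q}" "v \<notin> {p, q}" "{u, v} \<notin> F" "{u, v} \<noteq> {p, q}"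
    using insert.prems by auto
  have m: "matching (insert {p, q} (insert {u, v} F))"
    using insert.hyps(2) insert.prems unfolding matching_def
    by (auto simp: disjoint_def)
  have "{p, q} \<notin> insert {u, v} F" using insert.hyps(3) uv by auto
  moreover have "\<Union>(insert {u, v} F) \<subseteq> \<Union>E" using insert by auto
  ultimately have "num_loops E (insert {p, q} (insert {u, v} F))
      = num_loops (contract p q E) (insert {u, v} F) + of_bool ({p, q} \<in> E)"
    using num_loops_insert[OF insert.hyps(1) m _ insert.hyps(4,5)] insert.prems(1) by blast
  also have "num_loops (contract p q E) (insert {u, v} F) =
      num_loops (contract p q E) F + of_bool ({u, v} \<in> open_strands (contract p q E) F)"
    using insert.IH insert.prems insert.hyps uv by auto
  also have "open_strands (contract p q E) F = open_strands E (insert {p, q} F)"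
    using open_strands_insert[OF insert.hyps(1-5)] by simp
  finally show ?case
    using num_loops_insert[OF insert.hyps(1-5) insert.prems(1) insert.hyps(8)] by (simp add: insert_commute)
qed

text \<open>A strand closes at most one loop when it is attached, and only if it is a strand of the
  current \<open>E\<close>. In the equality case every strand does so; contraction then merely
  deletes strands, so all of \<open>F\<close> lies in the original \<open>E\<close>.\<close>

lemma num_loops_le_card:
  assumes "finite F" "matching F" "\<Union>F \<subseteq> \<Union>E" "matching E" "finite (\<Union>E)"
  shows "num_loops E F \<le> card F" "num_loops E F = card F \<Longrightarrow> F \<subseteq> E"
proof -
  have "num_loops E F \<le> card F \<and> (num_loops E F = card F \<longrightarrow> F \<subseteq> E)"
    using assms
  proof (induction rule: matching_insert_induct)
    case (empty E)
    then show ?case by (simp add: num_loops_empty)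
  next
    case (insert E F p q)
    have n: "num_loops E (insert {p, q} F) = num_loops (contract p q E) F + of_bool ({p, q} \<in> E)"
      by (rule num_loops_insert[OF insert.hyps(1-5) insert.prems insert.hyps(8)])
    have IH: "num_loops (contract p q E) F \<le> card F" "num_loops (contract p q E) F = card F \<longrightarrow> F \<subseteq> contract p q E"
      using insert.IH insert.prems insert.hyps by auto
    have "p \<noteq> q" using matching_neq[OF insert.hyps(2)] by simp
    then have "{p, q} \<in> E \<Longrightarrow> contract p q E \<subseteq> E" using contract_edge[OF insert.hyps(1)] by auto
    then show ?case using n IH insert.hyps(3,6) by (cases "{p, q} \<in> E") auto
  qed
  then show "num_loops E F \<le> card F" "num_loops E F = card F \<Longrightarrow> F \<subseteq> E" by auto
qed

lemma num_loops_subset: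
  assumes "finite F" "F \<subseteq> E" "matching E" "finite (\<Union>E)"
  shows "num_loops E F = card F" "open_strands E F = E - F"
proof -
  have "num_loops E F = card F \<and> open_strands E F = E - F"
    using assms
  proof (induction F arbitrary: E rule: finite_induct)
    case empty
    then show ?case by (simp add: num_loops_empty open_strands_empty)
  next
    case (insert s F)
    then obtain p q where s: "s = {p, q}" unfolding matching_def by (meson card_2_iff insert_subset)
    have m: "matching (insert {p, q} F)" using insert.prems s matching_subset by blast
    have pqF: "{p, q} \<notin> F" using insert.hyps s by simp
    note d = matching_insertD[OF m pqF]
    have pqE: "p \<in> \<Union>E" "q \<in> \<Union>E" "{p, q} \<in> E" using insert.prems s by auto
    have c: "contract p q E = E - {{p, q}}" by (rule contract_edge[OF insert.prems(2) d(1) pqE(3)])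
    have "F \<subseteq> E - {{p, q}}" using insert.prems(1) pqF by auto
    then have IH: "num_loops (contract p q E) F = card F" "open_strands (contract p q E) F = E - {{p, q}} - F"
      using insert.IH[of "contract p q E"] insert.prems matching_contract[OF insert.prems(2) d(1)]
      unfolding c by (auto intro: finite_subset)
    have FE: "\<Union>F \<subseteq> \<Union>E" using insert.prems by auto
    show ?case unfolding s
      using num_loops_insert[OF insert.prems(2) m pqF pqE(1,2) insert.prems(3) FE] pqE(3)
        open_strands_insert[OF insert.prems(2) m pqF pqE(1,2)] IH insert.hyps s by auto
  qed
  then show "num_loops E F = card F" "open_strands E F = E - F" by auto
qed

subsection \<open>Planar diagrams\<close>

definition planar :: "('a \<Rightarrow> nat) \<Rightarrow> 'a set set \<Rightarrow> bool" where
  "planar pos E \<longleftrightarrow> (\<forall>a b c d. {a, c} \<in> E \<longrightarrow> {b, d} \<in> E \<longrightarrow> pos a < pos b \<longrightarrow> pos b < pos c \<longrightarrow> \<not> pos c < pos d)"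

definition half_diagram :: "nat set \<Rightarrow> nat set set \<Rightarrow> bool" where
  "half_diagram S x \<longleftrightarrow> matching x \<and> \<Union>x \<subseteq> S \<and> planar id x \<and>
     (\<forall>a b p. {a, b} \<in> x \<longrightarrow> p \<in> S - \<Union>x \<longrightarrow> a < p \<longrightarrow> \<not> p < b)"

text \<open>The left and right points may be any subsets of \<open>{1..m}\<close> while
  \<open>m\<close> stays fixed: points removed by contraction leave gaps, and the others keep their
  boundary positions.\<close>

definition rect_diagram :: "nat \<Rightarrow> nat set \<Rightarrow> nat set \<Rightarrow> point set set \<Rightarrow> bool" where
  "rect_diagram m S T D \<longleftrightarrow> matching D \<and> \<Union>D = Lft ` S \<union> Rgt ` T \<and> planar (boundary_pos m) D"

definition left_part :: "point set set \<Rightarrow> nat set set" where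
  "left_part I = {{i, j} | i j. {Lft i, Lft j} \<in> I}"

definition half_diagrams :: "nat set \<Rightarrow> nat \<Rightarrow> nat set set set" where
  "half_diagrams S k = {x. half_diagram S x \<and> card (S - \<Union>x) = 2 * k}"

lemma planarD:
  "planar pos E \<Longrightarrow> {a, c} \<in> E \<Longrightarrow> {b, d} \<in> E \<Longrightarrow> pos a < pos b \<Longrightarrow> pos b < pos c \<Longrightarrow> pos c < pos d \<Longrightarrow> False"
  unfolding planar_def by blast

lemma planar_subset: "planar pos E \<Longrightarrow> F \<subseteq> E \<Longrightarrow> planar pos F"
  unfolding planar_def by blast

lemma planar_between:
  assumes "planar pos E" "{a, c} \<in> E" "{b, d} \<in> E" "pos a < pos b" "pos b < pos c"
  shows "pos a \<le> pos d" "pos d \<le> pos c"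
proof -
  show "pos d \<le> pos c" using planarD[OF assms] by (meson not_le)
  have "{d, b} \<in> E" using assms(3) by (simp only: insert_commute)
  then show "pos a \<le> pos d" using planarD[of pos E d b a c] assms by (meson not_le)
qed

lemma noncrossing_image_iff:
  assumes "matching E" "inj_on pos (\<Union>E)"
  shows "noncrossing ((`) pos ` E) \<longleftrightarrow> planar pos E"
proof
  assume nc: "noncrossing ((`) pos ` E)"
  show "planar pos E" unfolding planar_def
  proof (intro allI impI notI)
    fix a b c d assume *: "{a, c} \<in> E" "{b, d} \<in> E" "pos a < pos b" "pos b < pos c" "pos c < pos d"
    let ?A = "pos ` {a, c}" and ?B = "pos ` {b, d}"
    have "?A \<noteq> ?B" using *(3-5) by auto
    moreover have "?A \<in> (`) pos ` E" "?B \<in> (`) pos ` E" using *(1,2) by blast+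
    moreover have "pos a \<in> ?A" "pos c \<in> ?A" "pos b \<in> ?B" "pos d \<in> ?B" by auto
    ultimately show False using nc *(3-5) unfolding noncrossing_def by meson
  qed
next
  assume pl: "planar pos E"
  show "noncrossing ((`) pos ` E)" unfolding noncrossing_def
  proof (intro ballI impI notI)
    fix A B assume AB: "A \<in> (`) pos ` E" "B \<in> (`) pos ` E" "A \<noteq> B"
      "\<exists>a b c d. a < b \<and> b < c \<and> c < d \<and> a \<in> A \<and> c \<in> A \<and> b \<in> B \<and> d \<in> B"
    then obtain s t where st: "s \<in> E" "A = pos ` s" "t \<in> E" "B = pos ` t" by blast
    with AB(4) obtain a b c d where p: "a \<in> s" "c \<in> s" "b \<in> t" "d \<in> t"
      "pos a < pos b" "pos b < pos c" "pos c < pos d" by (elim exE conjE) blast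
    obtain a' where "s = {a, a'}" using matching_edge[OF assms(1) st(1) p(1)] by blast
    then have s: "{a, c} \<in> E" using st(1) p by auto
    obtain b' where "t = {b, b'}" using matching_edge[OF assms(1) st(3) p(3)] by blast
    then have "{b, d} \<in> E" using st(3) p by auto
    then show False using planarD[OF pl s _ p(5-7)] by blast
  qed
qed

text \<open>Suppose a new strand, made of \<open>{u, r}\<close> and \<open>{v, s}\<close> with
  \<open>{r, s} = {p, q}\<close>, crosses an old strand \<open>{x, y}\<close>. By planarity
  \<open>r\<close> lies on the side of \<open>u\<close> and \<open>s\<close> on the side of
  \<open>v\<close>, so \<open>x\<close> or \<open>y\<close> lies between \<open>p\<close> and
  \<open>q\<close>, where adjacency allows no point.\<close>

lemma planar_contract:
  assumes D: "matching D" and inj: "inj_on pos (\<Union>D)" and pq: "p \<noteq> q" "p \<in> \<Union>D" "q \<in> \<Union>D"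
    and adj: "\<And>r. r \<in> \<Union>D \<Longrightarrow> pos p < pos r \<Longrightarrow> pos r < pos q \<Longrightarrow> False"
      "\<And>r. r \<in> \<Union>D \<Longrightarrow> pos q < pos r \<Longrightarrow> pos r < pos p \<Longrightarrow> False"
    and pl: "planar pos D"
  shows "planar pos (contract p q D)"
  unfolding planar_def
proof (intro allI impI notI)
  fix a b c d
  assume *: "{a, c} \<in> contract p q D" "{b, d} \<in> contract p q D" and o: "pos a < pos b" "pos b < pos c" "pos c < pos d"
  note av = contract_avoid[OF D pq(1) *(1)] contract_avoid[OF D pq(1) *(2)]
  have U: "a \<in> \<Union>D" "b \<in> \<Union>D" "c \<in> \<Union>D" "d \<in> \<Union>D"
    using Union_contract_subset[OF D pq(1)] * by auto
  have ne: "pos x \<noteq> pos y" if "x \<in> \<Union>D" "y \<in> \<Union>D" "x \<noteq> y" for x y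
    using inj_onD[OF inj _ that(1,2)] that(3) by blast
  have npq: "pos x \<noteq> pos p" "pos x \<noteq> pos q" if "x \<in> {a, b, c, d}" for x
    using that ne[OF _ pq(2)] ne[OF _ pq(3)] U av by blast+
  have cross: False
    if e: "{x, y} \<in> D" and n: "{u, r} \<in> D" "{v, s} \<in> D" "{r, s} = {p, q}"
      and x: "x \<in> {a, b, c, d}" "y \<in> {a, b, c, d}"
      and u: "pos x < pos u" "pos u < pos y" and v: "pos v < pos x \<or> pos y < pos v" for x y u v r s
  proof -
    have rs: "r = p \<and> s = q \<or> r = q \<and> s = p" using n(3) by (simp only: doubleton_eq_iff)
    have "pos x \<le> pos r" "pos r \<le> pos y" using planar_between[OF pl e n(1) u] by auto
    moreover have "pos x \<noteq> pos r" "pos y \<noteq> pos r" using rs npq x by metis+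
    ultimately have r: "pos x < pos r" "pos r < pos y" by auto
    have "\<not> (pos x < pos s \<and> pos s < pos y)"
    proof
      assume s: "pos x < pos s \<and> pos s < pos y"
      have "{s, v} \<in> D" using n(2) by (simp only: insert_commute)
      from planar_between[OF pl e this] s v show False by auto
    qed
    moreover have "pos x \<noteq> pos s" "pos y \<noteq> pos s" using rs npq x by metis+
    ultimately consider "pos s < pos x" | "pos y < pos s" by linarith
    moreover have xy: "x \<in> \<Union>D" "y \<in> \<Union>D" using U x by auto
    ultimately show False
      using r rs adj[OF xy(1)] adj[OF xy(2)] by (metis order.strict_trans)
  qed
  from *(1) have 1: "{a, c} \<in> D \<or> {a, p} \<in> D \<and> {c, q} \<in> D \<or> {c, p} \<in> D \<and> {a, q} \<in> D"
    unfolding mem_contract[OF D av(1-4)] .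
  from *(2) have 2: "{b, d} \<in> D \<or> {b, p} \<in> D \<and> {d, q} \<in> D \<or> {d, p} \<in> D \<and> {b, q} \<in> D"
    unfolding mem_contract[OF D av(6-9)] .
  show False
  proof (cases "{a, c} \<in> D")
    case True
    show False
    proof (cases "{b, d} \<in> D")
      case b: True
      show False by (rule planarD[OF pl True b o])
    next
      case False
      with 2 show False
        using cross[OF True, of b p d q] cross[OF True, of b q d p] o by (auto simp: doubleton_eq_iff)
    qed
  next
    case False
    show False
    proof (cases "{b, d} \<in> D")
      case b: True
      from False 1 show False
        using cross[OF b, of c p a q] cross[OF b, of c q a p] o by (auto simp: doubleton_eq_iff)
    next
      case b: False
      \<comment> \<open>Two strands that are both new come from the same pair of old strands, so
        they share an end point, which the strict order excludes.\<close>
      have "a = b \<or> a = d" using False b 1 2 matching_unique'(3)[OF D, of a p b] matching_unique'(3)[OF D, of a p d]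
        matching_unique'(3)[OF D, of a q b] matching_unique'(3)[OF D, of a q d] by blast
      then show False using o by auto
    qed
  qed
qed

lemma inj_on_boundary_pos:
  assumes "S \<subseteq> {1..m}" "T \<subseteq> {1..m}"
  shows "inj_on (boundary_pos m) (Lft ` S \<union> Rgt ` T)"
proof (rule inj_onI)
  fix a b assume ab: "a \<in> Lft ` S \<union> Rgt ` T" "b \<in> Lft ` S \<union> Rgt ` T" "boundary_pos m a = boundary_pos m b"
  have "i \<le> m \<and> 1 \<le> i" if "a = Lft i \<or> a = Rgt i \<or> b = Lft i \<or> b = Rgt i" for i
    using ab(1,2) assms that by auto
  then show "a = b" using ab(3) by (cases a; cases b) fastforce+
qed

lemma rect_diagramD:
  assumes "rect_diagram m S T D"
  shows "matching D" "\<Union>D = Lft ` S \<union> Rgt ` T" "planar (boundary_pos m) D"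
  using assms unfolding rect_diagram_def by auto

lemma half_diagramD:
  assumes "half_diagram S x"
  shows "matching x" "\<Union>x \<subseteq> S" "planar id x"
    "\<And>a b p. {a, b} \<in> x \<Longrightarrow> p \<in> S \<Longrightarrow> p \<notin> \<Union>x \<Longrightarrow> a < p \<Longrightarrow> p < b \<Longrightarrow> False"
  using assms unfolding half_diagram_def by auto

context
  fixes m p q :: nat and S T :: "nat set" and D
  assumes D: "rect_diagram m S T D" and ST: "S \<subseteq> {1..m}" "T \<subseteq> {1..m}" and pq: "p < q"
begin

text \<open>Consecutive elements of \<open>T\<close> are neighbours on the whole boundary, since
  right points occupy the positions above \<open>m\<close>. Walking up the right line reverses the
  order, so \<open>q\<close> comes before \<open>p\<close>.\<close>

lemma rect_diagram_contract_Rgt: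
  assumes "p \<in> T" "q \<in> T" "\<And>r. r \<in> T \<Longrightarrow> p < r \<Longrightarrow> r < q \<Longrightarrow> False"
  shows "rect_diagram m S (T - {p, q}) (contract (Rgt p) (Rgt q) D)"
proof -
  note d = rect_diagramD[OF D]
  have pqD: "Rgt p \<noteq> Rgt q" "Rgt p \<in> \<Union>D" "Rgt q \<in> \<Union>D" using pq assms d(2) by auto
  have "planar (boundary_pos m) (contract (Rgt p) (Rgt q) D)"
  proof (rule planar_contract[OF d(1) _ pqD _ _ d(3)])
    show "inj_on (boundary_pos m) (\<Union>D)" unfolding d(2) by (rule inj_on_boundary_pos[OF ST])
    have r: "False" if r: "r \<in> \<Union>D" "2 * m + 1 - q < boundary_pos m r" "boundary_pos m r < 2 * m + 1 - p" for r
    proof -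
      have pm: "q \<le> m" "p \<le> m" using assms ST by auto
      from r(1) consider i where "r = Lft i" "i \<le> m" | t where "r = Rgt t" "t \<in> T" "t \<le> m" unfolding d(2) using ST by fastforce
      then show False
      proof cases
        case 1 then show False using r(2) pm by simp
      next
        case 2
        have "p < t" using r(3) pm unfolding 2(1) boundary_pos.simps by arith
        moreover have "t < q" using r(2) pm unfolding 2(1) boundary_pos.simps by arith
        ultimately have "p < t" "t < q" .
        then show False using assms(3) 2(2) by blast
      qed
    qed
    show "boundary_pos m (Rgt p) < boundary_pos m r \<Longrightarrow> boundary_pos m r < boundary_pos m (Rgt q) \<Longrightarrow> False"
      for r using pq by simp
    show "r \<in> \<Union>D \<Longrightarrow> boundary_pos m (Rgt q) < boundary_pos m r \<Longrightarrow> boundary_pos m r < boundary_pos m (Rgt p) \<Longrightarrow> False"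
      for r using r by simp
  qed
  moreover have "\<Union>(contract (Rgt p) (Rgt q) D) = Lft ` S \<union> Rgt ` (T - {p, q})"
    unfolding Union_contract[OF d(1) pqD] d(2) by auto
  ultimately show ?thesis unfolding rect_diagram_def using matching_contract[OF d(1) pqD(1)] by simp
qed

lemma rect_diagram_contract_Lft:
  assumes "p \<in> S" "q \<in> S" "\<And>r. r \<in> S \<Longrightarrow> p < r \<Longrightarrow> r < q \<Longrightarrow> False"
  shows "rect_diagram m (S - {p, q}) T (contract (Lft p) (Lft q) D)"
proof -
  note d = rect_diagramD[OF D]
  have pqD: "Lft p \<noteq> Lft q" "Lft p \<in> \<Union>D" "Lft q \<in> \<Union>D" using pq assms d(2) by auto
  have "planar (boundary_pos m) (contract (Lft p) (Lft q) D)"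
  proof (rule planar_contract[OF d(1) _ pqD _ _ d(3)])
    show "inj_on (boundary_pos m) (\<Union>D)" unfolding d(2) by (rule inj_on_boundary_pos[OF ST])
    have r: "False" if r: "r \<in> \<Union>D" "p < boundary_pos m r" "boundary_pos m r < q" for r
    proof -
      have pm: "q \<le> m" "p \<le> m" using assms ST by auto
      from r(1) consider i where "r = Rgt i" "i \<le> m" | t where "r = Lft t" "t \<in> S" "t \<le> m" unfolding d(2) using ST by fastforce
      then show False
      proof cases
        case 1 then show False using r(3) pm by simp
      next
        case 2 then show False using r(2,3) pm assms(3)[of t] by simp
      qed
    qed
    show "boundary_pos m (Lft q) < boundary_pos m r \<Longrightarrow> boundary_pos m r < boundary_pos m (Lft p) \<Longrightarrow> False"
      for r using pq by simp
    show "r \<in> \<Union>D \<Longrightarrow> boundary_pos m (Lft p) < boundary_pos m r \<Longrightarrow> boundary_pos m r < boundary_pos m (Lft q) \<Longrightarrow> False"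
      for r using r by simp
  qed
  moreover have "\<Union>(contract (Lft p) (Lft q) D) = Lft ` (S - {p, q}) \<union> Rgt ` T"
    unfolding Union_contract[OF d(1) pqD] d(2) by auto
  ultimately show ?thesis unfolding rect_diagram_def using matching_contract[OF d(1) pqD(1)] by simp
qed

end

text \<open>A shortest arc works: a point of \<open>S\<close> strictly inside it cannot be a defect,
  and its own arc would be nested and shorter.\<close>

lemma innermost_arc:
  assumes "half_diagram S x" "x \<noteq> {}"
  obtains p q where "p < q" "{p, q} \<in> x" "p \<in> S" "q \<in> S" "\<And>r. r \<in> S \<Longrightarrow> p < r \<Longrightarrow> r < q \<Longrightarrow> False"
proof -
  note h = half_diagramD[OF assms(1)]
  define P where "P n \<longleftrightarrow> (\<exists>p. {p, p + n} \<in> x \<and> 0 < n)" for n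
  have "\<exists>n. P n"
  proof -
    obtain s where "s \<in> x" using assms(2) by blast
    then obtain a b where "{a, b} \<in> x" "a \<noteq> b" using h(1) unfolding matching_def by (metis card_2_iff)
    then have "{min a b, max a b} \<in> x" "min a b < max a b" by (auto simp: min_def max_def insert_commute)
    then have "P (max a b - min a b)" unfolding P_def by (intro exI[of _ "min a b"]) simp
    then show ?thesis by blast
  qed
  then have L: "P (LEAST n. P n)" by (rule LeastI_ex)
  define n where "n = (LEAST n. P n)"
  obtain p where p: "{p, p + n} \<in> x" "0 < n" using L unfolding P_def n_def by blast
  have "False" if r: "r \<in> S" "p < r" "r < p + n" for r
  proof (cases "r \<in> \<Union>x")
    case False
    then show False using h(4)[OF p(1) r(1) _ r(2,3)] by blast
  next
    case True
    then obtain s where s: "s \<noteq> r" "{r, s} \<in> x" by (rule matching_partner[OF h(1)])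
    have "id p \<le> id s" "id s \<le> id (p + n)" using planar_between[OF h(3) p(1) s(2)] r by auto
    then have s2: "p \<le> s" "s \<le> p + n" by auto
    have "{min r s, max r s} \<in> x" "min r s < max r s" using s by (auto simp: min_def max_def insert_commute)
    then have "P (max r s - min r s)" unfolding P_def by (intro exI[of _ "min r s"]) simp
    then have "n \<le> max r s - min r s" unfolding n_def by (rule Least_le)
    then have "s = p \<and> r = p + n \<or> s = p + n \<and> r = p" using r s2 by (auto simp: min_def max_def split: if_splits)
    then show False using r by auto
  qed
  moreover have "p \<in> S" "p + n \<in> S" using p(1) h(2) by auto
  ultimately show ?thesis using that[of p "p + n"] p by auto
qed

lemma half_diagram_remove_arc:
  assumes "half_diagram S x" "{p, q} \<in> x"
  shows "half_diagram (S - {p, q}) (x - {{p, q}})" "\<Union>(x - {{p, q}}) = \<Union>x - {p, q}"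
    "S - {p, q} - \<Union>(x - {{p, q}}) = S - \<Union>x"
proof -
  note h = half_diagramD[OF assms(1)]
  have pq: "p \<noteq> q" using matching_neq[OF h(1) assms(2)] .
  show U: "\<Union>(x - {{p, q}}) = \<Union>x - {p, q}"
    using Union_remove_edge[OF h(1) h(1) pq assms(2)] .
  have pqx: "p \<in> \<Union>x" "q \<in> \<Union>x" using assms(2) by auto
  show "S - {p, q} - \<Union>(x - {{p, q}}) = S - \<Union>x" unfolding U using pqx by auto
  show "half_diagram (S - {p, q}) (x - {{p, q}})" unfolding half_diagram_def U
  proof (intro conjI allI impI notI)
    show "matching (x - {{p, q}})" using matching_subset[OF h(1)] by blast
    show "planar id (x - {{p, q}})" using planar_subset[OF h(3)] by blast
    show "\<Union>x - {p, q} \<subseteq> S - {p, q}" using h(2) by blast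
    show False if "{a, b} \<in> x - {{p, q}}" "r \<in> S - {p, q} - (\<Union>x - {p, q})" "a < r" "r < b" for a b r
      using that h(4)[of a b r] by blast
  qed
qed

lemma image_Rgt_matching: "matching x \<Longrightarrow> matching ((`) Rgt ` x)"
  by (rule matching_image) (auto simp: inj_on_def)

lemma Rgt_image_insert:
  assumes "{p, q} \<in> x"
  shows "(`) Rgt ` x = insert {Rgt p, Rgt q} ((`) Rgt ` (x - {{p, q}}))"
proof -
  have "(`) Rgt ` insert {p, q} (x - {{p, q}}) = insert {Rgt p, Rgt q} ((`) Rgt ` (x - {{p, q}}))"
    by (simp only: image_insert image_empty)
  then show ?thesis by (simp only: insert_Diff[OF assms])
qed

lemma Rgt_edge_iff: "{Rgt p, Rgt q} \<in> (`) Rgt ` x \<longleftrightarrow> {p, q} \<in> x"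
proof -
  have i: "inj Rgt" by (rule injI) simp
  have "inj ((`) Rgt)" by (rule injI) (simp only: inj_image_eq_iff[OF i])
  from inj_image_mem_iff[OF this, of "{p, q}" x] show ?thesis by simp
qed

text \<open>The arcs of \<open>w\<close> are attached from the inside out. The ends of an innermost
  arc are neighbours in \<open>T\<close>, so contraction preserves planarity, and the argument
  repeats without these two points.\<close>

lemma planar_open_strands:
  assumes "rect_diagram m S T D" "half_diagram T w" "S \<subseteq> {1..m}" "T \<subseteq> {1..m}"
  shows "planar (boundary_pos m) (open_strands D ((`) Rgt ` w))"
proof -
  have "finite w" using half_diagramD(1,2)[OF assms(2)] assms(4) finite_matching by (metis finite_atLeastAtMost finite_subset)
  then show ?thesis using assms
  proof (induction "card w" arbitrary: D T w)
    case 0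
    then have "w = {}" by simp
    then show ?case using open_strands_empty[OF rect_diagramD(1)[OF "0.prems"(2)]] rect_diagramD(3)[OF "0.prems"(2)] by simp
  next
    case (Suc n)
    note h = half_diagramD[OF Suc.prems(3)] and d = rect_diagramD[OF Suc.prems(2)]
    have "w \<noteq> {}" using Suc.hyps(2) by auto
    then obtain p q where pq: "p < q" "{p, q} \<in> w" "p \<in> T" "q \<in> T" "\<And>r. r \<in> T \<Longrightarrow> p < r \<Longrightarrow> r < q \<Longrightarrow> False"
      using innermost_arc[OF Suc.prems(3)] by metis
    let ?w = "w - {{p, q}}"
    have r: "rect_diagram m S (T - {p, q}) (contract (Rgt p) (Rgt q) D)"
      by (rule rect_diagram_contract_Rgt[OF Suc.prems(2,4,5) pq(1,3,4,5)])
    have "planar (boundary_pos m) (open_strands (contract (Rgt p) (Rgt q) D) ((`) Rgt ` ?w))"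
    proof (rule Suc.hyps(1)[OF _ _ r half_diagram_remove_arc(1)[OF Suc.prems(3) pq(2)] Suc.prems(4)])
      show "n = card ?w" using Suc.hyps(2) Suc.prems(1) pq(2) by simp
    qed (use Suc.prems in auto)
    moreover have "{Rgt p, Rgt q} \<notin> (`) Rgt ` ?w" unfolding Rgt_edge_iff by simp
    moreover have "matching (insert {Rgt p, Rgt q} ((`) Rgt ` ?w))"
      using image_Rgt_matching[OF h(1)] unfolding Rgt_image_insert[OF pq(2)] .
    moreover have "Rgt p \<in> \<Union>D" "Rgt q \<in> \<Union>D" using pq d(2) by auto
    ultimately show ?case unfolding Rgt_image_insert[OF pq(2)]
      using open_strands_insert[OF d(1), of "Rgt p" "Rgt q"] by simp
  qed
qed

subsection \<open>Gluing a diagram to a link state\<close>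

text \<open>The action of a diagram on a link state without the scalar and without the truncation to
  \<open>0\<close> when defects are lost.\<close>

definition glue :: "point set set \<Rightarrow> nat set set \<Rightarrow> nat set set" where
  "glue D w = left_part (open_strands D ((`) Rgt ` w))"

lemma left_part_iff [simp]: "{i, j} \<in> left_part I \<longleftrightarrow> {Lft i, Lft j} \<in> I"
proof
  assume "{i, j} \<in> left_part I"
  then obtain a b where ab: "{i, j} = {a, b}" "{Lft a, Lft b} \<in> I"
    unfolding left_part_def by (elim CollectE exE conjE) (rule that)
  then consider "a = i" "b = j" | "a = j" "b = i" by (metis doubleton_eq_iff)
  then show "{Lft i, Lft j} \<in> I" using ab(2) by cases (simp_all only: insert_commute)
next
  assume "{Lft i, Lft j} \<in> I"
  then show "{i, j} \<in> left_part I" unfolding left_part_def by (intro CollectI exI conjI) (rule refl)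
qed

lemma left_partE:
  assumes "s \<in> left_part I"
  obtains i j where "s = {i, j}" "{Lft i, Lft j} \<in> I"
  using assms unfolding left_part_def by (elim CollectE exE conjE) (rule that)

lemma matching_left_part:
  assumes "matching I"
  shows "matching (left_part I)"
proof (rule matchingI)
  fix s assume "s \<in> left_part I"
  then obtain i j where ij: "s = {i, j}" "{Lft i, Lft j} \<in> I" by (rule left_partE)
  then have "i \<noteq> j" using matching_neq[OF assms ij(2)] by simp
  then show "\<exists>a b. a \<noteq> b \<and> s = {a, b}" using ij by blast
next
  fix a b c assume "{a, b} \<in> left_part I" "{a, c} \<in> left_part I"
  then show "b = c" using matching_unique[OF assms, of "Lft a" "Lft b" "Lft c"] by simp
qed

lemma mem_Union_left_part:
  assumes "matching I"
  shows "i \<in> \<Union>(left_part I) \<longleftrightarrow> (\<exists>j. {Lft i, Lft j} \<in> I)"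
proof
  assume "i \<in> \<Union>(left_part I)"
  then obtain j where "j \<noteq> i" "{i, j} \<in> left_part I" by (rule matching_partner[OF matching_left_part[OF assms]])
  then show "\<exists>j. {Lft i, Lft j} \<in> I" by auto
next
  assume "\<exists>j. {Lft i, Lft j} \<in> I"
  then obtain j where "{i, j} \<in> left_part I" by auto
  then show "i \<in> \<Union>(left_part I)" by blast
qed

lemma matching_eqI:
  fixes A B :: "'a set set"
  assumes "matching A" "matching B" "\<And>a b. {a, b} \<in> A \<longleftrightarrow> {a, b} \<in> B"
  shows "A = B"
proof (rule Set.set_eqI)
  fix s
  have "s \<in> C \<Longrightarrow> \<exists>a b. s = {a, b}" if "matching C" for C :: "'a set set"
    using that unfolding matching_def by (metis card_2_iff)
  then show "s \<in> A \<longleftrightarrow> s \<in> B" using assms by metis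
qed

lemma left_part_contract:
  assumes "matching I" "p \<noteq> q"
  shows "left_part (contract (Lft p) (Lft q) I) = contract p q (left_part I)"
proof -
  have pq: "Lft p \<noteq> Lft q" using assms by simp
  show ?thesis
  proof (rule matching_eqI)
    show "matching (left_part (contract (Lft p) (Lft q) I))"
      by (rule matching_left_part[OF matching_contract[OF assms(1) pq]])
    show "matching (contract p q (left_part I))"
      by (rule matching_contract[OF matching_left_part[OF assms(1)] assms(2)])
    fix a b
    show "{a, b} \<in> left_part (contract (Lft p) (Lft q) I) \<longleftrightarrow> {a, b} \<in> contract p q (left_part I)"
    proof (cases "a \<in> {p, q} \<or> b \<in> {p, q}")
      case True
      have "{a, b} \<notin> contract p q (left_part I)"
        using contract_avoid(1-4)[OF matching_left_part[OF assms(1)] assms(2), of a b] True by blast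
      moreover have "{Lft a, Lft b} \<notin> contract (Lft p) (Lft q) I"
        using contract_avoid(1-4)[OF assms(1) pq, of "Lft a" "Lft b"] True by blast
      ultimately show ?thesis by simp
    next
      case False
      then show ?thesis
        using mem_contract[OF assms(1), of "Lft a" "Lft p" "Lft q" "Lft b"]
          mem_contract[OF matching_left_part[OF assms(1)], of a p q b] by simp
    qed
  qed
qed

lemma glue_iff:
  assumes "\<Union>D = Lft ` S \<union> Rgt ` T"
  shows "{i, j} \<in> glue D w \<longleftrightarrow> i \<in> S \<and> j \<in> S \<and> i \<noteq> j \<and> (Lft i, Lft j) \<in> joined (D \<union> (`) Rgt ` w)"
  unfolding glue_def left_part_iff open_strands_iff assms by auto

lemma concat_link_eq_glue:
  assumes "\<Union>D = Lft ` {1..m} \<union> Rgt ` {1..m}"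
  shows "concat_link m D w = glue D w"
proof (rule Set.set_eqI)
  fix s
  have "s \<in> concat_link m D w \<longleftrightarrow> (\<exists>i j. s = {i, j} \<and> {i, j} \<in> glue D w)"
    unfolding concat_link_def glue_iff[OF assms] by (intro iffI CollectI; elim CollectE exE conjE; intro exI conjI; assumption)
  moreover have "s \<in> glue D w \<Longrightarrow> \<exists>i j. s = {i, j}" unfolding glue_def using left_partE by metis
  ultimately show "s \<in> concat_link m D w \<longleftrightarrow> s \<in> glue D w" by metis
qed

lemma finite_half: "half_diagram T w \<Longrightarrow> T \<subseteq> {1..m::nat} \<Longrightarrow> finite w \<and> finite (\<Union>w)"
  using half_diagramD(1,2) finite_matching by (metis finite_atLeastAtMost finite_subset)

text \<open>A left point on no arc of the result is the end of a strand that leaves through a defect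
  of \<open>w\<close>. Distinct such points use distinct defects, which bounds their number, and an
  arc over such a point would cross its strand.\<close>

lemma half_diagram_glue:
  assumes D: "rect_diagram m S T D" and w: "half_diagram T w" and ST: "S \<subseteq> {1..m}" "T \<subseteq> {1..m}"
  shows "half_diagram S (glue D w)" "card (S - \<Union>(glue D w)) \<le> card (T - \<Union>w)"
    "matching (open_strands D ((`) Rgt ` w))"
    "\<Union>(open_strands D ((`) Rgt ` w)) = Lft ` S \<union> Rgt ` (T - \<Union>w)"
proof -
  let ?I = "open_strands D ((`) Rgt ` w)"
  note d = rect_diagramD[OF D] and h = half_diagramD[OF w]
  have fin: "finite ((`) Rgt ` w)" using finite_half[OF w ST(2)] by simp
  have sub: "\<Union>((`) Rgt ` w) \<subseteq> \<Union>D" unfolding d(2) Union_matching_image using h(2) by blast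
  note I = matching_open_strands[OF fin image_Rgt_matching[OF h(1)] sub d(1)]
  show mI: "matching ?I" by (rule I(1))
  show UI: "\<Union>?I = Lft ` S \<union> Rgt ` (T - \<Union>w)" unfolding I(2) d(2) Union_matching_image by auto
  have pl: "planar (boundary_pos m) ?I" by (rule planar_open_strands[OF D w ST])
  note mem = mem_Union_left_part[OF mI, folded glue_def]
  have through: "\<exists>t. {Lft p, Rgt t} \<in> ?I \<and> t \<in> T - \<Union>w" if p: "p \<in> S - \<Union>(glue D w)" for p
  proof -
    have "Lft p \<in> \<Union>?I" unfolding UI using p by blast
    then obtain z where z: "z \<noteq> Lft p" "{Lft p, z} \<in> ?I" by (rule matching_partner[OF mI])
    show ?thesis
    proof (cases z)
      case (Lft j)
      then show ?thesis using z p mem by auto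
    next
      case (Rgt t)
      have "Rgt t \<in> \<Union>?I" using z Rgt by blast
      then show ?thesis using z Rgt unfolding UI by auto
    qed
  qed
  show "half_diagram S (glue D w)" unfolding half_diagram_def
  proof (intro conjI allI impI notI)
    show "matching (glue D w)" unfolding glue_def by (rule matching_left_part[OF mI])
    show "\<Union>(glue D w) \<subseteq> S"
    proof
      fix i assume "i \<in> \<Union>(glue D w)"
      then obtain j where "{Lft i, Lft j} \<in> ?I" unfolding mem by blast
      then have "Lft i \<in> \<Union>?I" by blast
      then show "i \<in> S" unfolding UI by auto
    qed
    show "planar id (glue D w)" unfolding planar_def
    proof (intro allI impI notI)
      fix a b c d assume "{a, c} \<in> glue D w" "{b, d} \<in> glue D w" "id a < id b" "id b < id c" "id c < id d"
      then show False using planarD[OF pl, of "Lft a" "Lft c" "Lft b" "Lft d"] unfolding glue_def by simp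
    qed
    fix a b p assume ab: "{a, b} \<in> glue D w" and p: "p \<in> S - \<Union>(glue D w)" "a < p" "p < b"
    obtain t where t: "{Lft p, Rgt t} \<in> ?I" "t \<in> T - \<Union>w" using through[OF p(1)] by blast
    have "{Lft a, Lft b} \<in> ?I" using ab unfolding glue_def by simp
    \<comment> \<open>The strand at \<open>p\<close> ends on the right line, at a position above
      \<open>m\<close>, whereas the arc ends at \<open>b \<le> m\<close>.\<close>
    from planar_between(2)[OF pl this t(1)] p have "2 * m + 1 - t \<le> b" by simp
    moreover have "t \<le> m" using t ST by auto
    moreover have "b \<in> S" using \<open>\<Union>(glue D w) \<subseteq> S\<close> ab by blast
    then have "b \<le> m" using ST by auto
    ultimately show False by arith
  qed
  define f where "f p = (SOME t. {Lft p, Rgt t} \<in> ?I \<and> t \<in> T - \<Union>w)" for p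
  have f: "{Lft p, Rgt (f p)} \<in> ?I" "f p \<in> T - \<Union>w" if "p \<in> S - \<Union>(glue D w)" for p
    using someI_ex[OF through[OF that]] unfolding f_def by auto
  show "card (S - \<Union>(glue D w)) \<le> card (T - \<Union>w)"
  proof (rule card_inj_on_le)
    show "inj_on f (S - \<Union>(glue D w))"
    proof (rule inj_onI)
      fix p p' assume *: "p \<in> S - \<Union>(glue D w)" "p' \<in> S - \<Union>(glue D w)" "f p = f p'"
      have "{Lft p', Rgt (f p)} \<in> ?I" using f(1)[OF *(2)] *(3) by simp
      from matching_unique'(3)[OF mI f(1)[OF *(1)] this] show "p = p'" by simp
    qed
    show "f ` (S - \<Union>(glue D w)) \<subseteq> T - \<Union>w" using f(2) by blast
    show "finite (T - \<Union>w)" using ST(2) by (meson finite_Diff finite_atLeastAtMost finite_subset)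
  qed
qed

section \<open>Capping two neighbouring points of a half diagram\<close>

lemma contract_unmatched:
  assumes "p \<notin> \<Union>x \<or> q \<notin> \<Union>x"
  shows "contract p q x = {s \<in> x. p \<notin> s \<and> q \<notin> s}"
proof -
  have False if "{a, p} \<in> x" "{b, q} \<in> x" for a b
  proof -
    have "p \<in> \<Union>x" "q \<in> \<Union>x" using that by auto
    then show False using assms by blast
  qed
  then show ?thesis unfolding contract_def by auto
qed

text \<open>If only one of \<open>p\<close>, \<open>q\<close> is matched, its partner turns into a
  defect in exchange for the other. No arc covers this new defect: such an arc would by adjacency
  cover \<open>p\<close> and \<open>q\<close> as well, and one of these is already a defect.\<close>

lemma half_diagram_contract:
  assumes x: "half_diagram S x" and pq: "p < q" "p \<in> S" "q \<in> S" and adj: "\<And>r. r \<in> S \<Longrightarrow> p < r \<Longrightarrow> r < q \<Longrightarrow> False"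
  shows "half_diagram (S - {p, q}) (contract p q x)"
    and "finite S \<Longrightarrow> card (S - {p, q} - \<Union>(contract p q x)) \<le> card (S - \<Union>x)"
proof -
  note h = half_diagramD[OF x]
  have npq: "p \<noteq> q" using pq by simp
  note U = Union_contract_subset[OF h(1) npq]
  show "half_diagram (S - {p, q}) (contract p q x)" unfolding half_diagram_def
  proof (intro conjI allI impI notI)
    show "matching (contract p q x)" by (rule matching_contract[OF h(1) npq])
    show "\<Union>(contract p q x) \<subseteq> S - {p, q}" using U h(2) by blast
    show "planar id (contract p q x)"
    proof (cases "p \<in> \<Union>x \<and> q \<in> \<Union>x")
      case True
      show ?thesis
        by (rule planar_contract[OF h(1) _ npq _ _ _ _ h(3)]) (use True h(2) adj pq in \<open>auto dest: adj\<close>)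
    next
      case False
      then show ?thesis using planar_subset[OF h(3)] contract_unmatched[of p x q] by auto
    qed
    fix a b r assume ab: "{a, b} \<in> contract p q x" and r: "r \<in> S - {p, q} - \<Union>(contract p q x)" "a < r" "r < b"
    note av = contract_avoid[OF h(1) npq ab]
    have "a \<in> \<Union>x" "b \<in> \<Union>x" using U ab by auto
    then have abS: "a \<in> S" "b \<in> S" using h(2) by auto
    have rS: "r \<in> S" "r \<noteq> p" "r \<noteq> q" using r by auto
    show False
    proof (cases "{a, b} \<in> x")
      case True
      show False
      proof (cases "r \<in> \<Union>x")
        case False
        then show False using h(4)[OF True rS(1)] r by blast
      next
        case rx: True
        obtain z where z: "z \<noteq> r" "{r, z} \<in> x" using rx by (rule matching_partner[OF h(1)])
        have zpq: "z = p \<or> z = q"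
        proof (rule ccontr)
          assume "\<not> (z = p \<or> z = q)"
          then have "{r, z} \<in> contract p q x" using rS z by (intro contract_oldI) auto
          then show False using r(1) by blast
        qed
        have "\<not> (p \<in> \<Union>x \<and> q \<in> \<Union>x)"
        proof
          assume "p \<in> \<Union>x \<and> q \<in> \<Union>x"
          then have "\<Union>(contract p q x) = \<Union>x - {p, q}" using Union_contract[OF h(1) npq] by blast
          then show False using r(1) rx by blast
        qed
        moreover have "a < p \<and> p < b \<and> a < q \<and> q < b"
        proof -
          have "id a \<le> id z" "id z \<le> id b" using planar_between[OF h(3) True z(2)] r by auto
          then have "a < z" "z < b" using zpq av by auto
          moreover have "\<not> (p < a \<and> a < q)" "\<not> (p < b \<and> b < q)" using adj abS by blast+
          ultimately show ?thesis using zpq pq(1) av by auto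
        qed
        ultimately show False using h(4)[OF True pq(2)] h(4)[OF True pq(3)] by blast
      qed
    next
      case False
      with ab have new: "{a, p} \<in> x \<and> {b, q} \<in> x \<or> {b, p} \<in> x \<and> {a, q} \<in> x"
        unfolding mem_contract[OF h(1) av(1-4)] by blast
      then have "p \<in> \<Union>x \<and> q \<in> \<Union>x" by auto
      then have "\<Union>(contract p q x) = \<Union>x - {p, q}" using Union_contract[OF h(1) npq] by blast
      then have rx: "r \<notin> \<Union>x" using r(1) by blast
      have ro: "r < p \<or> q < r" using adj[OF rS(1)] rS(2,3) by (meson linorder_neqE_nat)
      from new show False
      proof (elim disjE conjE)
        assume e: "{a, p} \<in> x" "{b, q} \<in> x"
        have "{q, b} \<in> x" using e(2) by (simp only: insert_commute)
        then show False using ro h(4)[OF e(1) rS(1) rx r(2)] h(4)[OF _ rS(1) rx _ r(3)] by blast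
      next
        assume e: "{b, p} \<in> x" "{a, q} \<in> x"
        have "{p, b} \<in> x" using e(1) by (simp only: insert_commute)
        then show False using ro pq(1) h(4)[OF e(2) rS(1) rx r(2)] h(4)[OF _ rS(1) rx _ r(3), of p]
          by (meson order.strict_trans)
      qed
    qed
  qed
  assume fin: "finite S"
  show "card (S - {p, q} - \<Union>(contract p q x)) \<le> card (S - \<Union>x)"
  proof (cases "p \<in> \<Union>x \<and> q \<in> \<Union>x")
    case True
    then have "\<Union>(contract p q x) = \<Union>x - {p, q}" using Union_contract[OF h(1) npq] by blast
    then have "S - {p, q} - \<Union>(contract p q x) \<subseteq> S - \<Union>x" by blast
    then show ?thesis using fin by (intro card_mono) simp_all
  next
    case False
    have c: "contract p q x = {s \<in> x. p \<notin> s \<and> q \<notin> s}" by (rule contract_unmatched) (use False in blast)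
    \<comment> \<open>Here \<open>v\<close> is the unmatched one of the two points and
      \<open>a\<close> the partner of the other one, \<open>u\<close>: the new defects are among the
      old ones with \<open>v\<close> replaced by \<open>a\<close>.\<close>
    have un: "card (S - {p, q} - \<Union>(contract p q x)) \<le> card (S - \<Union>x)"
      if a: "{u, a} \<in> x" and v: "v \<notin> \<Union>x" "u = p \<and> v = q \<or> u = q \<and> v = p" for a u v
    proof -
      have sub: "r \<in> insert a (S - \<Union>x - {v})" if r: "r \<in> S - {p, q} - \<Union>(contract p q x)" for r
      proof (cases "r \<in> \<Union>x")
        case False
        then show ?thesis using r v(2) by blast
      next
        case True
        then obtain s where s: "s \<in> x" "r \<in> s" by blast
        have "s \<notin> contract p q x" using r s(2) by blast
        then have "p \<in> s \<or> q \<in> s" unfolding c using s(1) by simp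
        moreover have "v \<notin> s" using s(1) v(1) by blast
        ultimately have "u \<in> s" using v(2) by auto
        then have "s = {u, a}" by (rule matching_unique_set[OF h(1) s(1) a _ insertI1])
        then show ?thesis using s(2) r v(2) by auto
      qed
      have "card (S - {p, q} - \<Union>(contract p q x)) \<le> card (insert a (S - \<Union>x - {v}))"
        by (rule card_mono) (use fin sub in blast)+
      also have "\<dots> \<le> Suc (card (S - \<Union>x - {v}))" using fin by (simp add: card_insert_if)
      also have "v \<in> S - \<Union>x" using v pq by auto
      then have "Suc (card (S - \<Union>x - {v})) = card (S - \<Union>x)" using fin by (intro card_Suc_Diff1) simp_all
      finally show ?thesis .
    qed
    show ?thesis
    proof (cases "p \<in> \<Union>x")
      case True
      then obtain a where "a \<noteq> p" "{p, a} \<in> x" by (rule matching_partner[OF h(1)])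
      then show ?thesis using un[of p a q] True False by blast
    next
      case p: False
      show ?thesis
      proof (cases "q \<in> \<Union>x")
        case True
        then obtain a where "a \<noteq> q" "{q, a} \<in> x" by (rule matching_partner[OF h(1)])
        then show ?thesis using un[of q a p] p by blast
      next
        case q: False
        have "contract p q x = x" by (rule contract_id[OF p q])
        then have "S - {p, q} - \<Union>(contract p q x) \<subseteq> S - \<Union>x" by blast
        then show ?thesis using fin by (intro card_mono) simp_all
      qed
    qed
  qed
qed

subsection \<open>Joining two half diagrams\<close>

text \<open>As many elements of the image lie below \<open>f a\<close> as elements of
  \<open>A\<close> lie below \<open>a\<close>, so the image alone determines
  \<open>f a\<close>.\<close>

lemma strict_mono_on_image_unique:
  fixes f g :: "nat \<Rightarrow> nat"
  assumes fin: "finite A" and f: "strict_mono_on A f" and g: "strict_mono_on A g" and eq: "f ` A = g ` A" and a: "a \<in> A"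
  shows "f a = g a"
proof -
  have count: "card {s \<in> h ` A. s < h a} = card {r \<in> A. r < a}" if h: "strict_mono_on A h" for h :: "nat \<Rightarrow> nat"
  proof -
    have "{s \<in> h ` A. s < h a} = h ` {r \<in> A. r < a}"
      using strict_mono_on_less[OF h] a by auto
    moreover have "inj_on h {r \<in> A. r < a}"
      by (rule inj_on_subset[OF strict_mono_on_imp_inj_on[OF h]]) auto
    ultimately show ?thesis by (simp add: card_image)
  qed
  have le: False if "h1 a < h2 a" "h1 ` A = h2 ` A" "strict_mono_on A h1" "strict_mono_on A h2" for h1 h2 :: "nat \<Rightarrow> nat"
  proof -
    have "card {s \<in> h1 ` A. s < h1 a} < card {s \<in> h1 ` A. s < h2 a}"
    proof (rule psubset_card_mono)
      show "finite {s \<in> h1 ` A. s < h2 a}" using fin by simp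
      show "{s \<in> h1 ` A. s < h1 a} \<subset> {s \<in> h1 ` A. s < h2 a}" using that(1) a by auto
    qed
    then show False using count[OF that(3)] count[OF that(4)] that(2) by simp
  qed
  show ?thesis using le[of f g] le[of g f] f g eq by (metis linorder_neqE_nat)
qed

lemma ex_order_enumeration:
  fixes M :: "nat set"
  assumes "finite M"
  obtains h where "bij_betw h {1..card M} M" "strict_mono_on {1..card M} h"
proof -
  obtain g where g: "bij_betw g {..<card M} M" "strict_mono_on {..<card M} g"
    by (rule ex_bij_betw_strict_mono_card[OF assms])
  have s: "bij_betw (\<lambda>n. n - 1) {1..card M} {..<card M}"
    by (rule bij_betw_byWitness[of _ Suc]) auto
  have "strict_mono_on {1..card M} (g \<circ> (\<lambda>n. n - 1))"
    by (rule strict_mono_onI) (auto intro!: strict_mono_onD[OF g(2)])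
  then show ?thesis using that[OF bij_betw_trans[OF s g(1)]] by blast
qed

text \<open>\<open>f\<close> is meant to send the defects of \<open>y\<close> increasingly onto
  those of \<open>x\<close>, so that the through strands do not cross.\<close>

definition join_halves :: "nat set \<Rightarrow> nat set set \<Rightarrow> nat set set \<Rightarrow> (nat \<Rightarrow> nat) \<Rightarrow> point set set" where
  "join_halves S y x f = (`) Lft ` y \<union> (`) Rgt ` x \<union> (\<lambda>p. {Lft p, Rgt (f p)}) ` (S - \<Union>y)"

lemma join_halves_cases:
  assumes "s \<in> join_halves S y x f"
  obtains t where "t \<in> y" "s = Lft ` t" | t where "t \<in> x" "s = Rgt ` t"
  | p where "p \<in> S - \<Union>y" "s = {Lft p, Rgt (f p)}"
  using assms unfolding join_halves_def by blast

lemma inj_image_point: "inj ((`) Lft)" "inj ((`) Rgt)"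
proof -
  have i: "inj Lft" "inj Rgt" by (rule injI, simp)+
  show "inj ((`) Lft)" by (rule injI) (simp only: inj_image_eq_iff[OF i(1)])
  show "inj ((`) Rgt)" by (rule injI) (simp only: inj_image_eq_iff[OF i(2)])
qed

lemma join_halves_iff:
  "{Lft i, Lft j} \<in> join_halves S y x f \<longleftrightarrow> {i, j} \<in> y"
  "{Rgt i, Rgt j} \<in> join_halves S y x f \<longleftrightarrow> {i, j} \<in> x"
  "{Lft i, Rgt t} \<in> join_halves S y x f \<longleftrightarrow> i \<in> S - \<Union>y \<and> t = f i"
proof -
  have L: "{Lft i, Lft j} \<in> (`) Lft ` y \<longleftrightarrow> {i, j} \<in> y"
    using inj_image_mem_iff[OF inj_image_point(1), of "{i, j}" y] by simp
  have R: "{Rgt i, Rgt j} \<in> (`) Rgt ` x \<longleftrightarrow> {i, j} \<in> x"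
    using inj_image_mem_iff[OF inj_image_point(2), of "{i, j}" x] by simp
  have "{Lft i, Lft j} \<in> join_halves S y x f \<longleftrightarrow> {Lft i, Lft j} \<in> (`) Lft ` y"
  proof
    assume "{Lft i, Lft j} \<in> join_halves S y x f"
    then show "{Lft i, Lft j} \<in> (`) Lft ` y"
      by (cases rule: join_halves_cases) (auto simp: doubleton_eq_iff dest: equalityD1 equalityD2)
  qed (simp add: join_halves_def)
  then show "{Lft i, Lft j} \<in> join_halves S y x f \<longleftrightarrow> {i, j} \<in> y" using L by simp
  have "{Rgt i, Rgt j} \<in> join_halves S y x f \<longleftrightarrow> {Rgt i, Rgt j} \<in> (`) Rgt ` x"
  proof
    assume "{Rgt i, Rgt j} \<in> join_halves S y x f"
    then show "{Rgt i, Rgt j} \<in> (`) Rgt ` x"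
      by (cases rule: join_halves_cases) (auto simp: doubleton_eq_iff dest: equalityD1 equalityD2)
  qed (simp add: join_halves_def)
  then show "{Rgt i, Rgt j} \<in> join_halves S y x f \<longleftrightarrow> {i, j} \<in> x" using R by simp
  show "{Lft i, Rgt t} \<in> join_halves S y x f \<longleftrightarrow> i \<in> S - \<Union>y \<and> t = f i"
  proof
    assume "{Lft i, Rgt t} \<in> join_halves S y x f"
    then show "i \<in> S - \<Union>y \<and> t = f i"
    proof (cases rule: join_halves_cases)
      case (1 s)
      have "Rgt t \<in> Lft ` s" using 1(2) by blast
      then show ?thesis by auto
    next
      case (2 s)
      have "Lft i \<in> Rgt ` s" using 2(2) by blast
      then show ?thesis by auto
    next
      case (3 p)
      then show ?thesis by (simp add: doubleton_eq_iff)
    qed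
  qed (simp add: join_halves_def)
qed

lemma join_halves_edgeE:
  assumes "matching y" "matching x" "s \<in> join_halves S y x f"
  obtains a b where "a \<noteq> b" "s = {a, b}"
  using assms(3)
proof (cases rule: join_halves_cases)
  case (1 t)
  then obtain a b where "t = {a, b}" "a \<noteq> b" using assms(1) unfolding matching_def by (meson card_2_iff)
  then show ?thesis using that[of "Lft a" "Lft b"] 1 by simp
next
  case (2 t)
  then obtain a b where "t = {a, b}" "a \<noteq> b" using assms(2) unfolding matching_def by (meson card_2_iff)
  then show ?thesis using that[of "Rgt a" "Rgt b"] 2 by simp
next
  case (3 p)
  then show ?thesis using that[of "Lft p" "Rgt (f p)"] by simp
qed

text \<open>In boundary order left points precede right points, so a crossing
  \<open>a < b < c < d\<close> has one of five shapes. All left or all right contradicts planarity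
  of \<open>y\<close> or \<open>x\<close>; three left points put a defect of \<open>y\<close> under
  an arc, three right points a defect of \<open>x\<close>; two of each give through strands that
  violate monotonicity of \<open>f\<close>.\<close>

lemma rect_diagram_join_halves:
  assumes y: "half_diagram S y" and x: "half_diagram T x" and f: "strict_mono_on (S - \<Union>y) f" "f ` (S - \<Union>y) = T - \<Union>x"
    and ST: "S \<subseteq> {1..m}" "T \<subseteq> {1..m}"
  shows "rect_diagram m S T (join_halves S y x f)"
proof -
  let ?D = "join_halves S y x f"
  note hy = half_diagramD[OF y] and hx = half_diagramD[OF x]
  have RL: "{Rgt t, Lft i} \<in> ?D \<longleftrightarrow> i \<in> S - \<Union>y \<and> t = f i" for t i
    using join_halves_iff(3)[of i t S y x f] by (simp only: insert_commute)
  note iff = join_halves_iff[of _ _ S y x f] RL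
  have fx: "f i \<in> T" "f i \<notin> \<Union>x" if "i \<in> S - \<Union>y" for i using f(2) that by auto
  have "matching ?D"
  proof (rule matchingI)
    fix s assume "s \<in> ?D"
    then show "\<exists>a b. a \<noteq> b \<and> s = {a, b}" using join_halves_edgeE[OF hy(1) hx(1)] by metis
  next
    fix a b c assume e: "{a, b} \<in> ?D" "{a, c} \<in> ?D"
    show "b = c"
    proof (cases a)
      case (Lft i)
      show ?thesis
      proof (cases "i \<in> \<Union>y")
        case True
        then obtain j j' where "b = Lft j" "c = Lft j'" using e Lft iff by (cases b; cases c) auto
        then show ?thesis using e Lft iff matching_unique[OF hy(1)] by auto
      next
        case False
        have "{i, j} \<notin> y" for j using False by blast
        then show ?thesis using e Lft iff by (cases b; cases c) auto
      qed
    next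
      case (Rgt t)
      show ?thesis
      proof (cases "t \<in> \<Union>x")
        case True
        then have "b \<noteq> Lft i" "c \<noteq> Lft i" for i using e Rgt iff fx by auto
        then obtain j j' where "b = Rgt j" "c = Rgt j'" by (metis point.exhaust)
        then show ?thesis using e Rgt iff matching_unique[OF hx(1)] by auto
      next
        case False
        have "{t, j} \<notin> x" for j using False by blast
        then have "b \<noteq> Rgt j" "c \<noteq> Rgt j" for j using e Rgt iff by auto
        then obtain j j' where "b = Lft j" "c = Lft j'" by (metis point.exhaust)
        then show ?thesis using e Rgt iff strict_mono_on_imp_inj_on[OF f(1)] by (auto dest: inj_onD)
      qed
    qed
  qed
  moreover have "\<Union>?D = Lft ` S \<union> Rgt ` T"
  proof -
    have "\<Union>?D = Lft ` \<Union>y \<union> Rgt ` \<Union>x \<union> (Lft ` (S - \<Union>y) \<union> Rgt ` f ` (S - \<Union>y))"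
      unfolding join_halves_def by auto
    moreover have "Lft ` \<Union>y \<union> Lft ` (S - \<Union>y) = Lft ` S"
      by (simp only: image_Un[symmetric] Un_Diff_cancel Un_absorb1[OF hy(2)])
    moreover have "Rgt ` \<Union>x \<union> Rgt ` (T - \<Union>x) = Rgt ` T"
      by (simp only: image_Un[symmetric] Un_Diff_cancel Un_absorb1[OF hx(2)])
    ultimately show ?thesis unfolding f(2) by (simp only: Un_ac)
  qed
  moreover have "planar (boundary_pos m) ?D" unfolding planar_def
  proof (intro allI impI notI)
    fix a b c d assume e: "{a, c} \<in> ?D" "{b, d} \<in> ?D"
      and o: "boundary_pos m a < boundary_pos m b" "boundary_pos m b < boundary_pos m c" "boundary_pos m c < boundary_pos m d"
    have U: "v \<in> Lft ` S \<union> Rgt ` T" if "v = a \<or> v = b \<or> v = c \<or> v = d" for v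
      using e that unfolding \<open>\<Union>?D = Lft ` S \<union> Rgt ` T\<close>[symmetric] by blast
    have LR: "boundary_pos m (Lft i) < boundary_pos m (Rgt t)" if "Lft i \<in> {a, b, c, d}" "Rgt t \<in> {a, b, c, d}" for i t
    proof -
      have "i \<in> S" "t \<in> T" using that U[of "Lft i"] U[of "Rgt t"] by auto
      then show ?thesis using ST by fastforce
    qed
    have RR: "t < s" if "boundary_pos m (Rgt s) < boundary_pos m (Rgt t)" for s t
      using that by simp
    show False
    proof (cases d)
      case dL: (Lft d')
      have "\<exists>c'. c = Lft c'" using o(3) dL LR[of d'] by (cases c) fastforce+
      then obtain c' where cL: "c = Lft c'" by blast
      have "\<exists>b'. b = Lft b'" using o(2) cL LR[of c'] by (cases b) fastforce+
      then obtain b' where bL: "b = Lft b'" by blast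
      have "\<exists>a'. a = Lft a'" using o(1) bL LR[of b'] by (cases a) fastforce+
      then obtain a' where aL: "a = Lft a'" by blast
      show False using planarD[OF hy(3), of a' c' b' d'] e o iff aL bL cL dL by auto
    next
      case dR: (Rgt d')
      show False
      proof (cases c)
        case cL: (Lft c')
        have "\<exists>b'. b = Lft b'" using o(2) cL LR[of c'] by (cases b) fastforce+
        then obtain b' where bL: "b = Lft b'" by blast
        have "\<exists>a'. a = Lft a'" using o(1) bL LR[of b'] by (cases a) fastforce+
        then obtain a' where aL: "a = Lft a'" by blast
        show False using hy(4)[of a' c' b'] e o iff aL bL cL dR by auto
      next
        case cR: (Rgt c')
        show False
        proof (cases b)
          case bL: (Lft b')
          have "\<exists>a'. a = Lft a'" using o(1) bL LR[of b'] by (cases a) fastforce+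
          then obtain a' where aL: "a = Lft a'" by blast
          have "a' \<in> S - \<Union>y" "b' \<in> S - \<Union>y" "c' = f a'" "d' = f b'" "a' < b'"
            using e o(1) iff aL bL cR dR by auto
          then have "c' < d'" using strict_mono_onD[OF f(1)] by blast
          moreover have "d' < c'" using RR o(3) cR dR by simp
          ultimately show False by simp
        next
          case bR: (Rgt b')
          have o': "d' < c'" "c' < b'" using RR o(2,3) bR cR dR by simp_all
          have bd: "{d', b'} \<in> x" using e(2) iff bR dR by (simp only: insert_commute)
          show False
          proof (cases a)
            case aL: (Lft a')
            have "c' \<in> T" "c' \<notin> \<Union>x" using e(1) iff aL cR fx by auto
            then show False using hx(4)[OF bd _ _ o'] by blast
          next
            case aR: (Rgt a')
            have "b' < a'" using RR o(1) aR bR by simp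
            moreover have "{c', a'} \<in> x" using e(1) iff aR cR by (simp only: insert_commute)
            ultimately show False using planarD[OF hx(3) bd, of c' a'] o' by simp
          qed
        qed
      qed
    qed
  qed
  ultimately show ?thesis unfolding rect_diagram_def by blast
qed

text \<open>The through strands come from enumerating both sets of defects in increasing
  order.\<close>

lemma join_halves_exists:
  assumes "half_diagram S y" "half_diagram T x" "card (S - \<Union>y) = card (T - \<Union>x)" "S \<subseteq> {1..m}" "T \<subseteq> {1..m}"
  obtains D where "rect_diagram m S T D" "(`) Lft ` y \<subseteq> D" "(`) Rgt ` x \<subseteq> D"
    "\<And>i j. {Lft i, Lft j} \<in> D \<longleftrightarrow> {i, j} \<in> y" "\<And>i j. {Rgt i, Rgt j} \<in> D \<longleftrightarrow> {i, j} \<in> x"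
proof -
  let ?A = "S - \<Union>y" and ?B = "T - \<Union>x"
  have fin: "finite ?A" "finite ?B" using assms(4,5) by (meson finite_Diff finite_atLeastAtMost finite_subset)+
  obtain g where g: "bij_betw g {1..card ?A} ?A" "strict_mono_on {1..card ?A} g"
    by (rule ex_order_enumeration[OF fin(1)])
  obtain h where h: "bij_betw h {1..card ?B} ?B" "strict_mono_on {1..card ?B} h"
    by (rule ex_order_enumeration[OF fin(2)])
  define gi where "gi = inv_into {1..card ?A} g"
  have gi: "gi a \<in> {1..card ?A}" "g (gi a) = a" if "a \<in> ?A" for a
    using bij_betw_apply[OF bij_betw_inv_into[OF g(1)] that] bij_betw_inv_into_right[OF g(1) that]
    unfolding gi_def by blast+
  have "strict_mono_on ?A (h \<circ> gi)"
  proof (rule strict_mono_onI)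
    fix a b assume ab: "a \<in> ?A" "b \<in> ?A" "a < b"
    then have "gi a < gi b" using strict_mono_on_less[OF g(2) gi(1)[OF ab(1)] gi(1)[OF ab(2)]] gi(2) by simp
    then show "(h \<circ> gi) a < (h \<circ> gi) b" using strict_mono_onD[OF h(2)] gi ab assms(3) by simp
  qed
  moreover have "(h \<circ> gi) ` ?A = ?B"
  proof -
    have "gi ` ?A = {1..card ?A}" unfolding gi_def using bij_betw_inv_into[OF g(1)] by (simp add: bij_betw_def)
    then have "(h \<circ> gi) ` ?A = h ` {1..card ?A}" by (simp only: image_comp[symmetric])
    then show ?thesis using h(1) assms(3) by (simp add: bij_betw_def)
  qed
  ultimately have "rect_diagram m S T (join_halves S y x (h \<circ> gi))"
    using rect_diagram_join_halves[OF assms(1,2) _ _ assms(4,5)] by blast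
  moreover have "(`) Lft ` y \<subseteq> join_halves S y x (h \<circ> gi)" "(`) Rgt ` x \<subseteq> join_halves S y x (h \<circ> gi)"
    unfolding join_halves_def by auto
  ultimately show ?thesis using that join_halves_iff(1,2) by metis
qed

text \<open>The arcs fix the free points on both sides, and planarity makes the through strands an
  increasing bijection between them, of which there is only one.\<close>

lemma rect_diagram_unique:
  assumes D: "rect_diagram m S T D" and D': "rect_diagram m S T D'" and ST: "S \<subseteq> {1..m}" "T \<subseteq> {1..m}"
    and L: "\<And>i j. {Lft i, Lft j} \<in> D \<longleftrightarrow> {Lft i, Lft j} \<in> D'"
    and R: "\<And>i j. {Rgt i, Rgt j} \<in> D \<longleftrightarrow> {Rgt i, Rgt j} \<in> D'"
  shows "D = D'"
proof -
  define A where "A = {s \<in> S. \<forall>j. {Lft s, Lft j} \<notin> D}"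
  define B where "B = {t \<in> T. \<forall>j. {Rgt t, Rgt j} \<notin> D}"
  have main: "\<exists>f. strict_mono_on A f \<and> f ` A = B \<and> (\<forall>i t. {Lft i, Rgt t} \<in> E \<longleftrightarrow> i \<in> A \<and> t = f i)"
    if E: "rect_diagram m S T E" "\<And>i j. {Lft i, Lft j} \<in> D \<longleftrightarrow> {Lft i, Lft j} \<in> E"
      "\<And>i j. {Rgt i, Rgt j} \<in> D \<longleftrightarrow> {Rgt i, Rgt j} \<in> E" for E
  proof -
    note d = rect_diagramD[OF E(1)]
    have ex: "\<exists>t. {Lft i, Rgt t} \<in> E" if "i \<in> A" for i
    proof -
      have "Lft i \<in> \<Union>E" using that unfolding d(2) A_def by auto
      then obtain z where "{Lft i, z} \<in> E" by (rule matching_partner[OF d(1)])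
      then show ?thesis using that E(2) unfolding A_def by (cases z) auto
    qed
    define f where "f i = (SOME t. {Lft i, Rgt t} \<in> E)" for i
    have f: "{Lft i, Rgt (f i)} \<in> E" if "i \<in> A" for i using someI_ex[OF ex[OF that]] unfolding f_def .
    have iA: "i \<in> A" "t \<in> B" if "{Lft i, Rgt t} \<in> E" for i t
    proof -
      have "Lft i \<in> \<Union>E" "Rgt t \<in> \<Union>E" using that by auto
      then have "i \<in> S" "t \<in> T" unfolding d(2) by auto
      moreover have "{Lft i, Lft j} \<notin> E" for j using matching_unique[OF d(1) that, of "Lft j"] by blast
      moreover have "{Rgt t, Rgt j} \<notin> E" for j using matching_unique'(2)[OF d(1) that, of "Rgt j"] by blast
      ultimately show "i \<in> A" "t \<in> B" unfolding A_def B_def E(2,3) by auto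
    qed
    have iff: "{Lft i, Rgt t} \<in> E \<longleftrightarrow> i \<in> A \<and> t = f i" for i t
      using f iA(1) matching_unique[OF d(1), of "Lft i" "Rgt t" "Rgt (f i)"] by blast
    moreover have "strict_mono_on A f"
    proof (rule strict_mono_onI)
      fix i j assume ij: "i \<in> A" "j \<in> A" "i < j"
      have "f i \<noteq> f j"
        using f[OF ij(1)] f[OF ij(2)] ij(3) matching_unique'(3)[OF d(1), of "Lft i" "Rgt (f i)" "Lft j"] by auto
      moreover have "\<not> f j < f i"
      proof
        assume lt: "f j < f i"
        have "i \<le> m" "j \<le> m" using ij ST unfolding A_def by auto
        moreover have "f i \<in> B" "f j \<in> B" using f iA ij by blast+
        then have "f i \<le> m" "f j \<le> m" using ST unfolding B_def by auto
        ultimately show False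
          using planarD[OF d(3) f[OF ij(1)] f[OF ij(2)]] ij(3) lt by fastforce
      qed
      ultimately show "f i < f j" by simp
    qed
    moreover have "f ` A = B"
    proof
      show "f ` A \<subseteq> B" using f iA by blast
      show "B \<subseteq> f ` A"
      proof
        fix t assume t: "t \<in> B"
        then have "Rgt t \<in> \<Union>E" unfolding d(2) B_def by auto
        then obtain z where z: "{Rgt t, z} \<in> E" by (rule matching_partner[OF d(1)])
        then obtain i where "z = Lft i" using t E(3) unfolding B_def by (cases z) auto
        then have "{Lft i, Rgt t} \<in> E" using z by (simp only: insert_commute)
        then show "t \<in> f ` A" unfolding iff by blast
      qed
    qed
    ultimately show ?thesis by blast
  qed
  obtain f where f: "strict_mono_on A f" "f ` A = B" "\<And>i t. {Lft i, Rgt t} \<in> D \<longleftrightarrow> i \<in> A \<and> t = f i"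
    using main[OF D] by blast
  obtain f' where f': "strict_mono_on A f'" "f' ` A = B" "\<And>i t. {Lft i, Rgt t} \<in> D' \<longleftrightarrow> i \<in> A \<and> t = f' i"
    using main[OF D' L R] by blast
  have "A \<subseteq> {1..m}" using ST(1) unfolding A_def by blast
  then have "finite A" by (rule finite_subset) simp
  then have ff: "f i = f' i" if "i \<in> A" for i
    using strict_mono_on_image_unique[OF _ f(1) f'(1) _ that] f(2) f'(2) by simp
  have LR: "{Lft i, Rgt t} \<in> D \<longleftrightarrow> {Lft i, Rgt t} \<in> D'" for i t
    unfolding f(3) f'(3) using ff[of i] by (cases "i \<in> A") simp_all
  show ?thesis
  proof (rule matching_eqI[OF rect_diagramD(1)[OF D] rect_diagramD(1)[OF D']])
    fix a b
    show "{a, b} \<in> D \<longleftrightarrow> {a, b} \<in> D'"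
    proof (cases a)
      case a: (Lft i)
      show ?thesis using L LR by (cases b) (auto simp: a)
    next
      case a: (Rgt t)
      show ?thesis
      proof (cases b)
        case (Lft i)
        then have "{a, b} = {Lft i, Rgt t}" unfolding a by (simp only: insert_commute)
        then show ?thesis using LR by simp
      qed (use a R in simp)
    qed
  qed
qed

section \<open>Relabelling half diagrams along increasing maps\<close>

lemma half_diagram_image:
  assumes x: "half_diagram A x" and f: "strict_mono_on A f"
  shows "half_diagram (f ` A) ((`) f ` x)" "f ` A - \<Union>((`) f ` x) = f ` (A - \<Union>x)"
proof -
  note h = half_diagramD[OF x]
  have inj: "inj_on f A" by (rule strict_mono_on_imp_inj_on[OF f])
  have less: "a \<in> A \<Longrightarrow> b \<in> A \<Longrightarrow> f a < f b \<longleftrightarrow> a < b" for a b using strict_mono_on_less[OF f] by blast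
  show D: "f ` A - \<Union>((`) f ` x) = f ` (A - \<Union>x)"
    unfolding Union_matching_image using inj_on_image_set_diff[OF inj _ h(2), of A] by simp
  have m: "matching ((`) f ` x)" by (rule matching_image[OF h(1) inj_on_subset[OF inj h(2)]])
  have pre: "\<exists>a' b'. a = f a' \<and> b = f b' \<and> {a', b'} \<in> x \<and> a' \<in> A \<and> b' \<in> A" if e: "{a, b} \<in> (`) f ` x" for a b
  proof -
    obtain s where s: "s \<in> x" "{a, b} = f ` s" using e by auto
    then obtain c d where cd: "s = {c, d}" "c \<noteq> d" using h(1) unfolding matching_def by (meson card_2_iff)
    have A: "c \<in> A" "d \<in> A" using cd s h(2) by auto
    have "{a, b} = {f c, f d}" using s cd by simp
    then consider "a = f c" "b = f d" | "a = f d" "b = f c" by (metis doubleton_eq_iff)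
    then show ?thesis
    proof cases
      case 1 then show ?thesis using s cd A by blast
    next
      case 2
      moreover have "{d, c} \<in> x" using s(1) cd by (simp add: insert_commute)
      ultimately show ?thesis using A by blast
    qed
  qed
  show "half_diagram (f ` A) ((`) f ` x)" unfolding half_diagram_def
  proof (intro conjI allI impI notI m)
    show "\<Union>((`) f ` x) \<subseteq> f ` A" unfolding Union_matching_image using h(2) by blast
    show "planar id ((`) f ` x)" unfolding planar_def
    proof (intro allI impI notI)
      fix a b c d assume e: "{a, c} \<in> (`) f ` x" "{b, d} \<in> (`) f ` x" and o: "id a < id b" "id b < id c" "id c < id d"
      obtain a' c' where ac: "a = f a'" "c = f c'" "{a', c'} \<in> x" "a' \<in> A" "c' \<in> A" using pre[OF e(1)] by blast
      obtain b' d' where bd: "b = f b'" "d = f d'" "{b', d'} \<in> x" "b' \<in> A" "d' \<in> A" using pre[OF e(2)] by blast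
      show False using planarD[OF h(3) ac(3) bd(3)] o ac bd less by simp
    qed
    fix a b p assume e: "{a, b} \<in> (`) f ` x" "p \<in> f ` A - \<Union>((`) f ` x)" "a < p" "p < b"
    obtain a' b' where ab: "a = f a'" "b = f b'" "{a', b'} \<in> x" "a' \<in> A" "b' \<in> A" using pre[OF e(1)] by blast
    obtain p' where p: "p = f p'" "p' \<in> A" "p' \<notin> \<Union>x" using e(2) unfolding D by blast
    show False using h(4)[OF ab(3) p(2,3)] e(3,4) ab p less by simp
  qed
qed

lemma finite_half_diagrams: "finite S \<Longrightarrow> finite (half_diagrams S k)"
proof (rule finite_subset)
  show "half_diagrams S k \<subseteq> Pow (Pow S)" unfolding half_diagrams_def half_diagram_def by blast
qed simp

lemma card_half_diagrams_le:
  assumes "finite A" "strict_mono_on A f"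
  shows "card (half_diagrams A k) \<le> card (half_diagrams (f ` A) k)"
proof (rule card_inj_on_le)
  have inj: "inj_on f A" by (rule strict_mono_on_imp_inj_on[OF assms(2)])
  show "inj_on ((`) ((`) f)) (half_diagrams A k)"
  proof (rule inj_on_subset)
    show "inj_on ((`) ((`) f)) (Pow (Pow A))" using inj by (intro inj_on_image_Pow)
    show "half_diagrams A k \<subseteq> Pow (Pow A)" unfolding half_diagrams_def half_diagram_def by blast
  qed
  show "(`) ((`) f) ` half_diagrams A k \<subseteq> half_diagrams (f ` A) k"
  proof
    fix z assume "z \<in> (`) ((`) f) ` half_diagrams A k"
    then obtain x where x: "z = (`) f ` x" "half_diagram A x" "card (A - \<Union>x) = 2 * k" unfolding half_diagrams_def by blast
    have "card (f ` (A - \<Union>x)) = card (A - \<Union>x)" by (rule card_image[OF inj_on_subset[OF inj]]) blast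
    then show "z \<in> half_diagrams (f ` A) k"
      using x half_diagram_image[OF x(2) assms(2)] unfolding half_diagrams_def by simp
  qed
  show "finite (half_diagrams (f ` A) k)" using assms(1) by (intro finite_half_diagrams) simp
qed

text \<open>Sets that remain after removing points have gaps. The order enumeration and its inverse
  give injections in both directions, so only the number of points matters.\<close>

lemma card_half_diagrams:
  assumes "finite S"
  shows "card (half_diagrams S k) = card (half_diagrams {1..card S} k)"
proof -
  obtain g where g: "bij_betw g {1..card S} S" "strict_mono_on {1..card S} g"
    by (rule ex_order_enumeration[OF assms])
  define gi where "gi = inv_into {1..card S} g"
  have gi: "gi a \<in> {1..card S}" "g (gi a) = a" if "a \<in> S" for a
    using bij_betw_apply[OF bij_betw_inv_into[OF g(1)] that] bij_betw_inv_into_right[OF g(1) that]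
    unfolding gi_def by blast+
  have "strict_mono_on S gi"
  proof (rule strict_mono_onI)
    fix a b assume ab: "a \<in> S" "b \<in> S" "a < b"
    then show "gi a < gi b" using strict_mono_on_less[OF g(2) gi(1)[OF ab(1)] gi(1)[OF ab(2)]] gi(2) by simp
  qed
  moreover have "gi ` S = {1..card S}" unfolding gi_def using bij_betw_inv_into[OF g(1)] by (simp add: bij_betw_def)
  moreover have "g ` {1..card S} = S" using g(1) by (simp add: bij_betw_def)
  ultimately show ?thesis
    using card_half_diagrams_le[OF assms, of gi k] card_half_diagrams_le[OF _ g(2), of k] by simp
qed

subsection \<open>Cyclicity of the traces\<close>

text \<open>Serves both as the identity diagram on \<open>S\<close> and as the system of strands
  that closes a diagram up in the trace.\<close>

definition through_strands :: "nat set \<Rightarrow> point set set" where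
  "through_strands S = (\<lambda>i. {Lft i, Rgt i}) ` S"

text \<open>The trace of \<open>D\<close> on the standard module over the points \<open>S\<close>:
  only states that \<open>D\<close> reproduces contribute to the diagonal.\<close>

definition fixed_sum :: "nat set \<Rightarrow> point set set \<Rightarrow> nat \<Rightarrow> complex \<Rightarrow> complex" where
  "fixed_sum S D k \<chi> = (\<Sum>x\<in>{x \<in> half_diagrams S k. glue D x = x}. \<chi> ^ num_loops D ((`) Rgt ` x))"

lemma half_diagram_empty: "half_diagram S {}"
  unfolding half_diagram_def by (simp add: matching_def planar_def)

lemma through_strands_eq: "through_strands S = join_halves S {} {} id"
  unfolding through_strands_def join_halves_def by simp

lemma rect_diagram_through_strands:
  assumes "S \<subseteq> {1..m}"
  shows "rect_diagram m S S (through_strands S)"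
  unfolding through_strands_eq
  by (rule rect_diagram_join_halves[OF half_diagram_empty half_diagram_empty _ _ assms assms])
    (auto simp: strict_mono_on_def)

lemma glue_eqI:
  assumes "\<And>i j. {i, j} \<in> glue D x \<longleftrightarrow> {i, j} \<in> glue D' x'"
  shows "glue D x = glue D' x'"
proof (rule Set.set_eqI)
  fix s
  have "\<exists>i j. s = {i, j}" if "s \<in> glue E z" for E z
    using that unfolding glue_def using left_partE by metis
  then show "s \<in> glue D x \<longleftrightarrow> s \<in> glue D' x'" using assms by metis
qed

section \<open>Moving a cap around the closure\<close>

lemma Rgt_contract: "contract (Rgt p) (Rgt q) ((`) Rgt ` x) = (`) Rgt ` contract p q x"
  by (rule contract_image) (rule injI, simp)

text \<open>A cap at the right end of \<open>D\<close> meets \<open>x\<close> first: it contracts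
  \<open>x\<close>, closing a loop if \<open>{p, q}\<close> is an arc of \<open>x\<close>, and the
  rest of \<open>D\<close> acts on the result.\<close>

lemma glue_cap:
  assumes D: "rect_diagram m S T D" and fin: "finite (\<Union>D)" and x: "matching x" and pq: "{Rgt p, Rgt q} \<in> D"
  shows "glue D x = glue (D - {{Rgt p, Rgt q}}) (contract p q x)"
    "num_loops D ((`) Rgt ` x) = num_loops (D - {{Rgt p, Rgt q}}) ((`) Rgt ` contract p q x) + of_bool ({p, q} \<in> x)"
proof -
  note d = rect_diagramD[OF D]
  have ne: "Rgt p \<noteq> Rgt q" by (rule matching_neq[OF d(1) pq])
  note F = image_Rgt_matching[OF x]
  show "num_loops D ((`) Rgt ` x) = num_loops (D - {{Rgt p, Rgt q}}) ((`) Rgt ` contract p q x) + of_bool ({p, q} \<in> x)"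
    using num_loops_contract[OF d(1) F ne pq fin] unfolding Rgt_contract Rgt_edge_iff .
  have U: "\<Union>(D - {{Rgt p, Rgt q}}) = Lft ` S \<union> Rgt ` (T - {p, q})"
    unfolding Union_remove_edge[OF d(1) F ne pq] d(2) by auto
  show "glue D x = glue (D - {{Rgt p, Rgt q}}) (contract p q x)"
  proof (rule glue_eqI)
    fix i j
    show "{i, j} \<in> glue D x \<longleftrightarrow> {i, j} \<in> glue (D - {{Rgt p, Rgt q}}) (contract p q x)"
      unfolding glue_iff[OF d(2)] glue_iff[OF U]
      using joined_contract[OF d(1) F ne pq, of "Lft i" "Lft j"] unfolding Rgt_contract by simp
  qed
qed

text \<open>Both sides of the loop identity count the loops of \<open>D\<close> glued to
  \<open>w\<close> and to the strand \<open>{Lft p, Lft q}\<close>, which is attached before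
  \<open>w\<close> on the left-hand side and after \<open>w\<close> on the right-hand side.\<close>

lemma glue_close:
  assumes D: "rect_diagram m S T D" and w: "half_diagram T w" and ST: "S \<subseteq> {1..m}" "T \<subseteq> {1..m}"
    and pq: "p \<noteq> q" "p \<in> S" "q \<in> S"
  shows "glue (contract (Lft p) (Lft q) D) w = contract p q (glue D w)"
    "num_loops (contract (Lft p) (Lft q) D) ((`) Rgt ` w) + of_bool ({Lft p, Lft q} \<in> D) =
     num_loops D ((`) Rgt ` w) + of_bool ({p, q} \<in> glue D w)"
proof -
  let ?F = "(`) Rgt ` w"
  note d = rect_diagramD[OF D] and h = half_diagramD[OF w]
  have fin: "finite ?F" using finite_half[OF w ST(2)] by simp
  have sub: "\<Union>?F \<subseteq> \<Union>D" unfolding d(2) Union_matching_image using h(2) by blast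
  have finD: "finite (\<Union>D)" unfolding d(2) using ST by (simp add: finite_subset)
  note F = image_Rgt_matching[OF h(1)]
  have nF: "Lft i \<notin> \<Union>?F" for i unfolding Union_matching_image by blast
  have uD: "Lft p \<in> \<Union>D" "Lft q \<in> \<Union>D" unfolding d(2) using pq by auto
  then have u: "Lft p \<in> \<Union>D - \<Union>?F" "Lft q \<in> \<Union>D - \<Union>?F" using nF by blast+
  have ne: "Lft p \<noteq> Lft q" using pq by simp
  have new: "{Lft p, Lft q} \<notin> ?F" using nF[of p] by blast
  have m: "matching (insert {Lft p, Lft q} ?F)"
    unfolding matching_def
  proof (intro conjI ballI)
    have "{Lft p, Lft q} \<inter> s = {}" if "s \<in> ?F" for s using nF[of p] nF[of q] that by blast
    then show "disjoint (insert {Lft p, Lft q} ?F)" using F unfolding matching_def disjoint_def by (auto simp: Int_commute)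
    fix s assume "s \<in> insert {Lft p, Lft q} ?F"
    then show "card s = 2" using F ne unfolding matching_def by auto
  qed
  have "open_strands (contract (Lft p) (Lft q) D) ?F = contract (Lft p) (Lft q) (open_strands D ?F)"
    using open_strands_add[OF fin F sub d(1) u ne] open_strands_insert[OF d(1) m new uD] by simp
  then show "glue (contract (Lft p) (Lft q) D) w = contract p q (glue D w)"
    unfolding glue_def using left_part_contract[OF half_diagram_glue(3)[OF D w ST] pq(1)] by simp
  show "num_loops (contract (Lft p) (Lft q) D) ?F + of_bool ({Lft p, Lft q} \<in> D) =
     num_loops D ?F + of_bool ({p, q} \<in> glue D w)"
    using num_loops_add[OF fin F sub d(1) finD u ne] num_loops_insert[OF d(1) m new uD finD sub]
    unfolding glue_def by simp
qed

lemma Union_through_strands: "\<Union>(through_strands S) = Lft ` S \<union> Rgt ` S"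
  unfolding through_strands_def by auto

text \<open>A cap on the right slides along the two closing strands and becomes a cap on the
  left.\<close>

lemma contract_through_strands:
  assumes "p \<in> S" "q \<in> S" "p \<noteq> q"
  shows "contract (Rgt p) (Rgt q) (through_strands S) = insert {Lft p, Lft q} (through_strands (S - {p, q}))"
proof (intro subset_antisym subsetI)
  fix s assume "s \<in> contract (Rgt p) (Rgt q) (through_strands S)"
  then show "s \<in> insert {Lft p, Lft q} (through_strands (S - {p, q}))"
  proof (cases rule: contract_cases)
    case 1
    then show ?thesis unfolding through_strands_def by auto
  next
    case (2 a b)
    have "a = Lft p" using 2(2) unfolding through_strands_def by (auto simp: doubleton_eq_iff)
    moreover have "b = Lft q" using 2(3) unfolding through_strands_def by (auto simp: doubleton_eq_iff)
    ultimately show ?thesis using 2(1) by simp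
  qed
next
  fix s assume "s \<in> insert {Lft p, Lft q} (through_strands (S - {p, q}))"
  then consider "s = {Lft p, Lft q}" | i where "i \<in> S - {p, q}" "s = {Lft i, Rgt i}"
    unfolding through_strands_def by blast
  then show "s \<in> contract (Rgt p) (Rgt q) (through_strands S)"
  proof cases
    case 1
    have "{Lft p, Lft q} \<in> contract (Rgt p) (Rgt q) (through_strands S)"
      by (rule contract_newI) (use assms in \<open>auto simp: through_strands_def\<close>)
    then show ?thesis using 1 by simp
  next
    case 2
    show ?thesis by (rule contract_oldI) (use 2 in \<open>auto simp: through_strands_def\<close>)
  qed
qed

text \<open>Closing up is cyclic: a cap at the right end of \<open>D\<close> can be moved to the
  left end, where it closes an extra loop exactly if \<open>D\<close> joins the left points
  \<open>p\<close> and \<open>q\<close>.\<close>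

lemma num_loops_through_reduce:
  assumes D: "rect_diagram m S S D" and S: "S \<subseteq> {1..m}" and pq: "p \<noteq> q" "{Rgt p, Rgt q} \<in> D"
  shows "num_loops D (through_strands S) =
    num_loops (contract (Lft p) (Lft q) (D - {{Rgt p, Rgt q}})) (through_strands (S - {p, q})) + of_bool ({Lft p, Lft q} \<in> D)"
proof -
  let ?D0 = "D - {{Rgt p, Rgt q}}"
  note d = rect_diagramD[OF D]
  have "Rgt p \<in> \<Union>D" "Rgt q \<in> \<Union>D" using pq by auto
  then have pS: "p \<in> S" "q \<in> S" unfolding d(2) by auto
  have mt: "matching (through_strands S)" by (rule rect_diagramD(1)[OF rect_diagram_through_strands[OF S]])
  have finS: "finite S" using S by (rule finite_subset) simp
  have finD: "finite (\<Union>D)" unfolding d(2) using finS by simp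
  have ne: "Rgt p \<noteq> Rgt q" "Lft p \<noteq> Lft q" using pq by auto
  have nt: "{Rgt p, Rgt q} \<notin> through_strands S" "{Lft p, Lft q} \<notin> through_strands (S - {p, q})"
    unfolding through_strands_def by (auto simp: doubleton_eq_iff)
  have m0: "matching ?D0" using matching_subset[OF d(1)] by blast
  have U0: "\<Union>?D0 = Lft ` S \<union> Rgt ` (S - {p, q})"
    unfolding Union_remove_edge[OF d(1) mt ne(1) pq(2)] d(2) by auto
  have "num_loops D (through_strands S) = num_loops ?D0 (insert {Lft p, Lft q} (through_strands (S - {p, q})))"
    using num_loops_contract[OF d(1) mt ne(1) pq(2) finD] nt(1) unfolding contract_through_strands[OF pS pq(1)] by simp
  also have "\<dots> = num_loops (contract (Lft p) (Lft q) ?D0) (through_strands (S - {p, q})) + of_bool ({Lft p, Lft q} \<in> ?D0)"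
  proof (rule num_loops_insert[OF m0 _ nt(2)])
    show "matching (insert {Lft p, Lft q} (through_strands (S - {p, q})))"
      using matching_contract[OF mt ne(1)] unfolding contract_through_strands[OF pS pq(1)] .
    show "Lft p \<in> \<Union>?D0" "Lft q \<in> \<Union>?D0" unfolding U0 using pS by auto
    show "finite (\<Union>?D0)" unfolding U0 using finS by simp
    show "\<Union>(through_strands (S - {p, q})) \<subseteq> \<Union>?D0" unfolding U0 Union_through_strands by blast
  qed
  also have "{Lft p, Lft q} \<in> ?D0 \<longleftrightarrow> {Lft p, Lft q} \<in> D" by (simp add: doubleton_eq_iff)
  finally show ?thesis .
qed

text \<open>
  Write \<open>D = E cap\<close> with the cap on \<open>p, q\<close>. Applying the cap and applying \<open>E\<close> are inverse bijections
  between the states fixed by \<open>E cap\<close> and those fixed by \<open>cap E\<close>.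
\<close>

lemma fixed_sum_reduce:
  assumes D: "rect_diagram m S S D" and S: "S \<subseteq> {1..m}" and pq: "p < q" "{Rgt p, Rgt q} \<in> D"
    and adj: "\<And>r. r \<in> S \<Longrightarrow> p < r \<Longrightarrow> r < q \<Longrightarrow> False"
  shows "rect_diagram m (S - {p, q}) (S - {p, q}) (contract (Lft p) (Lft q) (D - {{Rgt p, Rgt q}}))" (is ?rect)
    "fixed_sum S D k \<chi> = \<chi> ^ of_bool ({Lft p, Lft q} \<in> D) *
      fixed_sum (S - {p, q}) (contract (Lft p) (Lft q) (D - {{Rgt p, Rgt q}})) k \<chi>" (is ?sum)
proof -
  let ?D0 = "D - {{Rgt p, Rgt q}}" and ?S' = "S - {p, q}"
  let ?D' = "contract (Lft p) (Lft q) ?D0"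
  note d = rect_diagramD[OF D]
  have npq: "p \<noteq> q" using pq by simp
  have "Rgt p \<in> \<Union>D" "Rgt q \<in> \<Union>D" using pq by auto
  then have pS: "p \<in> S" "q \<in> S" unfolding d(2) by auto
  have finS: "finite S" using S by (rule finite_subset) simp
  have finD: "finite (\<Union>D)" unfolding d(2) using finS by simp
  have S': "?S' \<subseteq> {1..m}" using S by blast
  have r0: "rect_diagram m S ?S' ?D0"
    using rect_diagram_contract_Rgt[OF D S S pq(1) pS adj] contract_edge[OF d(1) _ pq(2)] npq by simp
  show ?rect
    by (rule rect_diagram_contract_Lft[OF r0 S S' pq(1) pS adj])
  have L0: "{Lft p, Lft q} \<in> ?D0 \<longleftrightarrow> {Lft p, Lft q} \<in> D" by (simp add: doubleton_eq_iff)
  have cap: "glue D x = glue ?D0 (contract p q x)"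
    "num_loops D ((`) Rgt ` x) = num_loops ?D0 ((`) Rgt ` contract p q x) + of_bool ({p, q} \<in> x)"
    "half_diagram ?S' (contract p q x)"
    "card (?S' - \<Union>(contract p q x)) \<le> card (S - \<Union>x)" if x: "half_diagram S x" for x
    using glue_cap[OF D finD half_diagramD(1)[OF x] pq(2)]
      half_diagram_contract[OF x pq(1) pS adj] finS by auto
  have close: "glue ?D' w = contract p q (glue ?D0 w)"
    "num_loops ?D' ((`) Rgt ` w) + of_bool ({Lft p, Lft q} \<in> ?D0) = num_loops ?D0 ((`) Rgt ` w) + of_bool ({p, q} \<in> glue ?D0 w)"
    "half_diagram S (glue ?D0 w)"
    "card (S - \<Union>(glue ?D0 w)) \<le> card (?S' - \<Union>w)" if w: "half_diagram ?S' w" for w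
    using glue_close[OF r0 w S S' npq pS] half_diagram_glue(1,2)[OF r0 w S S'] by auto
  show ?sum unfolding fixed_sum_def sum_distrib_left
  proof (rule sum.reindex_bij_witness[where i = "glue ?D0" and j = "contract p q"])
    fix a assume "a \<in> {x \<in> half_diagrams S k. glue D x = x}"
    then have a: "half_diagram S a" "card (S - \<Union>a) = 2 * k" "glue D a = a" unfolding half_diagrams_def by auto
    note c = cap[OF a(1)]
    note cl = close[OF c(3)]
    show 1: "glue ?D0 (contract p q a) = a" using c(1) a(3) by simp
    have "glue ?D' (contract p q a) = contract p q a" unfolding cl(1) 1 ..
    \<comment> \<open>Neither operation increases the number of defects, and together they return to
      \<open>a\<close>, so the number stays \<open>2 * k\<close>.\<close>
    moreover have "card (?S' - \<Union>(contract p q a)) = 2 * k" using cl(4) c(4) a(2) unfolding 1 by simp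
    ultimately show "contract p q a \<in> {w \<in> half_diagrams ?S' k. glue ?D' w = w}" using c(3) unfolding half_diagrams_def by simp
    have "num_loops D ((`) Rgt ` a) = of_bool ({Lft p, Lft q} \<in> D) + num_loops ?D' ((`) Rgt ` contract p q a)"
      using c(2) cl(2) unfolding 1 L0 by simp
    then show "\<chi> ^ of_bool ({Lft p, Lft q} \<in> D) * \<chi> ^ num_loops ?D' ((`) Rgt ` contract p q a) = \<chi> ^ num_loops D ((`) Rgt ` a)"
      by (simp only: power_add)
  next
    fix b assume "b \<in> {w \<in> half_diagrams ?S' k. glue ?D' w = w}"
    then have b: "half_diagram ?S' b" "card (?S' - \<Union>b) = 2 * k" "glue ?D' b = b" unfolding half_diagrams_def by auto
    note cl = close[OF b(1)]
    note c = cap[OF cl(3)]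
    show 1: "contract p q (glue ?D0 b) = b" using cl(1) b(3) by simp
    have "glue D (glue ?D0 b) = glue ?D0 b" using c(1) unfolding 1 .
    moreover have "card (S - \<Union>(glue ?D0 b)) = 2 * k" using cl(4) c(4) b(2) unfolding 1 by simp
    ultimately show "glue ?D0 b \<in> {x \<in> half_diagrams S k. glue D x = x}" using cl(3) unfolding half_diagrams_def by simp
  qed
qed

text \<open>A shortest arc on the right has no point of \<open>T\<close> inside: the strand of such
  a point stays within the arc, hence ends on the right line again and is a shorter arc.\<close>

lemma adjacent_right_arc:
  assumes D: "rect_diagram m S T D" and T: "T \<subseteq> {1..m}" "S \<subseteq> {1..m}" and ex: "{Rgt i, Rgt j} \<in> D"
  obtains p q where "p < q" "{Rgt p, Rgt q} \<in> D" "\<And>r. r \<in> T \<Longrightarrow> p < r \<Longrightarrow> r < q \<Longrightarrow> False"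
proof -
  note d = rect_diagramD[OF D]
  define P where "P n \<longleftrightarrow> (\<exists>p. {Rgt p, Rgt (p + n)} \<in> D \<and> 0 < n)" for n
  have P: "P (max a b - min a b)" if "{Rgt a, Rgt b} \<in> D" for a b
  proof -
    have "a \<noteq> b" using matching_neq[OF d(1) that] by simp
    then have "{Rgt (min a b), Rgt (max a b)} \<in> D" "min a b < max a b"
      using that by (auto simp: min_def max_def insert_commute)
    then show ?thesis unfolding P_def by (intro exI[of _ "min a b"]) simp
  qed
  then have "\<exists>n. P n" using ex by blast
  then have L: "P (LEAST n. P n)" by (rule LeastI_ex)
  define n where "n = (LEAST n. P n)"
  obtain p where p: "{Rgt p, Rgt (p + n)} \<in> D" "0 < n" using L unfolding P_def n_def by blast
  have inT: "a \<in> T \<and> a \<le> m" if "Rgt a \<in> \<Union>D" for a using that T unfolding d(2) by auto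
  have "Rgt p \<in> \<Union>D" "Rgt (p + n) \<in> \<Union>D" using p by auto
  then have pm: "p + n \<le> m" "p \<le> m" using inT by blast+
  have "False" if r: "r \<in> T" "p < r" "r < p + n" for r
  proof -
    have rm: "r \<le> m" using r T by auto
    have "Rgt r \<in> \<Union>D" unfolding d(2) using r by auto
    then obtain z where z: "z \<noteq> Rgt r" "{Rgt r, z} \<in> D" by (rule matching_partner[OF d(1)])
    have e: "{Rgt (p + n), Rgt p} \<in> D" using p(1) by (simp only: insert_commute)
    have o: "boundary_pos m (Rgt (p + n)) < boundary_pos m (Rgt r)" "boundary_pos m (Rgt r) < boundary_pos m (Rgt p)"
      using r pm rm by auto
    note bet = planar_between[OF d(3) e z(2) o]
    have "z \<in> \<Union>D" using z by blast
    then consider i where "z = Lft i" "i \<le> m" | s where "z = Rgt s" "s \<le> m" unfolding d(2) using T by fastforce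
    then show False
    proof cases
      case 1
      then show False using bet(1) pm by simp
    next
      case 2
      have "p \<le> s" using bet(2) 2(2) pm unfolding 2(1) boundary_pos.simps by arith
      moreover have "s \<le> p + n" using bet(1) 2(2) pm unfolding 2(1) boundary_pos.simps by arith
      ultimately have s: "p \<le> s" "s \<le> p + n" .
      have "n \<le> max r s - min r s" unfolding n_def using P z(2) 2(1) by (intro Least_le) blast
      then have "s = p \<and> r = p + n \<or> s = p + n \<and> r = p" using r s by (auto simp: min_def max_def split: if_splits)
      then show False using r by auto
    qed
  qed
  then show ?thesis using that[of p "p + n"] p by auto
qed

text \<open>Without right arcs every right point is joined to a left one. This injection of the
  finite set \<open>S\<close> into itself is onto, so there are no left arcs either, and uniqueness
  applies.\<close>

lemma no_right_arc:
  assumes D: "rect_diagram m S S D" and S: "S \<subseteq> {1..m}" and R: "\<And>i j. {Rgt i, Rgt j} \<notin> D"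
  shows "D = through_strands S"
proof -
  note d = rect_diagramD[OF D]
  have finS: "finite S" using S by (rule finite_subset) simp
  have ex: "\<exists>i. {Lft i, Rgt t} \<in> D" if "t \<in> S" for t
  proof -
    have "Rgt t \<in> \<Union>D" unfolding d(2) using that by auto
    then obtain z where z: "z \<noteq> Rgt t" "{Rgt t, z} \<in> D" by (rule matching_partner[OF d(1)])
    then obtain i where "z = Lft i" using R by (cases z) auto
    then have "{Lft i, Rgt t} \<in> D" using z(2) by (simp only: insert_commute)
    then show ?thesis by blast
  qed
  define g where "g t = (SOME i. {Lft i, Rgt t} \<in> D)" for t
  have g: "{Lft (g t), Rgt t} \<in> D" if "t \<in> S" for t using someI_ex[OF ex[OF that]] unfolding g_def .
  have "inj_on g S"
  proof (rule inj_onI)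
    fix t u assume tu: "t \<in> S" "u \<in> S" "g t = g u"
    show "t = u" using matching_unique[OF d(1) g[OF tu(1)], of "Rgt u"] g[OF tu(2)] tu(3) by simp
  qed
  moreover have "g ` S \<subseteq> S"
  proof
    fix i assume "i \<in> g ` S"
    then obtain t where "t \<in> S" "i = g t" by blast
    then have "Lft i \<in> \<Union>D" using g by blast
    then show "i \<in> S" unfolding d(2) by auto
  qed
  ultimately have gS: "g ` S = S" using endo_inj_surj[OF finS] by blast
  have L: "{Lft i, Lft j} \<notin> D" for i j
  proof
    assume e: "{Lft i, Lft j} \<in> D"
    then have "Lft i \<in> \<Union>D" by blast
    then have "i \<in> g ` S" unfolding gS d(2) by auto
    then obtain t where "t \<in> S" "i = g t" by blast
    then show False using matching_unique[OF d(1) e, of "Rgt t"] g by simp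
  qed
  show ?thesis
    by (rule rect_diagram_unique[OF D rect_diagram_through_strands[OF S] S S])
      (use L R in \<open>auto simp: through_strands_eq join_halves_iff\<close>)
qed

lemma glue_through_strands:
  assumes x: "half_diagram S x"
  shows "glue (through_strands S) x = x" "num_loops (through_strands S) ((`) Rgt ` x) = 0"
proof -
  note h = half_diagramD[OF x]
  let ?E = "through_strands S" and ?F = "(`) Rgt ` x"
  have tE: "{Lft i, Rgt i} \<in> ?E \<union> ?F" if "i \<in> S" for i using that unfolding through_strands_def by auto
  have edge: "(\<exists>i. {c, d} = {Lft i, Rgt i}) \<or> (\<exists>i j. {i, j} \<in> x \<and> c = Rgt i \<and> d = Rgt j)"
    if "{c, d} \<in> ?E \<union> ?F" for c d
  proof (cases "{c, d} \<in> ?E")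
    case True then show ?thesis unfolding through_strands_def by blast
  next
    case False
    then have F: "{c, d} \<in> ?F" using that by blast
    then have "c \<in> \<Union>?F" "d \<in> \<Union>?F" by blast+
    then obtain i j where "c = Rgt i" "d = Rgt j" unfolding Union_matching_image by blast
    then show ?thesis using F Rgt_edge_iff by blast
  qed
  show "glue ?E x = x"
  proof (rule Set.set_eqI)
    fix s
    have iff: "{i, j} \<in> glue ?E x \<longleftrightarrow> {i, j} \<in> x" for i j
    proof
      assume "{i, j} \<in> glue ?E x"
      then have ij: "i \<noteq> j" "(Lft i, Lft j) \<in> joined (?E \<union> ?F)" unfolding glue_iff[OF Union_through_strands] by auto
      \<comment> \<open>\<open>?K\<close> holds the left and right copies of \<open>i\<close> and of
        its partner in \<open>x\<close>. It is closed under all strands, so a path from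
        \<open>Lft i\<close> reaches no other left point than that of the partner.\<close>
      let ?K = "{v. \<exists>a. (v = Lft a \<or> v = Rgt a) \<and> (a = i \<or> {i, a} \<in> x)}"
      have "Lft j \<in> ?K"
      proof (rule joined_closed[OF ij(2)])
        show "Lft i \<in> ?K" by simp
        fix c d assume c: "c \<in> ?K" and cd: "{c, d} \<in> ?E \<union> ?F"
        then obtain a where a: "c = Lft a \<or> c = Rgt a" "a = i \<or> {i, a} \<in> x" by blast
        from edge[OF cd] show "d \<in> ?K"
        proof (elim disjE exE conjE)
          fix b assume "{c, d} = {Lft b, Rgt b}"
          then have "d = Lft a \<or> d = Rgt a" using a(1) by (auto simp: doubleton_eq_iff)
          then show ?thesis using a(2) by blast
        next
          fix u v assume uv: "{u, v} \<in> x" "c = Rgt u" "d = Rgt v"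
          then have "u = a" using a(1) by simp
          then have "v = i \<or> {i, v} \<in> x" using a(2) uv(1) matching_unique'(2)[OF h(1), of i a v] by auto
          then show ?thesis using uv(3) by blast
        qed
      qed
      then show "{i, j} \<in> x" using ij(1) by auto
    next
      assume e: "{i, j} \<in> x"
      then have S: "i \<in> S" "j \<in> S" "i \<noteq> j" using h(2) matching_neq[OF h(1) e] by auto
      have "{Rgt i, Rgt j} \<in> ?E \<union> ?F" using e Rgt_edge_iff by blast
      then have "(Lft i, Rgt j) \<in> joined (?E \<union> ?F)"
        using joined_trans[OF joined_edge[OF tE[OF S(1)]]] joined_edge by metis
      then have "(Lft i, Lft j) \<in> joined (?E \<union> ?F)"
        using joined_trans joined_sym[OF joined_edge[OF tE[OF S(2)]]] by metis
      then show "{i, j} \<in> glue ?E x" unfolding glue_iff[OF Union_through_strands] using S by blast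
    qed
    have "\<exists>i j. s = {i, j}" if "s \<in> glue ?E x" using that unfolding glue_def using left_partE by metis
    moreover have "\<exists>i j. s = {i, j}" if "s \<in> x" using that h(1) unfolding matching_def by (metis card_2_iff)
    ultimately show "s \<in> glue ?E x \<longleftrightarrow> s \<in> x" using iff by metis
  qed
  have "closed_loops ?E ?F = {}"
  proof (rule ccontr)
    assume "closed_loops ?E ?F \<noteq> {}"
    then obtain C a where C: "C = joined (?E \<union> ?F) `` {a}" "C \<subseteq> \<Union>?E \<inter> \<Union>?F"
      unfolding closed_loops_def quotient_def by blast
    have "a \<in> C" using C(1) by simp
    then obtain t where t: "a = Rgt t" "t \<in> \<Union>x" using C(2) unfolding Union_matching_image by blast
    then have "t \<in> S" using h(2) by blast
    then have "Lft t \<in> C" using C(1) t(1) joined_sym[OF joined_edge[OF tE]] by blast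
    then show False using C(2) unfolding Union_matching_image by blast
  qed
  then show "num_loops ?E ?F = 0" unfolding num_loops_def by simp
qed

text \<open>The trace identity for the identity diagram on \<open>2j\<close> points, solved for \<open>d\<^sub>j\<close>.\<close>

function trace_weight :: "complex \<Rightarrow> nat \<Rightarrow> complex" where
  "trace_weight \<chi> j = \<chi> ^ (2 * j) - (\<Sum>k<j. trace_weight \<chi> k * of_nat (card (half_diagrams {1..2 * j} k)))"
  by auto
termination by (relation "measure snd") auto

declare trace_weight.simps [simp del]

lemma half_diagrams_top:
  assumes "card S = 2 * j" "finite S"
  shows "half_diagrams S j = {{}}"
proof -
  have "x = {}" if "half_diagram S x" "card (S - \<Union>x) = 2 * j" for x
  proof -
    note h = half_diagramD[OF that(1)]
    have "S - \<Union>x = S" using that(2) assms by (intro card_subset_eq) auto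
    then have "\<Union>x = {}" using h(2) by blast
    then show ?thesis using h(1) unfolding matching_def by fastforce
  qed
  then show ?thesis using half_diagram_empty assms unfolding half_diagrams_def by auto
qed

lemma half_diagrams_above:
  assumes "card S < 2 * j" "finite S"
  shows "half_diagrams S j = {}"
proof -
  have "card (S - \<Union>x) \<le> card S" for x using assms(2) by (intro card_mono) auto
  then have "card (S - \<Union>x) \<noteq> 2 * j" for x using assms(1) by (metis leD)
  then show ?thesis unfolding half_diagrams_def by simp
qed

text \<open>The recursion with its last term moved back: on \<open>2 * j\<close> points only the
  state without arcs has \<open>2 * j\<close> defects, so the coefficient at \<open>k = j\<close> is
  \<open>1\<close>.\<close>

lemma trace_weight_sum: "(\<Sum>k\<le>j. trace_weight \<chi> k * of_nat (card (half_diagrams {1..2 * j} k))) = \<chi> ^ (2 * j)"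
proof -
  have "half_diagrams {1..2 * j} j = {{}}" by (rule half_diagrams_top) auto
  then show ?thesis using trace_weight.simps[of \<chi> j] by (simp add: lessThan_Suc_atMost[symmetric])
qed

text \<open>Either \<open>D\<close> is the identity, where the recursion for
  \<open>trace_weight\<close> applies, or it has an arc between neighbours on the right; then both
  sides split off the same factor on passing to a diagram with two points fewer on each
  line.\<close>

lemma closure_trace:
  assumes "rect_diagram m S S D" "S \<subseteq> {1..m}" "card S = 2 * j"
  shows "\<chi> ^ num_loops D (through_strands S) = (\<Sum>k\<le>j. trace_weight \<chi> k * fixed_sum S D k \<chi>)"
  using assms
proof (induction j arbitrary: S D rule: less_induct)
  case (less j)
  have finS: "finite S" using less.prems(2) by (rule finite_subset) simp
  show ?case
  proof (cases "\<exists>i j. {Rgt i, Rgt j} \<in> D")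
    case False
    then have D: "D = through_strands S" using no_right_arc[OF less.prems(1,2)] by blast
    have "fixed_sum S D k \<chi> = of_nat (card (half_diagrams {1..2 * j} k))" for k
    proof -
      have "{x \<in> half_diagrams S k. glue D x = x} = half_diagrams S k"
        using glue_through_strands(1) unfolding D half_diagrams_def by blast
      then have "fixed_sum S D k \<chi> = (\<Sum>x\<in>half_diagrams S k. 1)"
        unfolding fixed_sum_def by (intro sum.cong) (auto simp: D half_diagrams_def glue_through_strands(2))
      then show ?thesis using card_half_diagrams[OF finS] less.prems(3) by simp
    qed
    moreover have "num_loops D (through_strands S) = 2 * j"
    proof -
      have "num_loops D D = card D"
        using num_loops_subset(1)[of D D] rect_diagramD(1,2)[OF less.prems(1)] finS
        by (simp add: finite_matching)
      also have "card D = card S" unfolding D through_strands_def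
        by (rule card_image) (auto simp: inj_on_def doubleton_eq_iff)
      finally show ?thesis using D less.prems(3) by simp
    qed
    ultimately show ?thesis using trace_weight_sum[of \<chi> j] by simp
  next
    case True
    then obtain p q where pq: "p < q" "{Rgt p, Rgt q} \<in> D" "\<And>r. r \<in> S \<Longrightarrow> p < r \<Longrightarrow> r < q \<Longrightarrow> False"
      using adjacent_right_arc[OF less.prems(1,2,2)] by metis
    let ?S' = "S - {p, q}" and ?D' = "contract (Lft p) (Lft q) (D - {{Rgt p, Rgt q}})"
    have red1: "rect_diagram m ?S' ?S' ?D'"
      by (rule fixed_sum_reduce(1)[OF less.prems(1,2) pq(1,2)]) (erule (2) pq(3))
    have red2: "fixed_sum S D k \<chi> = \<chi> ^ of_bool ({Lft p, Lft q} \<in> D) * fixed_sum ?S' ?D' k \<chi>" for k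
      by (rule fixed_sum_reduce(2)[OF less.prems(1,2) pq(1,2)]) (erule (2) pq(3))
    have "Rgt p \<in> \<Union>D" "Rgt q \<in> \<Union>D" using pq by auto
    then have pS: "p \<in> S" "q \<in> S" unfolding rect_diagramD(2)[OF less.prems(1)] by auto
    have "card ?S' = card S - card {p, q}" using pS finS by (intro card_Diff_subset) auto
    then have c: "card ?S' = 2 * (j - 1)" using less.prems(3) pq(1) by simp
    have "card {p, q} \<le> card S" using pS finS by (intro card_mono) auto
    then have j: "j > 0" using less.prems(3) pq(1) by simp
    have "\<chi> ^ num_loops D (through_strands S) =
        \<chi> ^ of_bool ({Lft p, Lft q} \<in> D) * \<chi> ^ num_loops ?D' (through_strands ?S')"
      using num_loops_through_reduce[OF less.prems(1,2) _ pq(2)] pq(1) by (simp add: power_add mult.commute)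
    also have "\<chi> ^ num_loops ?D' (through_strands ?S') = (\<Sum>k\<le>j - 1. trace_weight \<chi> k * fixed_sum ?S' ?D' k \<chi>)"
      using less.prems(2) j c by (intro less.IH red1) auto
    \<comment> \<open>The term \<open>k = j\<close> may be added because \<open>?S'\<close> has too
      few points for \<open>2 * j\<close> defects.\<close>
    also have "\<dots> = (\<Sum>k\<le>j. trace_weight \<chi> k * fixed_sum ?S' ?D' k \<chi>)"
    proof -
      have "half_diagrams ?S' j = {}" using c j finS by (intro half_diagrams_above) auto
      then have "fixed_sum ?S' ?D' j \<chi> = 0" unfolding fixed_sum_def by simp
      then show ?thesis using j by (cases j) auto
    qed
    also have "\<chi> ^ of_bool ({Lft p, Lft q} \<in> D) * \<dots> = (\<Sum>k\<le>j. trace_weight \<chi> k * fixed_sum S D k \<chi>)"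
      unfolding sum_distrib_left
    proof (rule sum.cong)
      fix k
      show "\<chi> ^ of_bool ({Lft p, Lft q} \<in> D) * (trace_weight \<chi> k * fixed_sum ?S' ?D' k \<chi>) =
        trace_weight \<chi> k * fixed_sum S D k \<chi>"
        unfolding red2 by (simp only: mult.left_commute)
    qed simp
    finally show ?thesis .
  qed
qed

text \<open>After division by the power \<open>2 * j\<close>, the term for \<open>k < j\<close> is a
  convergent factor times a positive power of \<open>1 / n\<close>, so only the leading power of the
  recursion survives.\<close>

lemma tendsto_trace_weight: "(\<lambda>n. trace_weight (of_nat n) j / of_nat n ^ (2 * j)) \<longlonglongrightarrow> 1"
proof (induction j rule: less_induct)
  case (less j)
  let ?c = "\<lambda>k. of_nat (card (half_diagrams {1..2 * j} k)) :: complex"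
  have t: "(\<lambda>n. trace_weight (of_nat n) k / of_nat n ^ (2 * k) * ?c k * inverse (of_nat n) ^ (2 * j - 2 * k)) \<longlonglongrightarrow> 1 * ?c k * 0 ^ (2 * j - 2 * k)"
    if "k < j" for k
    by (intro tendsto_mult less.IH[OF that] tendsto_const tendsto_power lim_inverse_n)
  have "(\<lambda>n. 1 - (\<Sum>k<j. trace_weight (of_nat n) k / of_nat n ^ (2 * k) * ?c k * inverse (of_nat n) ^ (2 * j - 2 * k)))
      \<longlonglongrightarrow> 1 - (\<Sum>k<j. 1 * ?c k * 0 ^ (2 * j - 2 * k))"
    by (intro tendsto_diff tendsto_const tendsto_sum t) simp
  also have "1 - (\<Sum>k<j. 1 * ?c k * 0 ^ (2 * j - 2 * k)) = 1"
    by (simp add: sum.neutral power_0_left)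
  finally show ?case
  proof (rule Lim_transform_eventually)
    show "\<forall>\<^sub>F n in sequentially. 1 - (\<Sum>k<j. trace_weight (of_nat n) k / of_nat n ^ (2 * k) * ?c k * inverse (of_nat n) ^ (2 * j - 2 * k))
       = trace_weight (of_nat n) j / of_nat n ^ (2 * j)"
      using eventually_gt_at_top[of 0]
    proof eventually_elim
      case (elim n)
      have "trace_weight (of_nat n) k / of_nat n ^ (2 * k) * ?c k * inverse (of_nat n) ^ (2 * j - 2 * k)
         = trace_weight (of_nat n) k * ?c k / of_nat n ^ (2 * j)" if "k < j" for k
      proof -
        have "(of_nat n :: complex) ^ (2 * j) = of_nat n ^ (2 * k) * of_nat n ^ (2 * j - 2 * k)"
          using that by (simp add: power_add[symmetric])
        then show ?thesis by (simp add: field_simps power_inverse)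
      qed
      then have "(\<Sum>k<j. trace_weight (of_nat n) k / of_nat n ^ (2 * k) * ?c k * inverse (of_nat n) ^ (2 * j - 2 * k))
         = (\<Sum>k<j. trace_weight (of_nat n) k * ?c k) / of_nat n ^ (2 * j)"
        by (simp add: sum_divide_distrib)
      then show ?case unfolding trace_weight.simps[of _ j] using elim by (simp add: diff_divide_distrib)
    qed
  qed
qed

subsection \<open>The coefficients of the trace\<close>

lemma diagrams_iff: "D \<in> diagrams m \<longleftrightarrow> rect_diagram m {1..m} {1..m} D"
proof -
  have "noncrossing ((`) (boundary_pos m) ` D) \<longleftrightarrow> planar (boundary_pos m) D"
    if "matching D" "\<Union>D = points m"
    using noncrossing_image_iff[OF that(1), of "boundary_pos m"] inj_on_boundary_pos[of "{1..m}" m "{1..m}"] that(2)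
    unfolding points_def by simp
  moreover have "partition_on (points m) D \<and> (\<forall>s\<in>D. card s = 2) \<longleftrightarrow> matching D \<and> \<Union>D = points m"
    unfolding partition_on_def matching_def by auto
  ultimately show ?thesis unfolding diagrams_def rect_diagram_def points_def by auto
qed

lemma link_states_eq: "link_states m k = half_diagrams {1..m} k"
proof (rule Set.set_eqI)
  fix x
  have nc: "noncrossing x \<longleftrightarrow> planar id x" if "matching x"
    using noncrossing_image_iff[OF that, of id] by simp
  have unc: "(\<forall>s\<in>x. \<forall>p\<in>defects m x. \<not> (\<exists>a\<in>s. \<exists>b\<in>s. a < p \<and> p < b)) \<longleftrightarrow>
      (\<forall>a b p. {a, b} \<in> x \<longrightarrow> p \<in> {1..m} - \<Union>x \<longrightarrow> a < p \<longrightarrow> \<not> p < b)" (is "?A \<longleftrightarrow> ?B") if m: "matching x"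
  proof
    assume A: ?A
    show ?B
    proof (intro allI impI notI)
      fix a b p assume *: "{a, b} \<in> x" "p \<in> {1..m} - \<Union>x" "a < p" "p < b"
      then have "p \<in> defects m x" unfolding defects_def by simp
      then have "\<not> (\<exists>a'\<in>{a, b}. \<exists>b'\<in>{a, b}. a' < p \<and> p < b')" using A *(1) by (simp only: ball_simps, blast)
      then show False using *(3,4) by auto
    qed
  next
    assume B: ?B
    show ?A
    proof (intro ballI notI)
      fix s p assume *: "s \<in> x" "p \<in> defects m x" "\<exists>a\<in>s. \<exists>b\<in>s. a < p \<and> p < b"
      then obtain a b where ab: "a \<in> s" "b \<in> s" "a < p" "p < b" by blast
      obtain c where "c \<noteq> a" "s = {a, c}" using matching_edge[OF m *(1) ab(1)] by blast
      then have "s = {a, b}" using ab by auto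
      then show False using B[rule_format, of a b p] *(1,2) ab(3,4) unfolding defects_def by auto
    qed
  qed
  show "x \<in> link_states m k \<longleftrightarrow> x \<in> half_diagrams {1..m} k"
  proof (cases "matching x")
    case True
    have "disjoint x" "\<forall>s\<in>x. card s = 2" using True unfolding matching_def by auto
    then show ?thesis using True
      unfolding link_states_def half_diagrams_def half_diagram_def mem_Collect_eq unc[OF True] nc[OF True]
      by (simp add: defects_def conj_ac)
  next
    case False
    moreover have "matching x" if "x \<in> link_states m k" using that unfolding link_states_def matching_def by simp
    moreover have "matching x" if "x \<in> half_diagrams {1..m} k"
      using that unfolding half_diagrams_def half_diagram_def by simp
    ultimately show ?thesis by metis
  qed
qed

lemma finite_diagrams: "finite (diagrams m)"
proof (rule finite_subset)
  show "diagrams m \<subseteq> Pow (Pow (points m))" unfolding diagrams_def partition_on_def by auto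
  show "finite (Pow (Pow (points m)))" unfolding points_def by simp
qed

lemma finite_link_states: "finite (link_states m k)"
  unfolding link_states_eq by (rule finite_half_diagrams) simp

lemma link_basis: "distinct (link_basis m k)" "set (link_basis m k) = link_states m k" "length (link_basis m k) = dim_std m k"
proof -
  have "\<exists>xs. distinct xs \<and> set xs = link_states m k"
    using finite_distinct_list[OF finite_link_states[of m k]] by blast
  then have *: "distinct (link_basis m k) \<and> set (link_basis m k) = link_states m k"
    unfolding link_basis_def by (rule someI_ex)
  then show "distinct (link_basis m k)" "set (link_basis m k) = link_states m k" by auto
  then show "length (link_basis m k) = dim_std m k"
    unfolding dim_std_def using distinct_card by metis
qed

lemma sum_link_basis: "(\<Sum>i<dim_std m k. f (link_basis m k ! i)) = (\<Sum>x\<in>link_states m k. f x)"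
proof -
  have "bij_betw ((!) (link_basis m k)) {..<dim_std m k} (link_states m k)"
    by (rule bij_betw_nth[OF link_basis(1)]) (simp_all add: link_basis)
  from sum.reindex_bij_betw[OF this] show ?thesis by simp
qed

lemma link_basis_mem: "i < dim_std m k \<Longrightarrow> link_basis m k ! i \<in> link_states m k"
  using link_basis(2,3) nth_mem by metis

lemma concat_link_glue: "D \<in> diagrams m \<Longrightarrow> concat_link m D w = glue D w"
  unfolding diagrams_iff by (rule concat_link_eq_glue) (rule rect_diagramD(2))

lemma glue_subset_Rgt:
  assumes D: "rect_diagram m S T D" and fin: "finite (\<Union>D)" and x: "(`) Rgt ` x \<subseteq> D" "finite x"
  shows "glue D x = left_part D" "num_loops D ((`) Rgt ` x) = card x"
proof -
  note d = rect_diagramD[OF D]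
  have fx: "finite ((`) Rgt ` x)" using x(2) by simp
  note s = num_loops_subset[OF fx x(1) d(1) fin]
  show "num_loops D ((`) Rgt ` x) = card x"
    using s(1) card_image[OF inj_on_subset[OF inj_image_point(2)], of x] by simp
  have "{Lft i, Lft j} \<notin> (`) Rgt ` x" for i j by auto
  then show "glue D x = left_part D" unfolding glue_def s(2) left_part_def by auto
qed

lemma left_part_eq:
  assumes D: "rect_diagram m S T D" and y: "matching y" and e: "\<And>i j. {Lft i, Lft j} \<in> D \<longleftrightarrow> {i, j} \<in> y"
  shows "left_part D = y"
  by (rule matching_eqI[OF matching_left_part[OF rect_diagramD(1)[OF D]] y]) (simp add: e)

lemma half_diagrams_nonempty:
  assumes "even m" "k \<le> m div 2"
  shows "half_diagrams {1..m} k \<noteq> {}"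
proof -
  define n where "n = m div 2 - k"
  \<comment> \<open>The first \<open>2 * n\<close> points are joined in neighbouring pairs, and the
    last \<open>2 * k\<close> points are defects.\<close>
  define y where "y = (\<lambda>i. {2 * i + 1, 2 * i + 2 :: nat}) ` {..<n}"
  have edge: "\<exists>i<n. a = 2 * i + 1 \<and> b = 2 * i + 2 \<or> a = 2 * i + 2 \<and> b = 2 * i + 1" if e: "{a, b} \<in> y" for a b
  proof -
    obtain i where i: "i < n" "{a, b} = {2 * i + 1, 2 * i + 2}" using e unfolding y_def by auto
    then show ?thesis unfolding doubleton_eq_iff by blast
  qed
  have m: "matching y"
  proof (rule matchingI)
    fix s assume "s \<in> y"
    then obtain i where "s = {2 * i + 1, 2 * i + 2}" unfolding y_def by blast
    then show "\<exists>a b. a \<noteq> b \<and> s = {a, b}" by (intro exI[of _ "2 * i + 1"] exI[of _ "2 * i + 2"]) simp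
  next
    fix a b c assume "{a, b} \<in> y" "{a, c} \<in> y"
    then obtain i j where "a = 2 * i + 1 \<and> b = 2 * i + 2 \<or> a = 2 * i + 2 \<and> b = 2 * i + 1"
      "a = 2 * j + 1 \<and> c = 2 * j + 2 \<or> a = 2 * j + 2 \<and> c = 2 * j + 1" using edge by meson
    then show "b = c" by presburger
  qed
  have U: "\<Union>y = {1..2 * n}"
  proof (intro subset_antisym subsetI)
    fix a assume "a \<in> \<Union>y" then show "a \<in> {1..2 * n}" unfolding y_def by auto
  next
    fix a assume a: "a \<in> {1..2 * n}"
    then have "(a - 1) div 2 < n" by auto
    moreover have "a = 2 * ((a - 1) div 2) + 1 \<or> a = 2 * ((a - 1) div 2) + 2" using a by simp presburger
    ultimately have "a \<in> {2 * ((a - 1) div 2) + 1, 2 * ((a - 1) div 2) + 2}"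
      "{2 * ((a - 1) div 2) + 1, 2 * ((a - 1) div 2) + 2} \<in> y" unfolding y_def by auto
    then show "a \<in> \<Union>y" by (rule UnionI[rotated])
  qed
  have nm: "2 * n + 2 * k = m" using assms unfolding n_def by auto
  have "half_diagram {1..m} y" unfolding half_diagram_def
  proof (intro conjI m allI impI notI)
    show "\<Union>y \<subseteq> {1..m}" unfolding U using nm by auto
    show "planar id y" unfolding planar_def
    proof (intro allI impI notI)
      fix a b c d assume "{a, c} \<in> y" "id a < id b" "id b < id c"
      then show False using edge[of a c] by auto
    qed
    fix a b p assume "{a, b} \<in> y" "a < p" "p < b"
    then show False using edge[of a b] by auto
  qed
  moreover have "{1..m} - {1..2 * n} = {2 * n + 1..m}" by auto
  then have "card ({1..m} - \<Union>y) = 2 * k" unfolding U using nm by simp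
  ultimately show ?thesis unfolding half_diagrams_def by blast
qed

text \<open>The truncation in \<open>action_coeff\<close> does not touch diagonal contributions,
  since a reproduced state keeps its number of defects.\<close>

lemma mat_trace_std_rep:
  "mat_trace (std_rep m j \<chi> t) = (\<Sum>D\<in>diagrams m. t D * fixed_sum {1..m} D j \<chi>)"
proof -
  have diag: "action_coeff m \<chi> D x x = (if glue D x = x then \<chi> ^ num_loops D ((`) Rgt ` x) else 0)"
    if "D \<in> diagrams m" for D x
    unfolding action_coeff_def concat_link_glue[OF that] by auto
  have "mat_trace (std_rep m j \<chi> t) =
      (\<Sum>i<dim_std m j. \<Sum>D\<in>diagrams m. t D * action_coeff m \<chi> D (link_basis m j ! i) (link_basis m j ! i))"
    unfolding mat_trace_def std_rep_def diagram_rep_def by simp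
  also have "\<dots> = (\<Sum>x\<in>link_states m j. \<Sum>D\<in>diagrams m. t D * action_coeff m \<chi> D x x)"
    by (rule sum_link_basis)
  also have "\<dots> = (\<Sum>D\<in>diagrams m. \<Sum>x\<in>link_states m j. t D * action_coeff m \<chi> D x x)"
    by (rule sum.swap)
  also have "\<dots> = (\<Sum>D\<in>diagrams m. t D * fixed_sum {1..m} D j \<chi>)"
  proof (rule sum.cong[OF refl])
    fix D assume D: "D \<in> diagrams m"
    have "(\<Sum>x\<in>link_states m j. action_coeff m \<chi> D x x) = fixed_sum {1..m} D j \<chi>"
      unfolding fixed_sum_def diag[OF D] link_states_eq
      by (rule sum.inter_filter[symmetric]) (simp add: finite_half_diagrams)
    then show "(\<Sum>x\<in>link_states m j. t D * action_coeff m \<chi> D x x) = t D * fixed_sum {1..m} D j \<chi>"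
      by (simp add: sum_distrib_left[symmetric])
  qed
  finally show ?thesis .
qed

lemma TL_trace_eq:
  assumes "even m"
  shows "TL_trace m \<chi> t = (\<Sum>j\<le>m div 2. trace_weight \<chi> j * mat_trace (std_rep m j \<chi> t))"
proof -
  have "closure_strands m = through_strands {1..m}" unfolding closure_strands_def through_strands_def ..
  then have "TL_trace m \<chi> t = (\<Sum>D\<in>diagrams m. t D * \<chi> ^ num_loops D (through_strands {1..m}))"
    unfolding TL_trace_def by simp
  also have "\<dots> = (\<Sum>D\<in>diagrams m. \<Sum>j\<le>m div 2. trace_weight \<chi> j * (t D * fixed_sum {1..m} D j \<chi>))"
  proof (rule sum.cong[OF refl])
    fix D assume "D \<in> diagrams m"
    then have "rect_diagram m {1..m} {1..m} D" by (simp only: diagrams_iff)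
    from closure_trace[OF this, of "m div 2" \<chi>] assms
    show "t D * \<chi> ^ num_loops D (through_strands {1..m}) = (\<Sum>j\<le>m div 2. trace_weight \<chi> j * (t D * fixed_sum {1..m} D j \<chi>))"
      by (simp add: sum_distrib_left mult.left_commute)
  qed
  also have "\<dots> = (\<Sum>j\<le>m div 2. trace_weight \<chi> j * mat_trace (std_rep m j \<chi> t))"
    unfolding mat_trace_std_rep sum_distrib_left by (rule sum.swap)
  finally show ?thesis .
qed

lemma glue_mono_left:
  assumes "rect_diagram m S T D" "(`) Lft ` y \<subseteq> D" "matching y"
  shows "y \<subseteq> glue D x"
proof
  note d = rect_diagramD[OF assms(1)]
  fix s assume s: "s \<in> y"
  then obtain a b where ab: "s = {a, b}" "a \<noteq> b" using assms(3) unfolding matching_def by (meson card_2_iff)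
  then have e: "{Lft a, Lft b} \<in> D" using s assms(2) by auto
  then have "Lft a \<in> \<Union>D" "Lft b \<in> \<Union>D" by auto
  moreover have "(Lft a, Lft b) \<in> joined (D \<union> (`) Rgt ` x)" using e by (intro joined_edge) simp
  ultimately have "{a, b} \<in> glue D x" unfolding glue_iff[OF d(2)] using ab(2) d(2) by auto
  then show "s \<in> glue D x" using ab by simp
qed

text \<open>Diagrams with \<open>2j\<close> through strands vanish on the standard modules above \<open>j\<close>, so testing on them
  determines the coefficients one after the other.\<close>

lemma triangular_diagram:
  assumes "even m" "j \<le> m div 2" "\<chi> \<noteq> 0"
  obtains D where "D \<in> diagrams m" "fixed_sum {1..m} D j \<chi> \<noteq> 0" "\<And>k. k > j \<Longrightarrow> fixed_sum {1..m} D k \<chi> = 0"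
proof -
  let ?S = "{1..m}"
  obtain y where y: "half_diagram ?S y" "card (?S - \<Union>y) = 2 * j"
    using half_diagrams_nonempty[OF assms(1,2)] unfolding half_diagrams_def by blast
  note h = half_diagramD[OF y(1)]
  obtain D where D: "rect_diagram m ?S ?S D" "(`) Lft ` y \<subseteq> D" "(`) Rgt ` y \<subseteq> D"
    "\<And>i j. {Lft i, Lft j} \<in> D \<longleftrightarrow> {i, j} \<in> y"
    by (rule join_halves_exists[OF y(1) y(1) refl, of m]) auto
  have finD: "finite (\<Union>D)" unfolding rect_diagramD(2)[OF D(1)] by simp
  have finy: "finite y" using finite_half[OF y(1), of m] by simp
  have gy: "glue D y = y" using glue_subset_Rgt(1)[OF D(1) finD D(3) finy] left_part_eq[OF D(1) h(1) D(4)] by simp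
  \<comment> \<open>The left arcs of \<open>D\<close> survive every gluing, so a fixed state
    contains \<open>y\<close> and has at most \<open>2 * j\<close> defects.\<close>
  have fix_sub: "y \<subseteq> x" if "glue D x = x" for x using glue_mono_left[OF D(1,2) h(1), of x] that by simp
  have "fixed_sum ?S D k \<chi> = 0" if k: "k > j" for k
  proof -
    have False if x: "x \<in> half_diagrams ?S k" "glue D x = x" for x
    proof -
      have "card (?S - \<Union>x) \<le> card (?S - \<Union>y)" using fix_sub[OF x(2)] by (intro card_mono) auto
      then show False using x(1) y(2) k unfolding half_diagrams_def by simp
    qed
    then have "{x \<in> half_diagrams ?S k. glue D x = x} = {}" by blast
    then show ?thesis unfolding fixed_sum_def by (simp only: sum.empty)
  qed
  moreover have "fixed_sum ?S D j \<chi> \<noteq> 0"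
  proof -
    have "x = y" if x: "x \<in> half_diagrams ?S j" "glue D x = x" for x
    proof -
      have hx: "half_diagram ?S x" "card (?S - \<Union>x) = 2 * j" using x(1) unfolding half_diagrams_def by auto
      note h' = half_diagramD[OF hx(1)]
      have sub: "y \<subseteq> x" by (rule fix_sub[OF x(2)])
      have "?S - \<Union>x = ?S - \<Union>y" by (rule card_subset_eq) (use sub hx(2) y(2) in auto)
      then have U: "\<Union>x = \<Union>y" using h(2) h'(2) by blast
      have "s \<in> y" if s: "s \<in> x" for s
      proof -
        obtain a where a: "a \<in> s" using s h'(1) unfolding matching_def by (metis card.empty ex_in_conv zero_neq_numeral)
        then obtain t where t: "t \<in> y" "a \<in> t" using s U by blast
        have "s = t" using matching_unique_set[OF h'(1) s _ a t(2)] sub t(1) by blast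
        then show ?thesis using t by simp
      qed
      then show ?thesis using sub by blast
    qed
    moreover have "y \<in> half_diagrams ?S j" using y unfolding half_diagrams_def by simp
    ultimately have "{x \<in> half_diagrams ?S j. glue D x = x} = {y}" using gy by blast
    then show ?thesis unfolding fixed_sum_def using assms(3) by simp
  qed
  ultimately show ?thesis using that D(1) unfolding diagrams_iff by blast
qed

text \<open>Two solutions are compared on single diagrams. With the diagram belonging to
  \<open>j\<close>, the differences below \<open>j\<close> vanish by induction and the traces above
  \<open>j\<close> vanish by choice, so the difference at \<open>j\<close> times a nonzero trace is
  \<open>0\<close>.\<close>

lemma trace_coeffs_eq:
  assumes m: "even m" and \<chi>: "\<chi> \<noteq> 0"
  shows "trace_coeffs m \<chi> = (\<lambda>j. if j \<le> m div 2 then trace_weight \<chi> j else 0)"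
  unfolding trace_coeffs_def
proof (rule the_equality)
  show "(\<forall>j>m div 2. (if j \<le> m div 2 then trace_weight \<chi> j else 0) = 0) \<and>
    (\<forall>t\<in>TL m. TL_trace m \<chi> t = (\<Sum>j\<le>m div 2. (if j \<le> m div 2 then trace_weight \<chi> j else 0) * mat_trace (std_rep m j \<chi> t)))"
    using TL_trace_eq[OF m] by simp
next
  fix d assume d: "(\<forall>j>m div 2. d j = 0) \<and> (\<forall>t\<in>TL m. TL_trace m \<chi> t = (\<Sum>j\<le>m div 2. d j * mat_trace (std_rep m j \<chi> t)))"
  define e where "e j = d j - trace_weight \<chi> j" for j
  have zero: "(\<Sum>k\<le>m div 2. e k * fixed_sum {1..m} D k \<chi>) = 0" if D: "D \<in> diagrams m" for D
  proof -
    define t :: "point set set \<Rightarrow> complex" where "t = (\<lambda>D'. if D' = D then 1 else 0)"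
    have "t \<in> TL m" using D unfolding TL_def t_def by auto
    moreover have "mat_trace (std_rep m k \<chi> t) = fixed_sum {1..m} D k \<chi>" for k
      unfolding mat_trace_std_rep t_def using D finite_diagrams by (simp add: if_distrib[of "\<lambda>z. z * _"] cong: if_cong)
    ultimately have "(\<Sum>k\<le>m div 2. d k * fixed_sum {1..m} D k \<chi>) = (\<Sum>k\<le>m div 2. trace_weight \<chi> k * fixed_sum {1..m} D k \<chi>)"
      using d TL_trace_eq[OF m, of \<chi> t] by simp
    then show ?thesis unfolding e_def by (simp add: left_diff_distrib sum_subtractf)
  qed
  have "e j = 0" if "j \<le> m div 2" for j
    using that
  proof (induction j rule: less_induct)
    case (less j)
    obtain D where D: "D \<in> diagrams m" "fixed_sum {1..m} D j \<chi> \<noteq> 0" "\<And>k. k > j \<Longrightarrow> fixed_sum {1..m} D k \<chi> = 0"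
      using triangular_diagram[OF m less.prems \<chi>] by blast
    have "(\<Sum>k\<le>m div 2. e k * fixed_sum {1..m} D k \<chi>) = (\<Sum>k\<in>{j}. e k * fixed_sum {1..m} D k \<chi>)"
    proof (rule sum.mono_neutral_right)
      show "\<forall>k\<in>{..m div 2} - {j}. e k * fixed_sum {1..m} D k \<chi> = 0"
      proof
        fix k assume "k \<in> {..m div 2} - {j}"
        then consider "k < j" | "k > j" by fastforce
        then show "e k * fixed_sum {1..m} D k \<chi> = 0" using less D(3) by cases auto
      qed
    qed (use less.prems in auto)
    then show ?case using zero[OF D(1)] D(2) by simp
  qed
  then show "d = (\<lambda>j. if j \<le> m div 2 then trace_weight \<chi> j else 0)"
    using d unfolding e_def by (intro ext) auto
qed

lemma tendsto_trace_coeffs: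
  assumes "even m" "k \<le> m div 2"
  shows "(\<lambda>n. trace_coeffs m (of_nat n) k / of_nat n ^ (2 * k)) \<longlonglongrightarrow> 1"
  using tendsto_trace_weight[of k]
proof (rule Lim_transform_eventually)
  show "\<forall>\<^sub>F n in sequentially. trace_weight (of_nat n) k / of_nat n ^ (2 * k) = trace_coeffs m (of_nat n) k / of_nat n ^ (2 * k)"
    using eventually_gt_at_top[of 0] by eventually_elim (use assms in \<open>simp add: trace_coeffs_eq\<close>)
qed

subsection \<open>Non-crossing permutations as matchings on a line\<close>

definition line_diagram :: "nat \<Rightarrow> nat set set \<Rightarrow> bool" where
  "line_diagram m P \<longleftrightarrow> matching P \<and> \<Union>P = {1..2 * m} \<and> planar id P"

definition to_line :: "nat \<Rightarrow> point set set \<Rightarrow> nat set set" where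
  "to_line m D = (`) (boundary_pos m) ` D"

definition of_pos :: "nat \<Rightarrow> nat \<Rightarrow> point" where
  "of_pos m v = (if v \<le> m then Lft v else Rgt (2 * m + 1 - v))"

text \<open>
  Walking down the left line and up the right line puts cap \<open>c\<close> on the points \<open>2c - 1\<close>, \<open>2c\<close>, and the diagram of
  \<open>h\<close> becomes the matching with strands from \<open>2i\<close> to \<open>2 h(i) - 1\<close>.
\<close>

definition perm_of :: "nat \<Rightarrow> nat set set \<Rightarrow> nat \<Rightarrow> nat" where
  "perm_of m P i = (if i \<in> {1..m} then (THE j. {2 * i, 2 * j - 1} \<in> P \<and> 1 \<le> j) else i)"

definition line_of :: "nat \<Rightarrow> (nat \<Rightarrow> nat) \<Rightarrow> nat set set" where
  "line_of m h = (\<lambda>i. {2 * i, 2 * h i - 1}) ` {1..m}"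

text \<open>The points \<open>2 * c - 1\<close> and \<open>2 * c\<close> of the caps with positive
  label \<open>c\<close> in \<open>A\<close>.\<close>

definition fatten :: "nat set \<Rightarrow> nat set" where
  "fatten A = {v. 1 \<le> v \<and> (v + 1) div 2 \<in> A}"

lemma line_diagramD:
  assumes "line_diagram m P"
  shows "matching P" "\<Union>P = {1..2 * m}" "planar id P"
  using assms unfolding line_diagram_def by auto

lemma line_interval_closed:
  assumes P: "line_diagram m P" and ab: "{a, b} \<in> P" and c: "a < c" "c < b" and cd: "{c, d} \<in> P"
  shows "a < d \<and> d < b"
proof -
  note p = line_diagramD[OF P]
  have "id a \<le> id d" "id d \<le> id b" using planar_between[OF p(3) ab cd] c by auto
  moreover have "d \<noteq> a" using matching_unique'(2)[OF p(1), of c a b] cd ab c by auto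
  moreover have "d \<noteq> b" using matching_unique'(3)[OF p(1), of c b a] cd ab c by auto
  ultimately show ?thesis by auto
qed

text \<open>By planarity the points under a strand are matched among themselves, so their number is
  even. Thus every strand has exactly one even end, which makes \<open>perm_of\<close> well
  defined.\<close>

lemma line_parity:
  assumes P: "line_diagram m P" and ab: "{a, b} \<in> P"
  shows "odd (a + b)"
proof -
  note p = line_diagramD[OF P]
  have main: "odd (a + b)" if ab: "{a, b} \<in> P" and lt: "a < b" for a b
  proof -
    let ?Q = "{s \<in> P. s \<subseteq> {a<..<b}}"
    have mQ: "matching ?Q" by (rule matching_subset[OF p(1)]) blast
    have U: "\<Union>?Q = {a<..<b}"
    proof (intro subset_antisym subsetI)
      fix c assume c: "c \<in> {a<..<b}"
      have "a \<in> \<Union>P" "b \<in> \<Union>P" using ab by auto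
      then have "c \<in> \<Union>P" using c unfolding p(2) by auto
      then obtain d where "d \<noteq> c" "{c, d} \<in> P" by (rule matching_partner[OF p(1)])
      moreover have "a < d \<and> d < b" using line_interval_closed[OF P ab _ _ calculation(2)] c by simp
      ultimately have "{c, d} \<in> ?Q" using c by auto
      then show "c \<in> \<Union>?Q" by blast
    qed blast
    have "card {a<..<b} = 2 * card ?Q"
      using card_Union_matching[OF mQ] unfolding U by simp
    then have "b - Suc a = 2 * card ?Q" by simp
    then obtain n where "b = Suc (a + 2 * n)" using lt by (metis Suc_diff_Suc add_Suc_right diff_Suc_Suc le_add_diff_inverse less_imp_le_nat)
    then show ?thesis by simp
  qed
  show ?thesis
  proof (cases "a < b")
    case True then show ?thesis using main ab by blast
  next
    case False
    then have "b < a" using matching_neq[OF p(1) ab] by simp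
    moreover have "{b, a} \<in> P" using ab by (simp only: insert_commute)
    ultimately show ?thesis using main[of b a] by (simp add: add.commute)
  qed
qed

context
  fixes m :: nat and P :: "nat set set"
  assumes P: "line_diagram m P"
begin

lemma perm_of_edge:
  assumes "i \<in> {1..m}"
  shows "{2 * i, 2 * perm_of m P i - 1} \<in> P" "perm_of m P i \<in> {1..m}"
proof -
  note p = line_diagramD[OF P]
  have "2 * i \<in> \<Union>P" unfolding p(2) using assms by auto
  then obtain b where b: "{2 * i, b} \<in> P" by (rule matching_partner[OF p(1)])
  then have "b \<in> \<Union>P" by blast
  then have bm: "1 \<le> b" "b \<le> 2 * m" unfolding p(2) by auto
  have "odd b" using line_parity[OF P b] by simp
  then obtain j0 where "b = 2 * j0 + 1" by (rule oddE)
  then have j: "b = 2 * Suc j0 - 1" "Suc j0 \<le> m" using bm by auto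
  have "\<exists>!j. {2 * i, 2 * j - 1} \<in> P \<and> 1 \<le> j"
  proof (rule ex1I[of _ "Suc j0"])
    show "{2 * i, 2 * Suc j0 - 1} \<in> P \<and> 1 \<le> Suc j0" using b j(1) by auto
    fix j assume "{2 * i, 2 * j - 1} \<in> P \<and> 1 \<le> j"
    then have "2 * j - 1 = b" "1 \<le> j" using matching_unique[OF p(1) _ b] by auto
    then show "j = Suc j0" using j(1) by auto
  qed
  from theI'[OF this] have "{2 * i, 2 * perm_of m P i - 1} \<in> P \<and> 1 \<le> perm_of m P i"
    unfolding perm_of_def using assms by simp
  moreover from this have "2 * perm_of m P i - 1 = b" using matching_unique[OF p(1) _ b] by blast
  ultimately show "{2 * i, 2 * perm_of m P i - 1} \<in> P" "perm_of m P i \<in> {1..m}" using bm by auto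
qed

lemma line_of_perm_of: "line_of m (perm_of m P) = P"
proof (intro subset_antisym subsetI)
  fix s assume "s \<in> line_of m (perm_of m P)"
  then show "s \<in> P" unfolding line_of_def using perm_of_edge(1) by blast
next
  note p = line_diagramD[OF P]
  fix s assume s: "s \<in> P"
  then obtain a b where ab: "s = {a, b}" using p(1) unfolding matching_def by (meson card_2_iff)
  then have "odd (a + b)" using line_parity[OF P] s by blast
  then obtain i where i: "2 * i \<in> s" using ab by (metis evenE insertI1 insertI2 even_add)
  then have "2 * i \<in> {1..2 * m}" using s p(2) by blast
  then have im: "i \<in> {1..m}" by auto
  have "s = {2 * i, 2 * perm_of m P i - 1}"
    by (rule matching_unique_set[OF p(1) s perm_of_edge(1)[OF im] i]) simp
  then show "s \<in> line_of m (perm_of m P)" unfolding line_of_def using im by blast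
qed

lemma perm_of_permutes: "perm_of m P permutes {1..m}"
proof (rule bij_imp_permutes)
  note p = line_diagramD[OF P]
  have inj: "inj_on (perm_of m P) {1..m}"
  proof (rule inj_onI)
    fix i j assume ij: "i \<in> {1..m}" "j \<in> {1..m}" "perm_of m P i = perm_of m P j"
    have "{2 * j, 2 * perm_of m P i - 1} \<in> P" using perm_of_edge(1)[OF ij(2)] ij(3) by simp
    from matching_unique'(3)[OF p(1) perm_of_edge(1)[OF ij(1)] this] show "i = j" by simp
  qed
  moreover have "perm_of m P ` {1..m} \<subseteq> {1..m}" using perm_of_edge(2) by blast
  ultimately show "bij_betw (perm_of m P) {1..m} {1..m}"
    unfolding bij_betw_def using endo_inj_surj[of "{1..m}"] by blast
  show "perm_of m P i = i" if "i \<notin> {1..m}" for i using that unfolding perm_of_def by auto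
qed

end

section \<open>Orbits and the order within cycles\<close>

lemma orbit_subsetI:
  assumes "j \<in> A" "\<And>i. i \<in> A \<Longrightarrow> h i \<in> A"
  shows "orbit h j \<subseteq> A"
proof
  fix i assume "i \<in> orbit h j"
  then show "i \<in> A" by induction (use assms in auto)
qed

lemma orbit_facts:
  assumes "h permutes {1..m::nat}"
  shows "i \<in> orbit h i" "i \<in> {1..m} \<Longrightarrow> orbit h i \<subseteq> {1..m}" "j \<in> orbit h i \<Longrightarrow> orbit h j = orbit h i"
    "h i \<in> orbit h i" "finite (orbit h i)"
proof -
  have perm: "permutation h" using assms permutation_permutes by blast
  show self: "i \<in> orbit h i" for i by (rule permutation_self_in_orbit[OF perm])
  show "i \<in> {1..m} \<Longrightarrow> orbit h i \<subseteq> {1..m}" by (rule permutes_orbit_subset[OF assms])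
  show "orbit h j = orbit h i" if "j \<in> orbit h i"
    using orbit_trans[OF _ that] orbit_trans[OF _ orbit_swap[OF self that]] by (intro subset_antisym subsetI)
  show "h i \<in> orbit h i" by (rule orbit.base)
  show "finite (orbit h i)" by (rule finite_orbit[OF self])
qed

text \<open>Membership in \<open>NC\<close> without minima: \<open>h i\<close> is the next larger
  element of the cycle, or else \<open>i\<close> is its maximum and \<open>h i\<close> its
  minimum.\<close>

definition cyclic_order :: "nat \<Rightarrow> (nat \<Rightarrow> nat) \<Rightarrow> bool" where
  "cyclic_order m h \<longleftrightarrow> h permutes {1..m} \<and> noncrossing (cycle_partition m h) \<and>
     (\<forall>i\<in>{1..m}. \<forall>j\<in>orbit h i. (i < h i \<longrightarrow> i < j \<longrightarrow> h i \<le> j) \<and> (h i \<le> i \<longrightarrow> h i \<le> j \<and> j \<le> i))"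

lemma NC_iff: "h \<in> NC m \<longleftrightarrow> cyclic_order m h"
proof -
  have *: "h i = (if \<exists>j\<in>orbit h i. i < j then Min {j \<in> orbit h i. i < j} else Min (orbit h i)) \<longleftrightarrow>
     (\<forall>j\<in>orbit h i. (i < h i \<longrightarrow> i < j \<longrightarrow> h i \<le> j) \<and> (h i \<le> i \<longrightarrow> h i \<le> j \<and> j \<le> i))" (is "?A \<longleftrightarrow> ?B")
    if perm: "h permutes {1..m}" for i
  proof -
    note o = orbit_facts[OF perm]
    show ?thesis
    proof (cases "\<exists>j\<in>orbit h i. i < j")
      case True
      let ?M = "{j \<in> orbit h i. i < j}"
      have fin: "finite ?M" "?M \<noteq> {}" using o(5) True by auto
      show ?thesis
      proof
        assume "?A"
        then have "h i = Min ?M" using True by simp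
        then have "h i \<in> ?M" "\<And>j. j \<in> ?M \<Longrightarrow> h i \<le> j" using Min_in[OF fin] Min_le[OF fin(1)] by auto
        then show ?B by auto
      next
        assume B: ?B
        obtain j where j: "j \<in> orbit h i" "i < j" using True by blast
        have "i < h i" using B j by (meson not_le)
        then have "h i \<in> ?M" "\<And>j. j \<in> ?M \<Longrightarrow> h i \<le> j" using B o(4) by auto
        then have "Min ?M = h i" by (intro Min_eqI fin(1)) auto
        then show ?A using True by simp
      qed
    next
      case False
      show ?thesis
      proof
        assume ?A
        then have "h i = Min (orbit h i)" using False by simp
        then have "\<And>j. j \<in> orbit h i \<Longrightarrow> h i \<le> j" using Min_le[OF o(5)] by auto
        then show ?B using False o(4) by (meson not_le)
      next
        assume B: ?B
        have "h i \<le> i" using False o(4) by (meson not_le)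
        then have "\<And>j. j \<in> orbit h i \<Longrightarrow> h i \<le> j" using B by blast
        then have "Min (orbit h i) = h i" using o(4,5) by (intro Min_eqI) auto
        then show ?A using False by simp
      qed
    qed
  qed
  show ?thesis unfolding NC_def cyclic_order_def mem_Collect_eq
    by (intro conj_cong ball_cong refl *)
qed

text \<open>Let \<open>h\<close> be the permutation. The strand between \<open>2 * i\<close> and
  \<open>2 * h i - 1\<close> encloses whole caps: those with labels strictly between
  \<open>i\<close> and \<open>h i\<close> if \<open>i < h i\<close>, and, with its ends included,
  those from \<open>h i\<close> to \<open>i\<close> otherwise. So these label sets are mapped into
  themselves, which yields both the order and the non-crossing property.\<close>

lemma perm_of_NC:
  assumes P: "line_diagram m P"
  shows "perm_of m P \<in> NC m"
proof -
  let ?h = "perm_of m P"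
  note p = line_diagramD[OF P] and perm = perm_of_permutes[OF P] and e = perm_of_edge[OF P]
  note o = orbit_facts[OF perm]
  have up: "orbit ?h j \<subseteq> {i<..<?h i}" if i: "i \<in> {1..m}" "i < ?h i" and j: "j \<in> {i<..<?h i}" for i j
  proof (rule orbit_subsetI[OF j])
    fix j assume j: "j \<in> {i<..<?h i}"
    then have jm: "j \<in> {1..m}" using e(2)[OF i(1)] i(1) by auto
    have "2 * i < 2 * ?h j - 1 \<and> 2 * ?h j - 1 < 2 * ?h i - 1"
      by (rule line_interval_closed[OF P e(1)[OF i(1)] _ _ e(1)[OF jm]]) (use j in auto)
    then show "?h j \<in> {i<..<?h i}" by auto
  qed
  have down: "orbit ?h i \<subseteq> {?h i..i}" if i: "i \<in> {1..m}" "?h i \<le> i" for i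
  proof (rule orbit_subsetI)
    show "i \<in> {?h i..i}" using i by simp
    fix j assume j: "j \<in> {?h i..i}"
    show "?h j \<in> {?h i..i}"
    proof (cases "j = i")
      case True then show ?thesis using i by simp
    next
      case False
      then have j': "?h i \<le> j" "j < i" using j by auto
      then have jm: "j \<in> {1..m}" using e(2)[OF i(1)] i(1) by auto
      have ed: "{2 * ?h i - 1, 2 * i} \<in> P" using e(1)[OF i(1)] by (simp only: insert_commute)
      have "2 * ?h i - 1 < 2 * ?h j - 1 \<and> 2 * ?h j - 1 < 2 * i"
        by (rule line_interval_closed[OF P ed _ _ e(1)[OF jm]]) (use j' e(2)[OF i(1)] in auto)
      then show ?thesis by auto
    qed
  qed
  have succ: "?h i \<le> j" if "i \<in> {1..m}" "j \<in> orbit ?h i" "i < ?h i" "i < j" for i j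
  proof (rule ccontr)
    assume "\<not> ?h i \<le> j"
    then have "orbit ?h j \<subseteq> {i<..<?h i}" using up[of i j] that by auto
    moreover have "i \<in> orbit ?h j" using o(3)[OF that(2)] o(1)[of i] by simp
    ultimately show False by auto
  qed
  have "noncrossing (cycle_partition m ?h)" unfolding noncrossing_def
  proof (intro ballI impI notI)
    fix A B assume AB: "A \<in> cycle_partition m ?h" "B \<in> cycle_partition m ?h" "A \<noteq> B"
      "\<exists>a b c d. a < b \<and> b < c \<and> c < d \<and> a \<in> A \<and> c \<in> A \<and> b \<in> B \<and> d \<in> B"
    then obtain a b c d where abcd: "a < b" "b < c" "c < d" "a \<in> A" "c \<in> A" "b \<in> B" "d \<in> B" by blast
    obtain a0 b0 where ab0: "a0 \<in> {1..m}" "A = orbit ?h a0" "b0 \<in> {1..m}" "B = orbit ?h b0"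
      using AB(1,2) unfolding cycle_partition_def by blast
    have A: "A = orbit ?h u" if "u \<in> A" for u using that o(3)[of u a0] ab0 by simp
    have B: "B = orbit ?h u" if "u \<in> B" for u using that o(3)[of u b0] ab0 by simp
    have disj: "u \<notin> B" if "u \<in> A" for u using A[OF that] B[of u] AB(3) by blast
    \<comment> \<open>\<open>i\<close> is the last element of \<open>A\<close> before
      \<open>b\<close>, so \<open>?h i\<close> jumps over \<open>b\<close>. The cycle of
      \<open>b\<close> is trapped between \<open>i\<close> and \<open>?h i\<close>, yet it contains
      \<open>d\<close>, which lies beyond \<open>c\<close> and hence beyond
      \<open>?h i\<close>.\<close>
    define i where "i = Max {u \<in> A. u < b}"
    have fin: "finite {u \<in> A. u < b}" "{u \<in> A. u < b} \<noteq> {}" using o(5) ab0 abcd by auto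
    have i: "i \<in> A" "i < b" using Max_in[OF fin] unfolding i_def by auto
    have imax: "u \<le> i" if "u \<in> A" "u < b" for u using Max_ge[OF fin(1)] that unfolding i_def by auto
    have im: "i \<in> {1..m}" using i(1) ab0 o(2) by blast
    have c: "c \<in> orbit ?h i" using A[OF i(1)] abcd by simp
    have lt: "i < ?h i"
    proof (rule ccontr)
      assume "\<not> i < ?h i"
      then have "c \<in> {?h i..i}" using down[OF im] c by auto
      then show False using i abcd by auto
    qed
    have hA: "?h i \<in> A" using A[OF i(1)] o(4) by simp
    then have "?h i \<noteq> b" using disj abcd by blast
    moreover have "\<not> ?h i < b" using imax[OF hA] lt by auto
    ultimately have "b < ?h i" by simp
    then have "orbit ?h b \<subseteq> {i<..<?h i}" using up[OF im lt, of b] i by auto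
    moreover have "d \<in> orbit ?h b" using B[OF abcd(6)] abcd by simp
    moreover have "?h i \<le> c" using succ[OF im c lt] i abcd by auto
    ultimately show False using abcd by auto
  qed
  moreover have "?h i \<le> j \<and> j \<le> i" if "i \<in> {1..m}" "j \<in> orbit ?h i" "?h i \<le> i" for i j
    using subsetD[OF down[OF that(1,3)] that(2)] by simp
  ultimately show ?thesis unfolding NC_iff cyclic_order_def using perm succ by blast
qed

text \<open>A crossing of two strands of the same cycle contradicts the cyclic order of its
  elements. Crossing strands of different cycles yield interlacing labels, against the non-crossing
  property.\<close>

lemma line_of_diagram:
  assumes "h \<in> NC m"
  shows "line_diagram m (line_of m h)" "perm_of m (line_of m h) = h"
proof -
  let ?P = "line_of m h"
  from assms have perm: "h permutes {1..m}" and nc: "noncrossing (cycle_partition m h)"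
    and up: "\<And>i j. i \<in> {1..m} \<Longrightarrow> j \<in> orbit h i \<Longrightarrow> i < h i \<Longrightarrow> i < j \<Longrightarrow> h i \<le> j"
    and down: "\<And>i j. i \<in> {1..m} \<Longrightarrow> j \<in> orbit h i \<Longrightarrow> h i \<le> i \<Longrightarrow> h i \<le> j \<and> j \<le> i"
    unfolding NC_iff cyclic_order_def by blast+
  note o = orbit_facts[OF perm]
  have h: "h i \<in> {1..m}" if "i \<in> {1..m}" for i using permutes_in_image[OF perm] that by blast
  have h1: "1 \<le> h i" if "i \<in> {1..m}" for i using h[OF that] by simp
  have inj: "h i = h j \<Longrightarrow> i = j" for i j using permutes_inj[OF perm] by (auto dest: injD)
  have edge: "\<exists>i\<in>{1..m}. a = 2 * i \<and> b = 2 * h i - 1 \<or> b = 2 * i \<and> a = 2 * h i - 1" if e: "{a, b} \<in> ?P" for a b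
  proof -
    obtain i where "i \<in> {1..m}" "{a, b} = {2 * i, 2 * h i - 1}" using e unfolding line_of_def by blast
    then show ?thesis unfolding doubleton_eq_iff by blast
  qed
  have m: "matching ?P"
  proof (rule matchingI)
    fix s assume "s \<in> ?P"
    then obtain i where i: "i \<in> {1..m}" "s = {2 * i, 2 * h i - 1}" unfolding line_of_def by blast
    have "2 * i \<noteq> 2 * h i - 1" using h1[OF i(1)] by presburger
    then show "\<exists>a b. a \<noteq> b \<and> s = {a, b}" using i by blast
  next
    fix a b c assume "{a, b} \<in> ?P" "{a, c} \<in> ?P"
    then obtain i j where ij: "i \<in> {1..m}" "a = 2 * i \<and> b = 2 * h i - 1 \<or> b = 2 * i \<and> a = 2 * h i - 1"
      "j \<in> {1..m}" "a = 2 * j \<and> c = 2 * h j - 1 \<or> c = 2 * j \<and> a = 2 * h j - 1" using edge by meson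
    have "2 * u \<noteq> 2 * h v - 1" "2 * h v - 1 \<noteq> 2 * u" if "v \<in> {1..m}" for u v
      using h1[OF that] by presburger+
    moreover have "i = j" if "2 * h i - 1 = 2 * h j - 1" using that h1 ij inj[of i j] by fastforce
    ultimately show "b = c" using ij by auto
  qed
  have U: "\<Union>?P = {1..2 * m}"
  proof (intro subset_antisym subsetI)
    fix a assume "a \<in> \<Union>?P"
    then obtain i where "i \<in> {1..m}" "a = 2 * i \<or> a = 2 * h i - 1" unfolding line_of_def by blast
    then show "a \<in> {1..2 * m}" using h by fastforce
  next
    fix a assume a: "a \<in> {1..2 * m}"
    show "a \<in> \<Union>?P"
    proof (cases "even a")
      case True
      then obtain i where "a = 2 * i" by (rule evenE)
      then show ?thesis using a unfolding line_of_def by auto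
    next
      case False
      then obtain j where "a = 2 * j + 1" by (rule oddE)
      then have j: "a = 2 * Suc j - 1" "Suc j \<in> {1..m}" using a by auto
      then obtain i where i: "i \<in> {1..m}" "h i = Suc j" using permutes_image[OF perm] by (metis imageE)
      then have "a \<in> {2 * i, 2 * h i - 1}" using j by simp
      then show ?thesis using i(1) unfolding line_of_def by blast
    qed
  qed
  have pl: "planar id ?P" unfolding planar_def
  proof (intro allI impI notI)
    fix a b c d assume e: "{a, c} \<in> ?P" "{b, d} \<in> ?P" and lt: "id a < id b" "id b < id c" "id c < id d"
    obtain i where i: "i \<in> {1..m}" "a = 2 * i \<and> c = 2 * h i - 1 \<or> c = 2 * i \<and> a = 2 * h i - 1"
      using edge[OF e(1)] by blast
    obtain j where j: "j \<in> {1..m}" "b = 2 * j \<and> d = 2 * h j - 1 \<or> d = 2 * j \<and> b = 2 * h j - 1"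
      using edge[OF e(2)] by blast
    note h1i = h1[OF i(1)] and h1j = h1[OF j(1)]
    show False
    proof (cases "orbit h i = orbit h j")
      case True
      have O: "j \<in> orbit h i" "h j \<in> orbit h i" "i \<in> orbit h j" "h i \<in> orbit h j"
        using True o(1,4) by auto
      from i(2) j(2) show False
      proof (elim disjE conjE)
        assume "a = 2 * i" "c = 2 * h i - 1" "b = 2 * j" "d = 2 * h j - 1"
        then have "i < j \<and> j < h i" using lt unfolding id_apply by arith
        then show False using up[OF i(1) O(1)] by auto
      next
        assume "a = 2 * i" "c = 2 * h i - 1" "d = 2 * j" "b = 2 * h j - 1"
        then have "i < h j \<and> h j \<le> j" using lt h1j unfolding id_apply by arith
        then show False using down[OF j(1) O(3)] by auto
      next
        assume "c = 2 * i" "a = 2 * h i - 1" "b = 2 * j" "d = 2 * h j - 1"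
        then have "i < h j \<and> h i \<le> i" using lt h1i unfolding id_apply by arith
        then show False using down[OF i(1) O(2)] by auto
      next
        assume *: "c = 2 * i" "a = 2 * h i - 1" "d = 2 * j" "b = 2 * h j - 1"
        have "h i \<le> i \<and> h j \<le> j" using * lt unfolding id_apply by arith
        then have "h i \<le> h j" "h j \<le> h i" using down[OF i(1) O(2)] down[OF j(1) O(4)] by auto
        then show False using * lt by auto
      qed
    next
      case False
      have disj: "u \<notin> orbit h j" if "u \<in> orbit h i" for u using o(3)[OF that] o(3)[of u j] False by metis
      \<comment> \<open>The label of the cap at position \<open>v\<close>. It is weakly increasing
        in \<open>v\<close>, and labels in disjoint orbits differ, so the order of the positions
        passes to a strict order of labels.\<close>
      define k where "k v = (v + 1) div 2" for v :: nat
      have k: "k (2 * u) = u" "1 \<le> u \<Longrightarrow> k (2 * u - 1) = u" for u unfolding k_def by auto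
      have kac: "k a \<in> orbit h i" "k c \<in> orbit h i" using i(2) k h1i o(1,4) by auto
      have kbd: "k b \<in> orbit h j" "k d \<in> orbit h j" using j(2) k h1j o(1,4) by auto
      have le: "k a \<le> k b" "k b \<le> k c" "k c \<le> k d" using lt unfolding k_def id_apply by (intro div_le_mono, simp)+
      have "k a \<noteq> k b" "k b \<noteq> k c" "k c \<noteq> k d" using disj[OF kac(1)] disj[OF kac(2)] kbd by auto
      then have less: "k a < k b" "k b < k c" "k c < k d" using le by auto
      have "orbit h i \<in> cycle_partition m h" "orbit h j \<in> cycle_partition m h"
        using i(1) j(1) unfolding cycle_partition_def by auto
      from nc[unfolded noncrossing_def, THEN bspec, OF this(1), THEN bspec, OF this(2)] False
      have "\<not> (\<exists>a b c d. a < b \<and> b < c \<and> c < d \<and> a \<in> orbit h i \<and> c \<in> orbit h i \<and> b \<in> orbit h j \<and> d \<in> orbit h j)"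
        by (rule mp)
      then show False using less kac kbd by blast
    qed
  qed
  show L: "line_diagram m ?P" unfolding line_diagram_def using m U pl by simp
  show "perm_of m ?P = h"
  proof
    fix i
    show "perm_of m ?P i = h i"
    proof (cases "i \<in> {1..m}")
      case True
      have "{2 * i, 2 * h i - 1} \<in> ?P" using True unfolding line_of_def by blast
      then have "2 * perm_of m ?P i - 1 = 2 * h i - 1"
        using matching_unique[OF m perm_of_edge(1)[OF L True]] by blast
      moreover have "1 \<le> perm_of m ?P i" using perm_of_edge(2)[OF L True] by simp
      ultimately show ?thesis using h1[OF True] by auto
    next
      case False
      then show ?thesis using permutes_not_in[OF perm] unfolding perm_of_def by auto
    qed
  qed
qed

text \<open>Once the blocks are known, the order condition in \<open>NC\<close> prescribes every
  value of the permutation.\<close>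

lemma NC_unique:
  assumes "h \<in> NC m" "h' \<in> NC m" "cycle_partition m h = cycle_partition m h'"
  shows "h = h'"
proof
  fix i
  have perm: "h permutes {1..m}" "h' permutes {1..m}" using assms(1,2) unfolding NC_def by auto
  note o = orbit_facts[OF perm(1)] and o' = orbit_facts[OF perm(2)]
  show "h i = h' i"
  proof (cases "i \<in> {1..m}")
    case True
    then have "orbit h i \<in> cycle_partition m h'" using assms(3) unfolding cycle_partition_def by blast
    then obtain j where "j \<in> {1..m}" "orbit h i = orbit h' j" unfolding cycle_partition_def by blast
    then have eq: "orbit h i = orbit h' i" using o(1)[of i] o'(3)[of i j] by simp
    have "\<forall>i\<in>{1..m}. h i = (if \<exists>j\<in>orbit h i. i < j then Min {j \<in> orbit h i. i < j} else Min (orbit h i))"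
      "\<forall>i\<in>{1..m}. h' i = (if \<exists>j\<in>orbit h' i. i < j then Min {j \<in> orbit h' i. i < j} else Min (orbit h' i))"
      using assms(1,2) unfolding NC_def by auto
    from bspec[OF this(1) True] bspec[OF this(2) True] show ?thesis unfolding eq by (rule trans[OF _ sym])
  next
    case False
    then show ?thesis using permutes_not_in[OF perm(1)] permutes_not_in[OF perm(2)] by simp
  qed
qed

lemma num_cycles_eq:
  assumes "h \<in> NC m"
  shows "num_cycles m h = card {i \<in> {1..m}. h i \<le> i}" "inj_on (orbit h) {i \<in> {1..m}. h i \<le> i}"
    "\<And>i. i \<in> {1..m} \<Longrightarrow> \<exists>j\<in>orbit h i. j \<in> {1..m} \<and> h j \<le> j \<and> orbit h j = orbit h i"
proof -
  from assms have perm: "h permutes {1..m}"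
    and down: "\<And>i j. i \<in> {1..m} \<Longrightarrow> j \<in> orbit h i \<Longrightarrow> h i \<le> i \<Longrightarrow> h i \<le> j \<and> j \<le> i"
    unfolding NC_iff cyclic_order_def by blast+
  note o = orbit_facts[OF perm]
  show inj: "inj_on (orbit h) {i \<in> {1..m}. h i \<le> i}"
  proof (rule inj_onI)
    fix i j assume *: "i \<in> {i \<in> {1..m}. h i \<le> i}" "j \<in> {i \<in> {1..m}. h i \<le> i}" "orbit h i = orbit h j"
    then have "j \<in> orbit h i" "i \<in> orbit h j" using o(1) by auto
    then have "j \<le> i" "i \<le> j" using down[of i j] down[of j i] * by auto
    then show "i = j" by simp
  qed
  show ex: "\<exists>j\<in>orbit h i. j \<in> {1..m} \<and> h j \<le> j \<and> orbit h j = orbit h i" if i: "i \<in> {1..m}" for i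
  proof (rule bexI)
    have ne: "orbit h i \<noteq> {}" using o(1) by blast
    show M: "Max (orbit h i) \<in> orbit h i" by (rule Max_in[OF o(5) ne])
    have "h (Max (orbit h i)) \<in> orbit h i" using o(3)[OF M] o(4) by metis
    then have "h (Max (orbit h i)) \<le> Max (orbit h i)" by (rule Max_ge[OF o(5)])
    then show "Max (orbit h i) \<in> {1..m} \<and> h (Max (orbit h i)) \<le> Max (orbit h i) \<and> orbit h (Max (orbit h i)) = orbit h i"
      using M o(2)[OF i] o(3)[OF M] by blast
  qed
  have "orbit h ` {i \<in> {1..m}. h i \<le> i} = cycle_partition m h"
  proof (intro subset_antisym subsetI)
    fix A assume "A \<in> cycle_partition m h"
    then obtain i where "i \<in> {1..m}" "A = orbit h i" unfolding cycle_partition_def by blast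
    then show "A \<in> orbit h ` {i \<in> {1..m}. h i \<le> i}" using ex[of i] by auto
  qed (auto simp: cycle_partition_def)
  then show "num_cycles m h = card {i \<in> {1..m}. h i \<le> i}"
    unfolding num_cycles_def using card_image[OF inj] by simp
qed

text \<open>
  A cycle of a non-crossing permutation has exactly one \<open>i\<close> with \<open>h(i) \<le> i\<close>, namely its maximum, and the strand of that
  \<open>i\<close> is the only one of the cycle whose left end \<open>2 h(i) - 1\<close> is odd. Counting cycles, or loops
  with the caps, thus amounts to counting arcs with odd left end.
\<close>

definition odd_arcs :: "nat set set \<Rightarrow> nat" where
  "odd_arcs P = card {s \<in> P. odd (Min s)}"

lemma Min_pair: "Min {a, b} = min a (b::nat)"
  by simp

lemma num_cycles_odd_arcs:
  assumes P: "line_diagram m P"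
  shows "num_cycles m (perm_of m P) = odd_arcs P"
proof -
  let ?h = "perm_of m P"
  note e = perm_of_edge[OF P]
  let ?f = "\<lambda>i. {2 * i, 2 * ?h i - 1}"
  have odd_iff: "odd (Min (?f i)) \<longleftrightarrow> ?h i \<le> i" if "i \<in> {1..m}" for i
  proof -
    have "1 \<le> ?h i" using e(2)[OF that] by simp
    then show ?thesis unfolding Min_pair by (cases "?h i \<le> i") (auto simp: min_def)
  qed
  have "{s \<in> P. odd (Min s)} = ?f ` {i \<in> {1..m}. ?h i \<le> i}"
  proof (intro subset_antisym subsetI)
    fix s assume s: "s \<in> {s \<in> P. odd (Min s)}"
    then have "s \<in> line_of m ?h" unfolding line_of_perm_of[OF P] by simp
    then obtain i where "i \<in> {1..m}" "s = ?f i" unfolding line_of_def by blast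
    then show "s \<in> ?f ` {i \<in> {1..m}. ?h i \<le> i}" using s odd_iff by auto
  next
    fix s assume "s \<in> ?f ` {i \<in> {1..m}. ?h i \<le> i}"
    then obtain i where i: "i \<in> {1..m}" "?h i \<le> i" "s = ?f i" by blast
    show "s \<in> {s \<in> P. odd (Min s)}" unfolding i(3) using e(1)[OF i(1)] odd_iff[OF i(1)] i(2) by simp
  qed
  moreover have "inj_on ?f {i \<in> {1..m}. ?h i \<le> i}"
  proof (rule inj_onI)
    fix i j assume "i \<in> {i \<in> {1..m}. ?h i \<le> i}" "j \<in> {i \<in> {1..m}. ?h i \<le> i}" "?f i = ?f j"
    then have "1 \<le> ?h i" "1 \<le> ?h j" "2 * i = 2 * j \<or> 2 * i = 2 * ?h j - 1" using e(2) by (auto simp: doubleton_eq_iff)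
    then show "i = j" by presburger
  qed
  ultimately show ?thesis
    unfolding odd_arcs_def num_cycles_eq(1)[OF perm_of_NC[OF P]] by (simp add: card_image)
qed

subsection \<open>Loops formed with the caps\<close>

lemma joined_image:
  assumes "(a, b) \<in> joined Q"
  shows "(f a, f b) \<in> joined ((`) f ` Q)"
  using assms
proof (induction rule: joined_induct)
  case (step c d)
  have "f ` {c, d} \<in> (`) f ` Q" using step(2) by (rule imageI)
  then have "(f c, f d) \<in> joined ((`) f ` Q)" by (intro joined_edge) simp
  then show ?case by (rule joined_trans[OF step(3)])
qed simp

text \<open>Injectivity keeps an image path from jumping: a strand of the image that starts at
  \<open>f b\<close> is the image of a strand at \<open>b\<close>.\<close>

lemma joined_image_conv:
  assumes inj: "inj_on f (\<Union>Q)" and a: "a \<in> \<Union>Q" and "(f a, z) \<in> joined ((`) f ` Q)"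
  shows "\<exists>b. z = f b \<and> b \<in> \<Union>Q \<and> (a, b) \<in> joined Q"
  using assms(3)
proof (induction rule: joined_induct)
  case refl
  then show ?case using a by auto
next
  case (step c d)
  then obtain b where b: "c = f b" "b \<in> \<Union>Q" "(a, b) \<in> joined Q" by blast
  obtain s where s: "s \<in> Q" "f ` s = {c, d}" using step(2) by auto
  have "d \<in> f ` s" "c \<in> f ` s" using s(2) by auto
  then obtain b' b'' where b': "b' \<in> s" "d = f b'" "b'' \<in> s" "c = f b''" by blast
  have eq: "u = v" if "u \<in> \<Union>Q" "v \<in> \<Union>Q" "f u = f v" for u v using inj_onD[OF inj that(3,1,2)] .
  have "b'' = b" using eq[of b'' b] b b' s(1) by auto
  moreover have "s \<subseteq> {b'', b'}"
  proof
    fix u assume u: "u \<in> s"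
    then have "f u \<in> {c, d}" using s(2) by blast
    then show "u \<in> {b'', b'}" using eq[of u b''] eq[of u b'] u b' s(1) by auto
  qed
  ultimately have "{b, b'} \<in> Q" using b'(1,3) s(1) by (metis empty_subsetI insert_subset subset_antisym)
  then have "(a, b') \<in> joined Q" using joined_trans[OF b(3)] joined_edge by metis
  then show ?case using b' s(1) by blast
qed

lemma Image_joined_image:
  assumes "inj_on f (\<Union>Q)" "a \<in> \<Union>Q"
  shows "joined ((`) f ` Q) `` {f a} = f ` (joined Q `` {a})"
  using joined_image[of a _ Q f] joined_image_conv[OF assms] by blast

definition pairs :: "nat \<Rightarrow> nat set set" where
  "pairs n = (\<lambda>c. {2 * c - 1, 2 * c}) ` {1..n}"

lemma Union_pairs: "\<Union>(pairs n) = {1..2 * n}"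
proof (intro subset_antisym subsetI)
  fix a assume "a \<in> \<Union>(pairs n)"
  then show "a \<in> {1..2 * n}" unfolding pairs_def by auto
next
  fix a assume a: "a \<in> {1..2 * n}"
  have "a = 2 * ((a + 1) div 2) - 1 \<or> a = 2 * ((a + 1) div 2)" by presburger
  moreover have "(a + 1) div 2 \<in> {1..n}" using a by auto
  ultimately show "a \<in> \<Union>(pairs n)" unfolding pairs_def by blast
qed

lemma mem_fatten: "1 \<le> j \<Longrightarrow> 2 * j \<in> fatten A \<longleftrightarrow> j \<in> A" "1 \<le> j \<Longrightarrow> 2 * j - 1 \<in> fatten A \<longleftrightarrow> j \<in> A"
  unfolding fatten_def by auto

lemma fatten_subset: "A \<subseteq> {1..m} \<Longrightarrow> fatten A \<subseteq> {1..2 * m}"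
proof
  fix v assume "A \<subseteq> {1..m}" "v \<in> fatten A"
  then have "1 \<le> v" "(v + 1) div 2 \<le> m" unfolding fatten_def by auto
  then show "v \<in> {1..2 * m}" by auto
qed

context
  fixes m :: nat and P :: "nat set set"
  assumes P: "line_diagram m P"
begin

lemma fatten_orbit_closed:
  assumes w: "w \<in> fatten (orbit (perm_of m P) i)" and i: "i \<in> {1..m}" and e: "{w, z} \<in> P \<union> pairs m"
  shows "z \<in> fatten (orbit (perm_of m P) i)"
proof -
  let ?h = "perm_of m P"
  note o = orbit_facts[OF perm_of_permutes[OF P]]
  have hinv: "?h j \<in> orbit ?h i \<longleftrightarrow> j \<in> orbit ?h i" for j
    using o(3)[of j i] o(3)[of "?h j" i] o(3)[of "?h j" j] o(1)[of j] o(4)[of j] by metis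
  from e consider "{w, z} \<in> line_of m ?h" | "{w, z} \<in> pairs m" unfolding line_of_perm_of[OF P] by blast
  then show ?thesis
  proof cases
    case 1
    then obtain j where j: "j \<in> {1..m}" "{w, z} = {2 * j, 2 * ?h j - 1}" unfolding line_of_def by blast
    then have "1 \<le> j" "1 \<le> ?h j" using perm_of_edge(2)[OF P] by auto
    note f = mem_fatten(1)[OF this(1)] mem_fatten(2)[OF this(2)]
    from j(2) consider "w = 2 * j" "z = 2 * ?h j - 1" | "z = 2 * j" "w = 2 * ?h j - 1" unfolding doubleton_eq_iff by blast
    then show ?thesis using w f hinv by cases simp_all
  next
    case 2
    then obtain c where c: "c \<in> {1..m}" "{w, z} = {2 * c - 1, 2 * c}" unfolding pairs_def by blast
    then have "1 \<le> c" by simp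
    note f = mem_fatten[OF this]
    from c(2) consider "w = 2 * c - 1" "z = 2 * c" | "z = 2 * c - 1" "w = 2 * c" unfolding doubleton_eq_iff by blast
    then show ?thesis using w f by cases simp_all
  qed
qed

text \<open>The strand at \<open>2 * j\<close> leads to the odd point of the cap with label
  \<open>perm_of m P j\<close>, and this cap leads on to its even point. Walking along a component
  thus iterates the permutation.\<close>

lemma Image_joined_pairs:
  assumes v: "v \<in> {1..2 * m}"
  shows "joined (P \<union> pairs m) `` {v} = fatten (orbit (perm_of m P) ((v + 1) div 2))"
proof -
  let ?h = "perm_of m P" and ?J = "joined (P \<union> pairs m)" and ?i = "(v + 1) div 2"
  note o = orbit_facts[OF perm_of_permutes[OF P]]
  have i: "?i \<in> {1..m}" using v by auto
  have half: "(2 * ((w + 1) div 2), w) \<in> ?J" if w: "w \<in> {1..2 * m}" for w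
  proof -
    have c: "(w + 1) div 2 \<in> {1..m}" using w by auto
    have "w = 2 * ((w + 1) div 2) \<or> w = 2 * ((w + 1) div 2) - 1" by presburger
    moreover have "{2 * ((w + 1) div 2) - 1, 2 * ((w + 1) div 2)} \<in> P \<union> pairs m" using c unfolding pairs_def by blast
    then have "(2 * ((w + 1) div 2), 2 * ((w + 1) div 2) - 1) \<in> ?J" by (rule joined_sym[OF joined_edge])
    ultimately show ?thesis by (metis joined_refl)
  qed
  have step: "(2 * j, 2 * ?h j) \<in> ?J" if j: "j \<in> {1..m}" for j
  proof -
    have "(2 * j, 2 * ?h j - 1) \<in> ?J" using perm_of_edge(1)[OF P j] by (intro joined_edge) blast
    moreover have "(2 * ?h j - 1, 2 * ?h j) \<in> ?J"
      using perm_of_edge(2)[OF P j] by (intro joined_edge) (auto simp: pairs_def)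
    ultimately show ?thesis by (rule joined_trans)
  qed
  have reach: "(2 * ?i, 2 * j) \<in> ?J \<and> j \<in> {1..m}" if "j \<in> orbit ?h ?i" for j
    using that
  proof induction
    case base
    then show ?case using step[OF i] perm_of_edge(2)[OF P i] by simp
  next
    case (step j)
    then show ?case using \<open>\<And>j. j \<in> {1..m} \<Longrightarrow> (2 * j, 2 * ?h j) \<in> ?J\<close>[of j] perm_of_edge(2)[OF P, of j] joined_trans by metis
  qed
  show ?thesis
  proof (intro subset_antisym subsetI)
    fix w assume "w \<in> ?J `` {v}"
    then have "(v, w) \<in> ?J" by simp
    then show "w \<in> fatten (orbit ?h ?i)"
    proof (rule joined_closed)
      show "v \<in> fatten (orbit ?h ?i)" unfolding fatten_def using v o(1) by simp
    qed (rule fatten_orbit_closed[OF _ i])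
  next
    fix w assume "w \<in> fatten (orbit ?h ?i)"
    then have w: "1 \<le> w" "(w + 1) div 2 \<in> orbit ?h ?i" unfolding fatten_def by auto
    then have "(2 * ?i, 2 * ((w + 1) div 2)) \<in> ?J" "(w + 1) div 2 \<in> {1..m}" using reach by auto
    moreover from this(2) have "w \<in> {1..2 * m}" using w(1) by auto
    ultimately have "(2 * ?i, w) \<in> ?J" using joined_trans half by metis
    then have "(v, w) \<in> ?J" using joined_trans[OF joined_sym[OF half[OF v]]] by metis
    then show "w \<in> ?J `` {v}" by simp
  qed
qed

text \<open>\<open>y\<close> consists of the strands of \<open>P\<close> within the first
  \<open>m\<close> points, so its loops with the caps there are cycles of the full permutation. Such
  a cycle is recognized at its maximum \<open>i\<close>: once the strand of \<open>i\<close> belongs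
  to \<open>y\<close>, the strands of the other elements, which are smaller, belong to
  \<open>y\<close> too.\<close>

lemma num_loops_pairs:
  assumes m: "even m" and y: "y \<subseteq> P" "\<Union>y \<subseteq> {1..m}" "\<And>a b. {a, b} \<in> P \<Longrightarrow> a \<le> m \<Longrightarrow> b \<le> m \<Longrightarrow> {a, b} \<in> y"
  shows "num_loops (pairs (m div 2)) y = odd_arcs y"
proof -
  let ?h = "perm_of m P" and ?f = "\<lambda>i. {2 * i, 2 * perm_of m P i - 1}"
  let ?Q = "pairs (m div 2) \<union> y" and ?I = "{i \<in> {1..m}. ?h i \<le> i \<and> ?f i \<in> y}"
  note o = orbit_facts[OF perm_of_permutes[OF P]] and e = perm_of_edge[OF P] and p = line_diagramD[OF P]
  note nc = num_cycles_eq[OF perm_of_NC[OF P]]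
  have my: "matching y" using matching_subset[OF p(1) y(1)] .
  have sub: "?Q \<subseteq> P \<union> pairs m" using y(1) unfolding pairs_def by auto
  have U: "\<Union>(pairs (m div 2)) = {1..m}" unfolding Union_pairs using m by simp
  have up: "joined ?Q `` {v} \<subseteq> fatten (orbit ?h ((v + 1) div 2))" if "v \<in> {1..2 * m}" for v
    unfolding Image_joined_pairs[OF that, symmetric]
  proof
    fix w assume "w \<in> joined ?Q `` {v}"
    then have "(v, w) \<in> joined ?Q" by simp
    then have "(v, w) \<in> joined (P \<union> pairs m)" by (rule joined_subset) (use sub in \<open>auto intro: joined_edge\<close>)
    then show "w \<in> joined (P \<union> pairs m) `` {v}" by simp
  qed
  \<comment> \<open>Coverage is demanded only for elements reached from \<open>2 * i\<close>,
    because for a loop \<open>C\<close> only the points of \<open>C\<close> are known to lie on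
    \<open>y\<close>.\<close>
  have down: "\<forall>j \<in> orbit ?h i. \<forall>w \<in> {2 * j - 1, 2 * j}. (2 * i, w) \<in> joined ?Q"
    if i: "i \<in> {1..m}" and cov: "\<And>j. j \<in> orbit ?h i \<Longrightarrow> (2 * i, 2 * j) \<in> joined ?Q \<Longrightarrow> ?f j \<in> y" for i
  proof -
    have pr: "{2 * j - 1, 2 * j} \<in> ?Q" if "j \<in> {1..m}" "2 * j - 1 \<le> m" for j
    proof -
      have "j \<in> {1..m div 2}" using that m by (auto elim!: evenE)
      then show ?thesis unfolding pairs_def by blast
    qed
    have st: "(2 * i, 2 * ?h j) \<in> joined ?Q \<and> (2 * i, 2 * ?h j - 1) \<in> joined ?Q"
      if j: "j \<in> orbit ?h i" "(2 * i, 2 * j) \<in> joined ?Q" for j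
    proof -
      have jm: "j \<in> {1..m}" using o(2)[OF i] j(1) by blast
      have fj: "?f j \<in> y" by (rule cov[OF j])
      then have "2 * ?h j - 1 \<in> {1..m}" using y(2) by blast
      then have "2 * ?h j - 1 \<le> m" by simp
      then have pp: "{2 * ?h j - 1, 2 * ?h j} \<in> ?Q" using pr e(2)[OF jm] by blast
      have "(2 * j, 2 * ?h j - 1) \<in> joined ?Q" using fj by (intro joined_edge) simp
      then have 1: "(2 * i, 2 * ?h j - 1) \<in> joined ?Q" by (rule joined_trans[OF j(2)])
      moreover have "(2 * i, 2 * ?h j) \<in> joined ?Q" by (rule joined_trans[OF 1 joined_edge[OF pp]])
      ultimately show ?thesis by blast
    qed
    have "(2 * i, 2 * j) \<in> joined ?Q \<and> (2 * i, 2 * j - 1) \<in> joined ?Q" if "j \<in> orbit ?h i" for j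
      using that
    proof induction
      case base
      show ?case using st[OF o(1) joined_refl] .
    next
      case (step j)
      then show ?case using st[of j] by blast
    qed
    then show ?thesis by blast
  qed
  have fat: "fatten A = (\<Union>j\<in>A. {2 * j - 1, 2 * j})" if "A \<subseteq> {1..m}" for A
  proof (intro subset_antisym subsetI)
    fix w assume "w \<in> fatten A"
    then have "(w + 1) div 2 \<in> A" unfolding fatten_def by simp
    moreover have "w \<in> {2 * ((w + 1) div 2) - 1, 2 * ((w + 1) div 2)}" by simp presburger
    ultimately show "w \<in> (\<Union>j\<in>A. {2 * j - 1, 2 * j})" by blast
  next
    fix w assume "w \<in> (\<Union>j\<in>A. {2 * j - 1, 2 * j})"
    then obtain j where "j \<in> A" "w = 2 * j - 1 \<or> w = 2 * j" by blast
    moreover from this have "1 \<le> j" using that by auto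
    ultimately show "w \<in> fatten A" using mem_fatten[of j A] by auto
  qed
  have cls: "joined ?Q `` {2 * i} = fatten (orbit ?h i)"
    if i: "i \<in> {1..m}" and cov: "\<And>j. j \<in> orbit ?h i \<Longrightarrow> (2 * i, 2 * j) \<in> joined ?Q \<Longrightarrow> ?f j \<in> y" for i
  proof
    show "joined ?Q `` {2 * i} \<subseteq> fatten (orbit ?h i)" using up[of "2 * i"] i by simp
    show "fatten (orbit ?h i) \<subseteq> joined ?Q `` {2 * i}"
      unfolding fat[OF o(2)[OF i]] using down[OF i cov] by blast
  qed
  have loops: "closed_loops (pairs (m div 2)) y = (\<lambda>i. fatten (orbit ?h i)) ` ?I"
  proof (intro subset_antisym subsetI)
    fix C assume "C \<in> closed_loops (pairs (m div 2)) y"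
    then obtain v where v: "C = joined ?Q `` {v}" "C \<subseteq> \<Union>(pairs (m div 2)) \<inter> \<Union>y"
      unfolding closed_loops_def quotient_def by blast
    then have "v \<in> \<Union>(pairs (m div 2))" using joined_refl[of v ?Q] by blast
    then have vm: "v \<in> {1..m}" unfolding U .
    define i0 where "i0 = (v + 1) div 2"
    have i0: "i0 \<in> {1..m div 2}" using vm m unfolding i0_def by (auto elim!: evenE)
    then have i0m: "i0 \<in> {1..m}" by auto
    have "{2 * i0 - 1, 2 * i0} \<in> ?Q" using i0 unfolding pairs_def by blast
    moreover have "v = 2 * i0 - 1 \<or> v = 2 * i0" unfolding i0_def by presburger
    ultimately have vi: "(v, 2 * i0) \<in> joined ?Q" using joined_edge[of "2 * i0 - 1" "2 * i0" ?Q] by auto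
    then have C: "C = joined ?Q `` {2 * i0}" using Image_joined_eq[of "2 * i0" ?Q v] v(1) by simp
    have cov: "?f j \<in> y" if j: "j \<in> orbit ?h i0" "(2 * i0, 2 * j) \<in> joined ?Q" for j
    proof -
      have "2 * j \<in> \<Union>y" using j(2) C v(2) by blast
      then obtain s where s: "s \<in> y" "2 * j \<in> s" by blast
      have "s = ?f j" using matching_unique_set[OF p(1) _ e(1) s(2)] s(1) y(1) o(2)[OF i0m] j(1) by blast
      then show ?thesis using s by simp
    qed
    have Cf: "C = fatten (orbit ?h i0)" using C cls[OF i0m cov] by simp
    obtain i where i: "i \<in> orbit ?h i0" "i \<in> {1..m}" "?h i \<le> i" "orbit ?h i = orbit ?h i0" using nc(3)[OF i0m] by blast
    have "2 * i \<in> C" using Cf i mem_fatten(1)[of i] by simp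
    then have "?f i \<in> y" using cov[OF i(1)] C by simp
    then show "C \<in> (\<lambda>i. fatten (orbit ?h i)) ` ?I" using i Cf by (intro image_eqI[of _ _ i]) auto
  next
    fix C assume "C \<in> (\<lambda>i. fatten (orbit ?h i)) ` ?I"
    then obtain i where i: "i \<in> {1..m}" "?h i \<le> i" "?f i \<in> y" "C = fatten (orbit ?h i)" by blast
    have "2 * i \<in> {1..m}" using i(3) y(2) by blast
    then have i2: "2 * i \<le> m" by simp
    have le: "?h j \<in> orbit ?h i" "j \<le> i" "?h j \<le> i" "j \<in> {1..m}" if "j \<in> orbit ?h i" for j
    proof -
      have "orbit ?h j = orbit ?h i" by (rule o(3)[OF that])
      then show h: "?h j \<in> orbit ?h i" using o(4)[of j] by simp
      have "\<forall>j\<in>orbit ?h i. j \<le> i"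
        using perm_of_NC[OF P] i(1,2) unfolding NC_iff cyclic_order_def by blast
      then show "j \<le> i" "?h j \<le> i" using that h by auto
      show "j \<in> {1..m}" using that o(2)[OF i(1)] by blast
    qed
    have cov: "?f j \<in> y" if j: "j \<in> orbit ?h i" for j
      by (rule y(3)[OF e(1)]) (use le[OF j] i2 in auto)
    have Cj: "C = joined ?Q `` {2 * i}" using cls[OF i(1) cov] i(4) by simp
    have "C \<subseteq> \<Union>y"
    proof
      fix w assume "w \<in> C"
      then obtain j where j: "j \<in> orbit ?h i" "w = 2 * j - 1 \<or> w = 2 * j" unfolding i(4) fat[OF o(2)[OF i(1)]] by blast
      \<comment> \<open>\<open>j'\<close> precedes \<open>j\<close> in the cycle: the point
        \<open>2 * j\<close> lies on the strand of \<open>j\<close> and the point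
        \<open>2 * j - 1\<close> on that of \<open>j'\<close>.\<close>
      obtain j' where j': "j' \<in> orbit ?h i" "?h j' = j"
      proof -
        have "j \<in> ?h ` {1..m}" using permutes_image[OF perm_of_permutes[OF P]] le(4)[OF j(1)] by simp
        then obtain j' where "?h j' = j" by blast
        moreover from this have "orbit ?h j = orbit ?h j'" using o(3)[OF o(4)[of j']] by simp
        then have "j' \<in> orbit ?h i" using o(1)[of j'] o(3)[OF j(1)] by simp
        ultimately show ?thesis using that by blast
      qed
      have "2 * j \<in> ?f j" "2 * j - 1 \<in> ?f j'" using j'(2) by auto
      then show "w \<in> \<Union>y" using j(2) cov[OF j(1)] cov[OF j'(1)] by blast
    qed
    moreover have "\<Union>y \<subseteq> \<Union>(pairs (m div 2))" unfolding U by (rule y(2))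
    moreover have "2 * i \<in> \<Union>?Q" using i(3) by blast
    ultimately show "C \<in> closed_loops (pairs (m div 2)) y"
      unfolding closed_loops_def quotient_def using Cj by blast
  qed
  have "inj_on (\<lambda>i. fatten (orbit ?h i)) ?I"
  proof (rule inj_onI)
    fix i j assume *: "i \<in> ?I" "j \<in> ?I" "fatten (orbit ?h i) = fatten (orbit ?h j)"
    have "u \<in> orbit ?h i \<longleftrightarrow> u \<in> orbit ?h j" for u
    proof (cases "1 \<le> u")
      case True then show ?thesis using mem_fatten(1)[OF True] *(3) by metis
    next
      case False
      then show ?thesis using o(2)[of i] o(2)[of j] *(1,2) by auto
    qed
    then have "orbit ?h i = orbit ?h j" by blast
    then show "i = j" using inj_onD[OF nc(2)] * by simp
  qed
  then have "num_loops (pairs (m div 2)) y = card ?I" unfolding num_loops_def loops by (rule card_image)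
  also have "card ?I = card (?f ` ?I)"
  proof (rule card_image[symmetric], rule inj_onI)
    fix i j assume "i \<in> ?I" "j \<in> ?I" "?f i = ?f j"
    then have "1 \<le> ?h i" "1 \<le> ?h j" "2 * i = 2 * j \<or> 2 * i = 2 * ?h j - 1" using e(2) by (auto simp: doubleton_eq_iff)
    then show "i = j" by presburger
  qed
  also have "?f ` ?I = {s \<in> y. odd (Min s)}"
  proof -
    have odd_iff: "odd (Min (?f i)) \<longleftrightarrow> ?h i \<le> i" if "i \<in> {1..m}" for i
    proof -
      have "1 \<le> ?h i" using e(2)[OF that] by simp
      then show ?thesis unfolding Min_pair by (cases "?h i \<le> i") (auto simp: min_def)
    qed
    show ?thesis
    proof (intro subset_antisym subsetI)
      fix s assume s: "s \<in> {s \<in> y. odd (Min s)}"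
      then have "s \<in> line_of m ?h" using y(1) unfolding line_of_perm_of[OF P] by blast
      then obtain i where "i \<in> {1..m}" "s = ?f i" unfolding line_of_def by blast
      then show "s \<in> ?f ` ?I" using s odd_iff by auto
    next
      fix s assume "s \<in> ?f ` ?I"
      then obtain i where i: "i \<in> {1..m}" "?h i \<le> i" "?f i \<in> y" "s = ?f i" by blast
      then show "s \<in> {s \<in> y. odd (Min s)}" using odd_iff[OF i(1)] by blast
    qed
  qed
  finally show ?thesis unfolding odd_arcs_def .
qed

end

section \<open>Diagrams and matchings of the line\<close>

lemma boundary_pos_of_pos: "v \<in> {1..2 * m} \<Longrightarrow> boundary_pos m (of_pos m v) = v"
  unfolding of_pos_def by auto

lemma of_pos_boundary_pos: "p \<in> Lft ` {1..m} \<union> Rgt ` {1..m} \<Longrightarrow> of_pos m (boundary_pos m p) = p"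
  unfolding of_pos_def by auto

lemma boundary_pos_range: "boundary_pos m ` (Lft ` {1..m} \<union> Rgt ` {1..m}) = {1..2 * m}"
proof (intro subset_antisym subsetI)
  fix v assume v: "v \<in> {1..2 * m}"
  have "of_pos m v \<in> Lft ` {1..m} \<union> Rgt ` {1..m}"
  proof (cases "v \<le> m")
    case False
    then have "2 * m + 1 - v \<in> {1..m}" using v by auto
    then show ?thesis using False unfolding of_pos_def by simp
  qed (use v in \<open>auto simp: of_pos_def\<close>)
  then show "v \<in> boundary_pos m ` (Lft ` {1..m} \<union> Rgt ` {1..m})"
    using boundary_pos_of_pos[OF v] by (metis imageI)
qed auto

lemma of_pos_range: "of_pos m ` {1..2 * m} = Lft ` {1..m} \<union> Rgt ` {1..m}"
  unfolding boundary_pos_range[symmetric] image_image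
  using of_pos_boundary_pos[of _ m] by simp

lemma inj_on_of_pos: "inj_on (of_pos m) {1..2 * m}"
  by (rule inj_on_inverseI[of _ "boundary_pos m"]) (rule boundary_pos_of_pos)

lemma of_pos_to_line:
  assumes "\<Union>D = Lft ` {1..m} \<union> Rgt ` {1..m}"
  shows "(`) (of_pos m) ` to_line m D = D"
proof -
  have "of_pos m ` boundary_pos m ` s = s" if "s \<in> D" for s
  proof -
    have "s \<subseteq> Lft ` {1..m} \<union> Rgt ` {1..m}" using that assms by blast
    then have "(\<lambda>p. of_pos m (boundary_pos m p)) ` s = (\<lambda>p. p) ` s"
      by (intro image_cong refl of_pos_boundary_pos) (rule subsetD)
    then show ?thesis by (simp add: image_image)
  qed
  then have "(\<lambda>s. of_pos m ` boundary_pos m ` s) ` D = (\<lambda>s. s) ` D" by (intro image_cong) auto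
  then show ?thesis unfolding to_line_def image_image by simp
qed

lemma to_line_of_pos:
  assumes "\<Union>P = {1..2 * m}"
  shows "to_line m ((`) (of_pos m) ` P) = P"
proof -
  have "boundary_pos m ` of_pos m ` s = s" if "s \<in> P" for s
  proof -
    have "s \<subseteq> {1..2 * m}" using that assms by blast
    then have "(\<lambda>p. boundary_pos m (of_pos m p)) ` s = (\<lambda>p. p) ` s"
      by (intro image_cong refl boundary_pos_of_pos) (rule subsetD)
    then show ?thesis by (simp add: image_image)
  qed
  then have "(\<lambda>s. boundary_pos m ` of_pos m ` s) ` P = (\<lambda>s. s) ` P" by (intro image_cong) auto
  then show ?thesis unfolding to_line_def image_image by simp
qed

lemma planar_to_line:
  assumes "matching D" "\<Union>D = Lft ` {1..m} \<union> Rgt ` {1..m}"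
  shows "matching (to_line m D)" "\<Union>(to_line m D) = {1..2 * m}"
    "planar id (to_line m D) \<longleftrightarrow> planar (boundary_pos m) D"
proof -
  have inj: "inj_on (boundary_pos m) (\<Union>D)" unfolding assms(2) by (rule inj_on_boundary_pos) auto
  show m: "matching (to_line m D)" unfolding to_line_def by (rule matching_image[OF assms(1) inj])
  show "\<Union>(to_line m D) = {1..2 * m}" unfolding to_line_def Union_matching_image assms(2) by (rule boundary_pos_range)
  show "planar id (to_line m D) \<longleftrightarrow> planar (boundary_pos m) D"
    using noncrossing_image_iff[OF assms(1) inj] noncrossing_image_iff[OF m, of id] unfolding to_line_def by simp
qed

lemma line_diagram_to_line: "D \<in> diagrams m \<Longrightarrow> line_diagram m (to_line m D)"
  unfolding diagrams_iff line_diagram_def using planar_to_line rect_diagramD by metis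

lemma diagram_of_line:
  assumes P: "line_diagram m P"
  shows "(`) (of_pos m) ` P \<in> diagrams m"
proof -
  let ?D = "(`) (of_pos m) ` P"
  note p = line_diagramD[OF P]
  have m: "matching ?D" by (rule matching_image[OF p(1)]) (simp only: p(2) inj_on_of_pos)
  have U: "\<Union>?D = Lft ` {1..m} \<union> Rgt ` {1..m}" unfolding Union_matching_image p(2) by (rule of_pos_range)
  have "planar (boundary_pos m) ?D" using planar_to_line(3)[OF m U] p(3) unfolding to_line_of_pos[OF p(2)] by simp
  then show ?thesis unfolding diagrams_iff rect_diagram_def using m U by simp
qed

text \<open>For even \<open>m\<close> no cap straddles the turn from the left to the right line, and
  the labels, which grow upwards on the right, agree with the positions along the line.\<close>

lemma caps_eq:
  assumes "even m"
  shows "c \<in> {1..m} \<Longrightarrow> cap m c = of_pos m ` {2 * c - 1, 2 * c}" "cap m ` {1..m} = (`) (of_pos m) ` pairs m"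
proof -
  show cap: "cap m c = of_pos m ` {2 * c - 1, 2 * c}" if c: "c \<in> {1..m}" for c
  proof (cases "c \<le> m div 2")
    case True
    then have "2 * c \<le> m" by auto
    then show ?thesis unfolding cap_def of_pos_def using True by auto
  next
    case False
    then have "m < 2 * c - 1" using assms by (auto elim!: evenE)
    moreover have "2 * (m + 1 - c) - 1 = 2 * m + 1 - 2 * c" "2 * (m + 1 - c) = 2 * m + 1 - (2 * c - 1)" using c by auto
    ultimately show ?thesis unfolding cap_def of_pos_def using False by auto
  qed
  then show "cap m ` {1..m} = (`) (of_pos m) ` pairs m" unfolding pairs_def image_image by (intro image_cong) auto
qed

text \<open>Strands and caps both cover all points, so every component is closed; the components are
  those of the line, carried over by \<open>of_pos\<close>.\<close>

lemma closed_loops_caps: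
  assumes m: "even m" and D: "D \<in> diagrams m"
  shows "closed_loops D (cap m ` {1..m}) =
    (\<lambda>i. of_pos m ` fatten (orbit (perm_of m (to_line m D)) i)) ` {1..m}"
proof -
  let ?P = "to_line m D" and ?f = "of_pos m"
  let ?h = "perm_of m ?P" and ?Q = "?P \<union> pairs m"
  have P: "line_diagram m ?P" by (rule line_diagram_to_line[OF D])
  have D': "D = (`) ?f ` ?P"
    using of_pos_to_line[OF rect_diagramD(2)] D unfolding diagrams_iff by blast
  have UQ: "\<Union>?Q = {1..2 * m}" unfolding Union_Un_distrib Union_pairs line_diagramD(2)[OF P] by simp
  have DQ: "D \<union> cap m ` {1..m} = (`) ?f ` ?Q" unfolding caps_eq(2)[OF m] using D' by blast
  have V: "\<Union>D = ?f ` {1..2 * m}" "\<Union>(cap m ` {1..m}) = ?f ` {1..2 * m}"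
    unfolding caps_eq(2)[OF m] Union_matching_image Union_pairs
    by (subst D', simp only: Union_matching_image line_diagramD(2)[OF P]) (rule refl)
  have cls: "joined (D \<union> cap m ` {1..m}) `` {?f v} = ?f ` fatten (orbit ?h ((v + 1) div 2))" if "v \<in> {1..2 * m}" for v
    unfolding DQ Image_joined_pairs[OF P that, symmetric]
    by (rule Image_joined_image) (unfold UQ, rule inj_on_of_pos, rule that)
  have sub: "?f ` fatten (orbit ?h i) \<subseteq> ?f ` {1..2 * m}" if "i \<in> {1..m}" for i
    using fatten_subset[OF orbit_facts(2)[OF perm_of_permutes[OF P] that]] by blast
  show ?thesis
  proof (intro subset_antisym subsetI)
    fix C assume "C \<in> closed_loops D (cap m ` {1..m})"
    then obtain z where z: "C = joined (D \<union> cap m ` {1..m}) `` {z}" "z \<in> \<Union>(D \<union> cap m ` {1..m})"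
      unfolding closed_loops_def quotient_def by blast
    then have "z \<in> ?f ` {1..2 * m}" using V by auto
    then obtain v where v: "v \<in> {1..2 * m}" "z = ?f v" by blast
    have "(v + 1) div 2 \<in> {1..m}" using v(1) by auto
    then show "C \<in> (\<lambda>i. ?f ` fatten (orbit ?h i)) ` {1..m}" using cls[OF v(1)] z(1) v(2) by blast
  next
    fix C assume "C \<in> (\<lambda>i. ?f ` fatten (orbit ?h i)) ` {1..m}"
    then obtain i where i: "i \<in> {1..m}" "C = ?f ` fatten (orbit ?h i)" by blast
    have v: "2 * i \<in> {1..2 * m}" using i(1) by auto
    have "C = joined (D \<union> cap m ` {1..m}) `` {?f (2 * i)}" using cls[OF v] i(2) by simp
    moreover have "?f (2 * i) \<in> \<Union>(D \<union> cap m ` {1..m})" unfolding Union_Un_distrib V using v by blast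
    moreover have "C \<subseteq> \<Union>D \<inter> \<Union>(cap m ` {1..m})" unfolding V using sub[OF i(1)] i(2) by simp
    ultimately show "C \<in> closed_loops D (cap m ` {1..m})" unfolding closed_loops_def quotient_def by blast
  qed
qed

lemma cap_partition_eq:
  assumes m: "even m" and D: "D \<in> diagrams m"
  shows "cap_partition m D = cycle_partition m (perm_of m (to_line m D))"
proof -
  let ?h = "perm_of m (to_line m D)"
  note P = line_diagram_to_line[OF D]
  have "{c \<in> {1..m}. cap m c \<subseteq> of_pos m ` fatten (orbit ?h i)} = orbit ?h i" if i: "i \<in> {1..m}" for i
  proof -
    have O: "orbit ?h i \<subseteq> {1..m}" by (rule orbit_facts(2)[OF perm_of_permutes[OF P] i])
    have iff: "of_pos m v \<in> of_pos m ` fatten (orbit ?h i) \<longleftrightarrow> v \<in> fatten (orbit ?h i)" if "v \<in> {1..2 * m}" for v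
      by (rule inj_on_image_mem_iff[OF inj_on_of_pos that fatten_subset[OF O]])
    have "cap m c \<subseteq> of_pos m ` fatten (orbit ?h i) \<longleftrightarrow> c \<in> orbit ?h i" if c: "c \<in> {1..m}" for c
    proof -
      have "1 \<le> c" "2 * c - 1 \<in> {1..2 * m}" "2 * c \<in> {1..2 * m}" using c by auto
      then show ?thesis unfolding caps_eq(1)[OF m c] using iff[of "2 * c - 1"] iff[of "2 * c"] mem_fatten[of c] by simp
    qed
    then show ?thesis using O by blast
  qed
  then show ?thesis
    unfolding cap_partition_def closed_loops_caps[OF m D] cycle_partition_def image_image by (intro image_cong) auto
qed

text \<open>The definite description is resolved because the cap partition determines the
  permutation in \<open>NC\<close>, the permutation determines the strands on the line, and these
  determine the diagram.\<close>

lemma diagram_of_eq: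
  assumes m: "even m" and h: "h \<in> NC m"
  shows "diagram_of m h = (`) (of_pos m) ` line_of m h"
  unfolding diagram_of_def
proof (rule the_equality)
  let ?D = "(`) (of_pos m) ` line_of m h"
  have D: "?D \<in> diagrams m" by (rule diagram_of_line[OF line_of_diagram(1)[OF h]])
  have "to_line m ?D = line_of m h" by (rule to_line_of_pos[OF line_diagramD(2)[OF line_of_diagram(1)[OF h]]])
  then have "cap_partition m ?D = cycle_partition m h"
    unfolding cap_partition_eq[OF m D] using line_of_diagram(2)[OF h] by simp
  then show "?D \<in> diagrams m \<and> cap_partition m ?D = cycle_partition m h" using D by simp
  fix E assume E: "E \<in> diagrams m \<and> cap_partition m E = cycle_partition m h"
  then have P: "line_diagram m (to_line m E)" using line_diagram_to_line by blast
  have "cycle_partition m (perm_of m (to_line m E)) = cycle_partition m h" using E cap_partition_eq[OF m, of E] by simp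
  then have "perm_of m (to_line m E) = h" by (rule NC_unique[OF perm_of_NC[OF P] h])
  then have "to_line m E = line_of m h" using line_of_perm_of[OF P] by simp
  moreover have "E = (`) (of_pos m) ` to_line m E"
    using of_pos_to_line[OF rect_diagramD(2)] E unfolding diagrams_iff by blast
  ultimately show "E = ?D" by simp
qed

lemma bij_betw_diagram_of:
  assumes m: "even m"
  shows "bij_betw (diagram_of m) (NC m) (diagrams m)"
proof (rule bij_betw_byWitness[where f' = "\<lambda>D. perm_of m (to_line m D)"])
  show "\<forall>h\<in>NC m. perm_of m (to_line m (diagram_of m h)) = h"
    using diagram_of_eq[OF m] to_line_of_pos line_diagramD(2) line_of_diagram by simp
  show "\<forall>D\<in>diagrams m. diagram_of m (perm_of m (to_line m D)) = D"
  proof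
    fix D assume D: "D \<in> diagrams m"
    note P = line_diagram_to_line[OF D]
    show "diagram_of m (perm_of m (to_line m D)) = D"
      unfolding diagram_of_eq[OF m perm_of_NC[OF P]] line_of_perm_of[OF P]
      using of_pos_to_line[OF rect_diagramD(2)] D unfolding diagrams_iff by blast
  qed
  show "diagram_of m ` NC m \<subseteq> diagrams m"
    using diagram_of_eq[OF m] diagram_of_line line_of_diagram(1) by auto
  show "(\<lambda>D. perm_of m (to_line m D)) ` diagrams m \<subseteq> NC m"
    using perm_of_NC line_diagram_to_line by blast
qed

lemma num_cycles_diagram_of:
  assumes m: "even m" and h: "h \<in> NC m"
  shows "num_cycles m h = odd_arcs (to_line m (diagram_of m h))"
proof -
  have "to_line m (diagram_of m h) = line_of m h"
    unfolding diagram_of_eq[OF m h] by (rule to_line_of_pos[OF line_diagramD(2)[OF line_of_diagram(1)[OF h]]])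
  then show ?thesis using num_cycles_odd_arcs[OF line_of_diagram(1)[OF h]] line_of_diagram(2)[OF h] by simp
qed

lemma to_line_iff:
  assumes "\<Union>D = Lft ` {1..m} \<union> Rgt ` {1..m}" "a \<in> {1..2 * m}" "b \<in> {1..2 * m}"
  shows "{a, b} \<in> to_line m D \<longleftrightarrow> {of_pos m a, of_pos m b} \<in> D"
proof
  assume "{a, b} \<in> to_line m D"
  then have "of_pos m ` {a, b} \<in> (`) (of_pos m) ` to_line m D" by (rule imageI)
  then show "{of_pos m a, of_pos m b} \<in> D" unfolding of_pos_to_line[OF assms(1)] by simp
next
  assume "{of_pos m a, of_pos m b} \<in> D"
  then have "boundary_pos m ` {of_pos m a, of_pos m b} \<in> to_line m D" unfolding to_line_def by (rule imageI)
  then show "{a, b} \<in> to_line m D" using boundary_pos_of_pos assms(2,3) by simp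
qed

lemma e0_eq_pairs: "e0 m = pairs (m div 2)"
  unfolding e0_def pairs_def ..

section \<open>Counting odd points\<close>

lemma card_odd_interval: "card {p \<in> {1..2 * n}. odd p} = n"
proof -
  have "{p \<in> {1..2 * n}. odd p} = (\<lambda>i. 2 * i + 1) ` {..<n}"
  proof (intro subset_antisym subsetI)
    fix p assume p: "p \<in> {p \<in> {1..2 * n}. odd p}"
    then obtain i where "p = 2 * i + 1" by (auto elim: oddE)
    then show "p \<in> (\<lambda>i. 2 * i + 1) ` {..<n}" using p by auto
  qed auto
  moreover have "inj_on (\<lambda>i::nat. 2 * i + 1) {..<n}" by (rule inj_onI) simp
  ultimately show ?thesis by (simp add: card_image)
qed

lemma card_odd_matching:
  assumes y: "matching y" "finite (\<Union>y)" and par: "\<And>a b. {a, b} \<in> y \<Longrightarrow> odd (a + b)"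
  shows "card {p \<in> \<Union>y. odd p} = card (y :: nat set set)"
proof -
  have s1: "\<exists>p. {p \<in> s. odd p} = {p}" if s: "s \<in> y" for s
  proof -
    obtain a b where ab: "s = {a, b}" using y(1) s unfolding matching_def by (meson card_2_iff)
    then have "odd (a + b)" using par s by blast
    then show ?thesis unfolding ab by (cases "odd a") (auto intro!: exI)
  qed
  have fin: "finite y" by (rule finite_matching[OF y])
  have "{p \<in> \<Union>y. odd p} = (\<Union>s\<in>y. {p \<in> s. odd p})" by blast
  also have "card \<dots> = (\<Sum>s\<in>y. card {p \<in> s. odd p})"
  proof (rule card_UN_disjoint[OF fin])
    show "\<forall>s\<in>y. finite {p \<in> s. odd p}" using s1 by (metis finite.emptyI finite_insert)
    show "\<forall>s\<in>y. \<forall>t\<in>y. s \<noteq> t \<longrightarrow> {p \<in> s. odd p} \<inter> {p \<in> t. odd p} = {}"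
      using matching_unique_set[OF y(1)] by blast
  qed
  also have "\<dots> = (\<Sum>s\<in>y. 1)"
  proof (rule sum.cong[OF refl])
    fix s assume "s \<in> y"
    then obtain p where "{p \<in> s. odd p} = {p}" using s1 by blast
    then show "card {p \<in> s. odd p} = 1" by simp
  qed
  finally show ?thesis by simp
qed

subsection \<open>The leading diagram of a matrix entry\<close>

text \<open>\<open>y\<close> is realized as the left half of the diagram that joins \<open>y\<close>
  to its own mirror image, so that the facts about matchings of the full line apply.\<close>

lemma half_diagram_parity:
  assumes y: "half_diagram {1..m} y"
  shows "\<And>a b. {a, b} \<in> y \<Longrightarrow> odd (a + b)"
    "even m \<Longrightarrow> num_loops (e0 m) y = odd_arcs y"
proof -
  note h = half_diagramD[OF y]
  obtain D where D: "rect_diagram m {1..m} {1..m} D" "(`) Lft ` y \<subseteq> D"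
    "\<And>i j. {Lft i, Lft j} \<in> D \<longleftrightarrow> {i, j} \<in> y"
    by (rule join_halves_exists[OF y y refl, of m]) auto
  note d = rect_diagramD[OF D(1)]
  have P: "line_diagram m (to_line m D)" using D(1) by (intro line_diagram_to_line) (simp only: diagrams_iff)
  have iff: "{a, b} \<in> to_line m D \<longleftrightarrow> {a, b} \<in> y" if "a \<in> {1..m}" "b \<in> {1..m}" for a b
  proof -
    have "a \<in> {1..2 * m}" "b \<in> {1..2 * m}" "of_pos m a = Lft a" "of_pos m b = Lft b" using that unfolding of_pos_def by auto
    then show ?thesis using to_line_iff[OF d(2)] D(3) by simp
  qed
  have in1: "a \<in> {1..m}" "b \<in> {1..m}" if "{a, b} \<in> y" for a b using that h(2) by auto
  show "odd (a + b)" if e: "{a, b} \<in> y" for a b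
    using line_parity[OF P] iff[OF in1[OF e]] e by blast
  show "num_loops (e0 m) y = odd_arcs y" if m: "even m"
    unfolding e0_eq_pairs
  proof (rule num_loops_pairs[OF P m _ h(2)])
    show "y \<subseteq> to_line m D"
    proof
      fix s assume s: "s \<in> y"
      then obtain a b where ab: "s = {a, b}" using h(1) unfolding matching_def by (meson card_2_iff)
      then show "s \<in> to_line m D" using iff in1 s by blast
    qed
    fix a b assume e: "{a, b} \<in> to_line m D" and le: "a \<le> m" "b \<le> m"
    then have "a \<in> \<Union>(to_line m D)" "b \<in> \<Union>(to_line m D)" by auto
    then have "a \<in> {1..m}" "b \<in> {1..m}" using le unfolding line_diagramD(2)[OF P] by auto
    then show "{a, b} \<in> y" using iff e by blast
  qed
qed

lemma card_half_diagram:
  assumes "y \<in> half_diagrams {1..m} k"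
  shows "2 * card y + 2 * k = m"
proof -
  have h: "half_diagram {1..m} y" "card ({1..m} - \<Union>y) = 2 * k" using assms unfolding half_diagrams_def by auto
  note h' = half_diagramD[OF h(1)]
  have fin: "finite (\<Union>y)" using h'(2) by (rule finite_subset) simp
  have "card ({1..m} - \<Union>y) = m - card (\<Union>y)" using card_Diff_subset[OF fin h'(2)] by simp
  moreover have "card (\<Union>y) \<le> m" using card_mono[OF _ h'(2)] by simp
  ultimately show ?thesis using card_Union_matching[OF h'(1) fin] h(2) by simp
qed

text \<open>Every arc has one odd and one even end, so the defects are half odd and half even as
  well.\<close>

lemma card_odd_defects:
  assumes "y \<in> half_diagrams {1..m} k"
  shows "card {p \<in> {1..m} - \<Union>y. odd p} = k"
proof -
  have h: "half_diagram {1..m} y" using assms unfolding half_diagrams_def by auto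
  note h' = half_diagramD[OF h]
  have fin: "finite (\<Union>y)" using h'(2) by (rule finite_subset) simp
  note c = card_half_diagram[OF assms]
  have "{p \<in> {1..m} - \<Union>y. odd p} = {p \<in> {1..m}. odd p} - {p \<in> \<Union>y. odd p}" by auto
  also have "card \<dots> = card {p \<in> {1..m}. odd p} - card {p \<in> \<Union>y. odd p}"
  proof (rule card_Diff_subset)
    show "finite {p \<in> \<Union>y. odd p}" by (rule finite_subset[OF _ fin]) blast
    show "{p \<in> \<Union>y. odd p} \<subseteq> {p \<in> {1..m}. odd p}" using h'(2) by blast
  qed
  also have "card {p \<in> \<Union>y. odd p} = card y"
    by (rule card_odd_matching[OF h'(1) fin half_diagram_parity(1)[OF h]])
  also have "card {p \<in> {1..m}. odd p} = card y + k"
    using card_odd_interval[of "card y + k"] c by (simp add: algebra_simps)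
  finally show ?thesis by simp
qed

text \<open>Left arcs keep their positions. The reflection that carries right arcs to the line
  reverses order and parity; as the two ends have opposite parity, the new left end has the parity
  of the old one. A through strand has its left end at a defect of \<open>y\<close>, and
  \<open>k\<close> of these are odd.\<close>

lemma odd_arcs_join:
  assumes D: "rect_diagram m {1..m} {1..m} D"
    and y: "y \<in> half_diagrams {1..m} k" and x: "x \<in> half_diagrams {1..m} k"
    and L: "\<And>i j. {Lft i, Lft j} \<in> D \<longleftrightarrow> {i, j} \<in> y" and R: "\<And>i j. {Rgt i, Rgt j} \<in> D \<longleftrightarrow> {i, j} \<in> x"
  shows "odd_arcs (to_line m D) = odd_arcs y + odd_arcs x + k"
proof -
  let ?P = "to_line m D"
  note d = rect_diagramD[OF D]
  have hy: "half_diagram {1..m} y" and hx: "half_diagram {1..m} x" using x y unfolding half_diagrams_def by auto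
  note hy' = half_diagramD[OF hy] and hx' = half_diagramD[OF hx]
  have P: "line_diagram m ?P" using D by (intro line_diagram_to_line) (simp only: diagrams_iff)
  note p = line_diagramD[OF P]
  have pair: "\<exists>a b. s = {a, b} \<and> a < b \<and> a \<in> {1..2 * m} \<and> b \<in> {1..2 * m}" if s: "s \<in> ?P" for s
  proof -
    obtain a b where ab: "s = {a, b}" "a \<noteq> b" using p(1) s unfolding matching_def by (meson card_2_iff)
    have "a \<in> {1..2 * m}" "b \<in> {1..2 * m}" using s ab p(2) by auto
    moreover have "s = {min a b, max a b}" "min a b < max a b" using ab by (auto simp: min_def max_def)
    ultimately show ?thesis by (intro exI[of _ "min a b"] exI[of _ "max a b"]) (auto simp: min_def max_def)
  qed
  have iff: "{a, b} \<in> ?P \<longleftrightarrow> {of_pos m a, of_pos m b} \<in> D" if "a \<in> {1..2 * m}" "b \<in> {1..2 * m}" for a b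
    by (rule to_line_iff[OF d(2) that])
  have low: "of_pos m a = Lft a" if "a \<le> m" for a using that unfolding of_pos_def by simp
  have high: "of_pos m a = Rgt (2 * m + 1 - a)" if "m < a" for a using that unfolding of_pos_def by simp
  define A1 where "A1 = {s \<in> ?P. odd (Min s) \<and> s \<subseteq> {1..m}}"
  define A2 where "A2 = {s \<in> ?P. odd (Min s) \<and> s \<subseteq> {m<..}}"
  define A3 where "A3 = {s \<in> ?P. odd (Min s) \<and> \<not> s \<subseteq> {1..m} \<and> \<not> s \<subseteq> {m<..}}"
  have finP: "finite ?P" by (rule finite_matching[OF p(1)]) (simp add: p(2))
  have split: "{s \<in> ?P. odd (Min s)} = A1 \<union> A2 \<union> A3" unfolding A1_def A2_def A3_def by blast
  have "s \<noteq> {}" if "s \<in> ?P" for s using pair[OF that] by blast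
  then have "\<not> (s \<subseteq> {1..m} \<and> s \<subseteq> {m<..})" if "s \<in> ?P" for s using that by (fastforce simp: subset_iff)
  then have disj: "A1 \<inter> A2 = {}" "(A1 \<union> A2) \<inter> A3 = {}" unfolding A1_def A2_def A3_def by blast+
  have fin: "finite A1" "finite A2" "finite A3" unfolding A1_def A2_def A3_def using finP by auto
  have "odd_arcs ?P = card A1 + card A2 + card A3"
    unfolding odd_arcs_def split using card_Un_disjoint[OF _ fin(3) disj(2)] card_Un_disjoint[OF fin(1,2) disj(1)] fin by simp
  moreover have "A1 = {s \<in> y. odd (Min s)}"
  proof -
    have "s \<in> ?P \<and> s \<subseteq> {1..m} \<longleftrightarrow> s \<in> y" for s
    proof
      assume s: "s \<in> ?P \<and> s \<subseteq> {1..m}"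
      then obtain a b where ab: "s = {a, b}" "a \<in> {1..2 * m}" "b \<in> {1..2 * m}" using pair by blast
      then show "s \<in> y" using s iff[OF ab(2,3)] low L by auto
    next
      assume s: "s \<in> y"
      then obtain a b where ab: "s = {a, b}" using hy'(1) unfolding matching_def by (meson card_2_iff)
      then have "a \<in> {1..m}" "b \<in> {1..m}" using s hy'(2) by auto
      then show "s \<in> ?P \<and> s \<subseteq> {1..m}" using s iff[of a b] low L ab by auto
    qed
    then show ?thesis unfolding A1_def by blast
  qed
  moreover have "card A2 = odd_arcs x"
  proof -
    let ?r = "\<lambda>v. 2 * m + 1 - v"
    have inj: "inj_on ((`) ?r) {s \<in> x. odd (Min s)}"
    proof (rule inj_on_subset)
      show "inj_on ((`) ?r) (Pow {1..m})" by (rule inj_on_image_Pow) (auto simp: inj_on_def)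
      show "{s \<in> x. odd (Min s)} \<subseteq> Pow {1..m}" using hx'(2) by blast
    qed
    have e: "({?r a, ?r b} \<in> ?P \<longleftrightarrow> {a, b} \<in> x) \<and> (odd (Min {?r a, ?r b}) \<longleftrightarrow> odd (Min {a, b}))"
      if a: "a \<in> {1..m}" and b: "b \<in> {1..m}" and o: "odd (a + b)" for a b
    proof -
      have "of_pos m (?r a) = Rgt a" "of_pos m (?r b) = Rgt b" using a b unfolding of_pos_def by auto
      moreover have "?r a \<in> {1..2 * m}" "?r b \<in> {1..2 * m}" using a b by auto
      ultimately have "{?r a, ?r b} \<in> ?P \<longleftrightarrow> {a, b} \<in> x" using iff R by simp
      moreover have "odd (?r a) \<longleftrightarrow> even a" "odd (?r b) \<longleftrightarrow> even b" using a b by auto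
      then have "odd (Min {?r a, ?r b}) \<longleftrightarrow> odd (Min {a, b})"
        unfolding Min_pair using o a b by (cases "a < b") (auto simp: min_def)
      ultimately show ?thesis by blast
    qed
    have "A2 = (`) ?r ` {s \<in> x. odd (Min s)}"
    proof (intro subset_antisym subsetI)
      fix s assume s: "s \<in> A2"
      then have sP: "s \<in> ?P" "odd (Min s)" "s \<subseteq> {m<..}" unfolding A2_def by auto
      obtain a b where ab: "s = {a, b}" "a \<in> {1..2 * m}" "b \<in> {1..2 * m}" using pair[OF sP(1)] by blast
      have r: "?r a \<in> {1..m}" "?r b \<in> {1..m}" "?r (?r a) = a" "?r (?r b) = b" using ab sP(3) by auto
      have "odd (a + b)" using line_parity[OF P] sP(1) ab(1) by blast
      then have "odd (?r a + ?r b)" using r(1,2) ab(2,3) by auto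
      from e[OF r(1,2) this] sP(1,2) have "{?r a, ?r b} \<in> {s \<in> x. odd (Min s)}" unfolding r(3,4) ab(1) by simp
      moreover have "s = ?r ` {?r a, ?r b}" unfolding image_insert image_empty r(3,4) ab(1) ..
      ultimately show "s \<in> (`) ?r ` {s \<in> x. odd (Min s)}" by (rule rev_image_eqI)
    next
      fix s assume "s \<in> (`) ?r ` {s \<in> x. odd (Min s)}"
      then obtain t where t: "t \<in> x" "odd (Min t)" "s = ?r ` t" by blast
      obtain a b where ab: "t = {a, b}" using t(1) hx'(1) unfolding matching_def by (meson card_2_iff)
      have abm: "a \<in> {1..m}" "b \<in> {1..m}" using t(1) ab hx'(2) by auto
      have s: "s = {?r a, ?r b}" unfolding t(3) ab by simp
      have "odd (a + b)" using half_diagram_parity(1)[OF hx] t(1) ab by blast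
      from e[OF abm this] have "s \<in> ?P" "odd (Min s)" unfolding s using t(1,2) ab by auto
      moreover have "s \<subseteq> {m<..}" unfolding s using abm by auto
      ultimately show "s \<in> A2" unfolding A2_def by simp
    qed
    then show ?thesis unfolding odd_arcs_def using card_image[OF inj] by simp
  qed
  moreover have "card A3 = k"
  proof -
    have inj: "inj_on Min A3"
    proof (rule inj_onI)
      fix s t assume st: "s \<in> A3" "t \<in> A3" "Min s = Min t"
      then have sP: "s \<in> ?P" "t \<in> ?P" unfolding A3_def by auto
      have "Min s \<in> s" "Min t \<in> t" using pair[OF sP(1)] pair[OF sP(2)] by (auto simp: min_def)
      then show "s = t" using matching_unique_set[OF p(1) sP, of "Min s"] st(3) by simp
    qed
    have "Min ` A3 = {p \<in> {1..m} - \<Union>y. odd p}"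
    proof (intro subset_antisym subsetI)
      fix v assume "v \<in> Min ` A3"
      then obtain s where s: "s \<in> ?P" "odd (Min s)" "\<not> s \<subseteq> {1..m}" "\<not> s \<subseteq> {m<..}" "v = Min s" unfolding A3_def by blast
      obtain a b where ab: "s = {a, b}" "a < b" "a \<in> {1..2 * m}" "b \<in> {1..2 * m}" using pair[OF s(1)] by blast
      have m: "a \<le> m" "m < b" using s(3,4) ab by auto
      have v: "v = a" using s(5) ab by simp
      have e: "{Lft a, Rgt (2 * m + 1 - b)} \<in> D" using iff[OF ab(3,4)] s(1) ab(1) low[OF m(1)] high[OF m(2)] by simp
      have "a \<notin> \<Union>y"
      proof
        assume "a \<in> \<Union>y"
        then obtain c where "c \<noteq> a" "{a, c} \<in> y" by (rule matching_partner[OF hy'(1)])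
        then have "{Lft a, Lft c} \<in> D" using L by blast
        from matching_unique[OF d(1) e this] show False by simp
      qed
      then show "v \<in> {p \<in> {1..m} - \<Union>y. odd p}" using v s(2,5) m ab(3) by auto
    next
      fix v assume v: "v \<in> {p \<in> {1..m} - \<Union>y. odd p}"
      then have "Lft v \<in> \<Union>D" unfolding d(2) by auto
      then obtain z where z: "z \<noteq> Lft v" "{Lft v, z} \<in> D" by (rule matching_partner[OF d(1)])
      obtain t where t: "z = Rgt t"
      proof (cases z)
        case (Lft j)
        then have "{v, j} \<in> y" using z L by blast
        then show ?thesis using v by blast
      qed
      have "Rgt t \<in> \<Union>D" using z t by blast
      then have tm: "t \<in> {1..m}" unfolding d(2) by auto
      let ?s = "{v, 2 * m + 1 - t}"
      have "?s \<in> ?P"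
      proof -
        have "v \<in> {1..2 * m}" "2 * m + 1 - t \<in> {1..2 * m}" "of_pos m v = Lft v" "of_pos m (2 * m + 1 - t) = Rgt t"
          using v tm unfolding of_pos_def by auto
        then show ?thesis using iff z(2) t by simp
      qed
      moreover have "Min ?s = v" "odd (Min ?s)" "\<not> ?s \<subseteq> {1..m}" "\<not> ?s \<subseteq> {m<..}" using v tm by auto
      ultimately have "?s \<in> A3" "v = Min ?s" unfolding A3_def by auto
      then show "v \<in> Min ` A3" by (rule rev_image_eqI)
    qed
    then show ?thesis using card_image[OF inj] card_odd_defects[OF y] by simp
  qed
  ultimately show ?thesis unfolding odd_arcs_def by simp
qed

text \<open>The distinguished diagram has left arcs \<open>y\<close> and right arcs
  \<open>x\<close>, so each arc of \<open>x\<close> closes a loop with it. Another diagram taking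
  \<open>x\<close> to \<open>y\<close> with equally many loops would contain the arcs of
  \<open>x\<close> and have left arcs \<open>y\<close>; counting through strands leaves no room for
  further right arcs, and uniqueness identifies the two.\<close>

lemma leading_diagram:
  assumes x: "x \<in> link_states m k" and y: "y \<in> link_states m k"
  obtains D where "D \<in> diagrams m" "\<And>\<chi>. action_coeff m \<chi> D x y = \<chi> ^ (m div 2 - k)"
    "\<And>D'. D' \<in> diagrams m \<Longrightarrow> D' \<noteq> D \<Longrightarrow>
      (\<exists>e<m div 2 - k. \<forall>\<chi>. action_coeff m \<chi> D' x y = \<chi> ^ e) \<or> (\<forall>\<chi>. action_coeff m \<chi> D' x y = 0)"
    "odd_arcs (to_line m D) = odd_arcs y + odd_arcs x + k"
proof -
  let ?S = "{1..m}"
  note x' = x[unfolded link_states_eq] and y' = y[unfolded link_states_eq]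
  have hx: "half_diagram ?S x" "card (?S - \<Union>x) = 2 * k" and hy: "half_diagram ?S y" "card (?S - \<Union>y) = 2 * k"
    using x' y' unfolding half_diagrams_def by auto
  note hx' = half_diagramD[OF hx(1)] and hy' = half_diagramD[OF hy(1)]
  have c: "m div 2 - k = card x" using card_half_diagram[OF x'] by simp
  have finx: "finite x" using finite_half[OF hx(1), of m] by simp
  obtain D where D: "rect_diagram m ?S ?S D" "(`) Lft ` y \<subseteq> D" "(`) Rgt ` x \<subseteq> D"
    "\<And>i j. {Lft i, Lft j} \<in> D \<longleftrightarrow> {i, j} \<in> y" "\<And>i j. {Rgt i, Rgt j} \<in> D \<longleftrightarrow> {i, j} \<in> x"
    by (rule join_halves_exists[OF hy(1) hx(1), of m]) (use hx(2) hy(2) in auto)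
  have finE: "finite (\<Union>E)" if "rect_diagram m ?S ?S E" for E unfolding rect_diagramD(2)[OF that] by simp
  have Dm: "D \<in> diagrams m" using D(1) by (simp only: diagrams_iff)
  have "glue D x = y" using glue_subset_Rgt(1)[OF D(1) finE[OF D(1)] D(3) finx] left_part_eq[OF D(1) hy'(1) D(4)] by simp
  then have 1: "action_coeff m \<chi> D x y = \<chi> ^ (m div 2 - k)" for \<chi>
    using glue_subset_Rgt(2)[OF D(1) finE[OF D(1)] D(3) finx] hx(2) hy(2)
    unfolding action_coeff_def concat_link_glue[OF Dm] c defects_def by simp
  have 2: "(\<exists>e<m div 2 - k. \<forall>\<chi>. action_coeff m \<chi> E x y = \<chi> ^ e) \<or> (\<forall>\<chi>. action_coeff m \<chi> E x y = 0)"
    if E: "E \<in> diagrams m" "E \<noteq> D" for E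
  proof (cases "glue E x = y")
    case False
    then show ?thesis unfolding action_coeff_def concat_link_glue[OF E(1)] by simp
  next
    case g: True
    have rE: "rect_diagram m ?S ?S E" using E(1) by (simp only: diagrams_iff)
    note dE = rect_diagramD[OF rE]
    have fx: "finite ((`) Rgt ` x)" using finx by simp
    have sub: "\<Union>((`) Rgt ` x) \<subseteq> \<Union>E" unfolding dE(2) Union_matching_image using hx'(2) by blast
    note le = num_loops_le_card[OF fx image_Rgt_matching[OF hx'(1)] sub dE(1) finE[OF rE]]
    have cR: "card ((`) Rgt ` x) = card x" by (rule card_image[OF inj_on_subset[OF inj_image_point(2)]]) simp
    have "num_loops E ((`) Rgt ` x) \<noteq> card x"
    proof
      assume "num_loops E ((`) Rgt ` x) = card x"
      then have RE: "(`) Rgt ` x \<subseteq> E" using le(2) cR by simp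
      have RE': "{Rgt i, Rgt j} \<in> E" if "{i, j} \<in> x" for i j
        by (rule subsetD[OF RE]) (simp only: Rgt_edge_iff that)
      have L: "{Lft i, Lft j} \<in> E \<longleftrightarrow> {i, j} \<in> y" for i j
        using glue_subset_Rgt(1)[OF rE finE[OF rE] RE finx] g left_part_iff[of i j E] by simp
      have R: "{Rgt i, Rgt j} \<in> E \<longleftrightarrow> {i, j} \<in> x" for i j
      proof
        assume "{i, j} \<in> x" then show "{Rgt i, Rgt j} \<in> E" by (rule RE')
      next
        assume e: "{Rgt i, Rgt j} \<in> E"
        show "{i, j} \<in> x"
        proof (cases "i \<in> \<Union>x")
          case True
          then obtain l where l: "l \<noteq> i" "{i, l} \<in> x" by (rule matching_partner[OF hx'(1)])
          have "Rgt l = Rgt j" by (rule matching_unique[OF dE(1) RE'[OF l(2)] e])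
          then show ?thesis using l(2) by simp
        next
          case False
          \<comment> \<open>\<open>B\<close> and \<open>A\<close> are the free points of
            \<open>y\<close> and \<open>x\<close>, equally many. Every point of \<open>B\<close> has
            a through strand into \<open>A\<close>, so these strands use up \<open>A\<close>, and
            the supposed extra arc at \<open>i\<close> has no place.\<close>
          define A where "A = ?S - \<Union>x"
          define B where "B = ?S - \<Union>y"
          have ex: "\<exists>t. {Lft p, Rgt t} \<in> E" if "p \<in> B" for p
          proof -
            have "Lft p \<in> \<Union>E" using that unfolding dE(2) B_def by auto
            then obtain z where z: "z \<noteq> Lft p" "{Lft p, z} \<in> E" by (rule matching_partner[OF dE(1)])
            show ?thesis
            proof (cases z)
              case (Lft l)
              then have "{p, l} \<in> y" using z L by simp
              then show ?thesis using that unfolding B_def by blast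
            next
              case (Rgt t) then show ?thesis using z by blast
            qed
          qed
          define f where "f p = (SOME t. {Lft p, Rgt t} \<in> E)" for p
          have f: "{Lft p, Rgt (f p)} \<in> E" if "p \<in> B" for p using someI_ex[OF ex[OF that]] unfolding f_def .
          have fA: "f p \<in> A" if "p \<in> B" for p
          proof -
            have "Rgt (f p) \<in> \<Union>E" using f[OF that] by blast
            then have "f p \<in> ?S" unfolding dE(2) by auto
            moreover have "f p \<notin> \<Union>x"
            proof
              assume "f p \<in> \<Union>x"
              then obtain l where l: "l \<noteq> f p" "{f p, l} \<in> x" by (rule matching_partner[OF hx'(1)])
              from matching_unique'(2)[OF dE(1) f[OF that] RE'[OF l(2)]] show False by simp
            qed
            ultimately show ?thesis unfolding A_def by simp
          qed
          have "inj_on f B"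
          proof (rule inj_onI)
            fix u v assume uv: "u \<in> B" "v \<in> B" "f u = f v"
            have "{Lft v, Rgt (f u)} \<in> E" using f[OF uv(2)] uv(3) by simp
            from matching_unique'(3)[OF dE(1) f[OF uv(1)] this] show "u = v" by simp
          qed
          then have "card (f ` B) = card A" using card_image hx(2) hy(2) unfolding A_def B_def by metis
          moreover have "f ` B \<subseteq> A" using fA by blast
          ultimately have "f ` B = A" using card_subset_eq[of A "f ` B"] unfolding A_def by simp
          moreover have "Rgt i \<in> \<Union>E" using e by blast
          then have "i \<in> A" using False unfolding dE(2) A_def by auto
          ultimately obtain p where p: "p \<in> B" "i = f p" by blast
          have False using matching_unique'(2)[OF dE(1) f[OF p(1)], of "Rgt j"] p(2) e by simp
          then show ?thesis ..
        qed
      qed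
      have "E = D" by (rule rect_diagram_unique[OF rE D(1)]) (use L R D(4,5) in auto)
      then show False using E(2) by simp
    qed
    then have "num_loops E ((`) Rgt ` x) < m div 2 - k" using le(1) cR c by simp
    moreover have "action_coeff m \<chi> E x y = \<chi> ^ num_loops E ((`) Rgt ` x)" for \<chi>
      using g hx(2) hy(2) unfolding action_coeff_def concat_link_glue[OF E(1)] defects_def by simp
    ultimately show ?thesis by blast
  qed
  show ?thesis by (rule that[OF Dm 1 2 odd_arcs_join[OF D(1) y' x' D(4,5)]])
qed

subsection \<open>Eigenvalues near a rank one limit\<close>

text \<open>The trace is invariant under similarity, and the Schur form of \<open>A\<close> carries
  the prescribed list of eigenvalues on its diagonal.\<close>

lemma mat_trace_eq_sum_list:
  fixes A :: "complex mat"
  assumes A: "A \<in> carrier_mat n n" and c: "char_poly A = (\<Prod>a\<leftarrow>as. [:- a, 1:])"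
  shows "mat_trace A = sum_list as"
proof -
  obtain B P Q where s: "schur_decomposition A as = (B, P, Q)" by (cases "schur_decomposition A as") auto
  from schur_decomposition[OF A c s] have d: "similar_mat_wit A B P Q" "diag_mat B = as" by auto
  have B: "B \<in> carrier_mat n n" and P: "P \<in> carrier_mat n n" and Q: "Q \<in> carrier_mat n n"
    and QP: "Q * P = 1\<^sub>m n" and eq: "A = P * B * Q"
    using similar_mat_witD2[OF A d(1)] by auto
  have comm: "mat_trace (X * Y) = mat_trace (Y * X)" if X: "X \<in> carrier_mat n n" and Y: "Y \<in> carrier_mat n n" for X Y
  proof -
    have "mat_trace (X * Y) = (\<Sum>i<n. \<Sum>j<n. X $$ (i, j) * Y $$ (j, i))"
      using X Y unfolding mat_trace_def by (auto simp: scalar_prod_def lessThan_atLeast0 intro!: sum.cong)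
    also have "\<dots> = (\<Sum>j<n. \<Sum>i<n. X $$ (i, j) * Y $$ (j, i))" by (rule sum.swap)
    also have "\<dots> = mat_trace (Y * X)"
      using X Y unfolding mat_trace_def by (auto simp: scalar_prod_def lessThan_atLeast0 mult.commute intro!: sum.cong)
    finally show ?thesis .
  qed
  have "mat_trace A = mat_trace (Q * (P * B))" unfolding eq using comm[of "P * B" Q] P B Q by simp
  also have "Q * (P * B) = B" using assoc_mult_mat[OF Q P B] QP B by simp
  also have "mat_trace B = sum_list (diag_mat B)"
    unfolding mat_trace_def diag_mat_def by (simp add: sum_list_distinct_conv_sum_set lessThan_atLeast0)
  finally show ?thesis using d(2) by simp
qed

text \<open>The eigenvalue equation is estimated in a row where \<open>norm (v i)\<close> is largest
  and positive, so that this norm can be cancelled.\<close>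

lemma norm_eigenvalue_le:
  fixes C :: "nat \<Rightarrow> nat \<Rightarrow> complex" and v :: "nat \<Rightarrow> complex"
  assumes v: "j0 < n" "v j0 \<noteq> 0" and ev: "\<And>i. i < n \<Longrightarrow> (\<Sum>j<n. C i j * v j) = c * v i"
    and b: "\<And>i j. i < n \<Longrightarrow> j < n \<Longrightarrow> norm (C i j) \<le> \<epsilon>"
  shows "norm c \<le> n * \<epsilon>"
proof -
  let ?M = "Max ((\<lambda>i. norm (v i)) ` {..<n})"
  have "?M \<in> (\<lambda>i. norm (v i)) ` {..<n}" using v(1) by (intro Max_in) auto
  then obtain i where i: "i < n" "?M = norm (v i)" by auto
  have le: "norm (v j) \<le> norm (v i)" if "j < n" for j
    unfolding i(2)[symmetric] using that by (intro Max_ge) auto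
  have "0 < norm (v j0)" using v(2) by simp
  then have pos: "0 < norm (v i)" using le[OF v(1)] by linarith
  have \<epsilon>: "0 \<le> \<epsilon>" using order_trans[OF norm_ge_zero b[OF i(1) i(1)]] .
  have "norm c * norm (v i) = norm (\<Sum>j<n. C i j * v j)" unfolding ev[OF i(1)] by (rule norm_mult[symmetric])
  also have "\<dots> \<le> (\<Sum>j<n. norm (C i j) * norm (v j))"
    by (rule order_trans[OF norm_sum]) (simp add: norm_mult)
  also have "\<dots> \<le> (\<Sum>j<n. \<epsilon> * norm (v i))"
    by (rule sum_mono, rule mult_mono) (use b[OF i(1)] le \<epsilon> in auto)
  also have "\<dots> = (n * \<epsilon>) * norm (v i)" by simp
  finally show ?thesis using pos by (rule mult_right_le_imp_le)
qed

lemma mset_eq_image_enumeration: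
  "mset xs = image_mset (\<lambda>i. xs ! i) (mset_set {..<length xs})"
proof -
  have "mset xs = mset (map ((!) xs) [0..<length xs])" by (simp add: map_nth)
  also have "\<dots> = image_mset ((!) xs) (mset_set {..<length xs})"
    by (simp only: mset_map mset_upt lessThan_atLeast0)
  finally show ?thesis .
qed

text \<open>Each \<open>a\<close> is near \<open>0\<close> or near \<open>l\<close>, and the sum leaves room for one \<open>a\<close> near \<open>l\<close> only.\<close>

lemma near_idempotent_split:
  fixes as :: "complex list" and l :: complex
  assumes \<epsilon>: "0 < \<epsilon>" "4 * (real (length as) + 1) * \<epsilon> \<le> norm l"
    and sq: "\<And>a. a \<in> set as \<Longrightarrow> norm (a * (a - l)) < \<epsilon>\<^sup>2" and tr: "norm (sum_list as - l) < \<epsilon>"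
    and first: "\<And>i. i < length as \<Longrightarrow> norm (as ! 0 - l) \<le> norm (as ! i - l)"
  shows "norm (as ! 0 - l) < \<epsilon>" "\<And>i. 0 < i \<Longrightarrow> i < length as \<Longrightarrow> norm (as ! i) < \<epsilon>"
proof -
  let ?N = "length as"
  have dich: "norm a < \<epsilon> \<or> norm (a - l) < \<epsilon>" if "a \<in> set as" for a
  proof (rule ccontr)
    assume "\<not> ?thesis"
    then have "\<epsilon> * \<epsilon> \<le> norm a * norm (a - l)" using \<epsilon>(1) by (intro mult_mono) auto
    then show False using sq[OF that] by (simp add: norm_mult power2_eq_square)
  qed
  define J where "J = {i. i < ?N \<and> norm (as ! i - l) < \<epsilon>}"
  have finJ: "finite J" and Jsub: "J \<subseteq> {..<?N}" unfolding J_def by auto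
  have approx: "norm (as ! i - (if i \<in> J then l else 0)) \<le> \<epsilon>" if "i < ?N" for i
    using dich[of "as ! i"] that nth_mem[OF that] unfolding J_def by auto
  have sumJ: "(\<Sum>i<?N. if i \<in> J then l else 0) = of_nat (card J) * l"
    using Jsub by (simp add: sum.If_cases Int_absorb1)
  have "norm (sum_list as - of_nat (card J) * l) = norm (\<Sum>i<?N. as ! i - (if i \<in> J then l else 0))"
    unfolding sum_subtractf sumJ by (simp add: sum_list_sum_nth lessThan_atLeast0)
  also have "\<dots> \<le> (\<Sum>i<?N. \<epsilon>)" by (rule sum_norm_le) (use approx in auto)
  also have "\<dots> = real ?N * \<epsilon>" by simp
  finally have b1: "norm (sum_list as - of_nat (card J) * l) \<le> real ?N * \<epsilon>" .
  have "norm ((of_nat (card J) - 1) * l) = norm ((sum_list as - l) - (sum_list as - of_nat (card J) * l))"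
    by (simp add: algebra_simps)
  also have "\<dots> \<le> norm (sum_list as - l) + norm (sum_list as - of_nat (card J) * l)" by (rule norm_triangle_ineq4)
  also have "\<dots> < \<epsilon> + real ?N * \<epsilon>" using tr b1 by linarith
  also have "\<dots> = (real ?N + 1) * \<epsilon>" by (simp add: algebra_simps)
  \<comment> \<open>The right-hand side is at most a quarter of \<open>norm l\<close>, so the
    integer \<open>card J\<close> must be \<open>1\<close>.\<close>
  finally have b2: "\<bar>real (card J) - 1\<bar> * norm l < (real ?N + 1) * \<epsilon>"
    by (metis norm_mult norm_of_real of_real_1 of_real_diff of_real_of_nat_eq)
  have Npos: "0 < (real ?N + 1) * \<epsilon>" using \<epsilon>(1) by (intro mult_pos_pos) auto
  then have lpos: "norm l > 0" using \<epsilon>(2) by linarith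
  have "\<bar>real (card J) - 1\<bar> < 1"
  proof (rule ccontr)
    assume "\<not> ?thesis"
    then have "1 * norm l \<le> \<bar>real (card J) - 1\<bar> * norm l" using lpos by (intro mult_right_mono) auto
    then show False using b2 \<epsilon>(2) Npos by linarith
  qed
  then have "card J = 1" by linarith
  then obtain i0 where i0: "J = {i0}" using card_1_singletonE by blast
  then have i0N: "i0 < ?N" "norm (as ! i0 - l) < \<epsilon>" unfolding J_def by auto
  then have N0: "0 < ?N" by linarith
  show 1: "norm (as ! 0 - l) < \<epsilon>" using first[OF i0N(1)] i0N(2) by simp
  then have "0 \<in> J" unfolding J_def mem_Collect_eq using N0 by (rule conjI[rotated])
  then have J0: "J = {0}" using i0 by simp
  fix i assume i: "0 < i" "i < ?N"
  then have "i \<notin> J" using J0 by simp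
  then show "norm (as ! i) < \<epsilon>" using dich[of "as ! i"] nth_mem[OF i(2)] i unfolding J_def by auto
qed

lemma eigenvalues_of_rank_one_limit:
  fixes A :: "nat \<Rightarrow> complex mat" and B :: "nat \<Rightarrow> nat \<Rightarrow> complex" and l :: complex
  assumes A: "\<And>n. A n \<in> carrier_mat N N" and N: "0 < N"
    and lim: "\<And>i j. i < N \<Longrightarrow> j < N \<Longrightarrow> (\<lambda>n. A n $$ (i, j)) \<longlonglongrightarrow> B i j"
    and sq: "\<And>i j. i < N \<Longrightarrow> j < N \<Longrightarrow> (\<Sum>r<N. B i r * B r j) = l * B i j"
    and tr: "(\<Sum>i<N. B i i) = l" and l: "l \<noteq> 0"
  shows "\<exists>ev. (\<forall>n. eigenvalue_mset (A n) = image_mset (ev n) (mset_set {..<N})) \<and>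
    (\<lambda>n. ev n 0) \<longlonglongrightarrow> l \<and> (\<forall>i\<in>{1..<N}. (\<lambda>n. ev n i) \<longlonglongrightarrow> 0)"
proof -
  have "\<exists>as. char_poly (A n) = (\<Prod>a\<leftarrow>as. [:- a, 1:]) \<and> length as = N \<and>
     (\<forall>i<N. norm (as ! 0 - l) \<le> norm (as ! i - l))" for n
  proof -
    obtain bs where bs: "char_poly (A n) = (\<Prod>a\<leftarrow>bs. [:- a, 1:])" "length bs = N"
      using char_poly_factorized[OF A] by blast
    have ne: "set bs \<noteq> {}" using bs(2) N by auto
    obtain b where b: "b \<in> set bs" "\<And>a. a \<in> set bs \<Longrightarrow> norm (b - l) \<le> norm (a - l)"
      using arg_min_if_finite[OF finite_set ne, of "\<lambda>a. norm (a - l)"] by (metis not_le)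
    \<comment> \<open>An eigenvalue nearest to \<open>l\<close> is put in front for every
      \<open>n\<close>; in an arbitrary listing the one close to \<open>l\<close> could change its
      index with \<open>n\<close>.\<close>
    define as where "as = b # remove1 b bs"
    have ms: "mset as = mset bs" unfolding as_def using b(1) by simp
    then have "(\<Prod>a\<leftarrow>as. [:- a, 1:]) = (\<Prod>a\<leftarrow>bs. [:- a, 1:])"
      by (metis mset_map prod_mset_prod_list)
    moreover have len: "length as = N" using ms bs(2) by (metis size_mset)
    moreover have "set as = set bs" using ms by (metis set_mset_mset)
    then have "\<forall>i<N. norm (as ! 0 - l) \<le> norm (as ! i - l)"
      using b(2) len nth_mem[of _ as] unfolding as_def by auto
    ultimately show ?thesis using bs(1) by metis
  qed
  then obtain as where as: "\<And>n. char_poly (A n) = (\<Prod>a\<leftarrow>as n. [:- a, 1:])" "\<And>n. length (as n) = N"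
    "\<And>n i. i < N \<Longrightarrow> norm (as n ! 0 - l) \<le> norm (as n ! i - l)"
    by metis
  have mset: "eigenvalue_mset (A n) = image_mset ((!) (as n)) (mset_set {..<N})" for n
  proof -
    have p: "proots (\<Prod>a\<leftarrow>xs. [:- a, 1:]) = mset xs" for xs :: "complex list"
    proof (induction xs)
      case (Cons a xs)
      have "(\<Prod>a\<leftarrow>xs. [:- a, 1:]) \<noteq> 0" by (auto simp: prod_list_zero_iff)
      then have "proots ([:- a, 1:] * (\<Prod>a\<leftarrow>xs. [:- a, 1:])) = proots [:- a, 1:] + proots (\<Prod>a\<leftarrow>xs. [:- a, 1:])"
        by (intro proots_mult) auto
      then show ?case using Cons by (simp del: mult_pCons_left)
    qed simp
    show ?thesis unfolding eigenvalue_mset_def as(1) p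
      using mset_eq_image_enumeration[of "as n"] as(2) by simp
  qed
  have conv: "\<forall>\<^sub>F n in sequentially. norm (as n ! 0 - l) < e \<and> (\<forall>i\<in>{1..<N}. norm (as n ! i) < e)" if e: "0 < e" for e
  proof -
    \<comment> \<open>The second bound is the separation required by
      \<open>near_idempotent_split\<close>; the minimum keeps the precision
      \<open>e\<close>.\<close>
    define \<epsilon> where "\<epsilon> = min e (norm l / (4 * (real N + 1)))"
    have \<epsilon>0: "0 < \<epsilon>" unfolding \<epsilon>_def using e l by simp
    have "\<epsilon> \<le> norm l / (4 * (real N + 1))" unfolding \<epsilon>_def by simp
    then have \<epsilon>1: "4 * (real N + 1) * \<epsilon> \<le> norm l" by (simp add: field_simps)
    \<comment> \<open>The entries of \<open>A n * A n - l * A n\<close>, which multiplies an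
      eigenvector of \<open>A n\<close> for \<open>a\<close> by \<open>a * (a - l)\<close>.\<close>
    define C where "C n i j = (\<Sum>r<N. A n $$ (i, r) * A n $$ (r, j)) - l * A n $$ (i, j)" for n i j
    \<comment> \<open>Entries of norm at most \<open>\<delta>\<close> bound the eigenvalues of the
      matrix \<open>C\<close> by \<open>N * \<delta>\<close>, which is half the square of
      \<open>\<epsilon>\<close>.\<close>
    define \<delta> where "\<delta> = \<epsilon>\<^sup>2 / (2 * N)"
    have \<delta>: "0 < \<delta>" unfolding \<delta>_def using \<epsilon>0 N by simp
    have "(\<lambda>n. C n i j) \<longlonglongrightarrow> (\<Sum>r<N. B i r * B r j) - l * B i j" if "i < N" "j < N" for i j
      unfolding C_def by (intro tendsto_intros lim) (use that in auto)
    then have C0: "(\<lambda>n. C n i j) \<longlonglongrightarrow> 0" if "i < N" "j < N" for i j using sq[OF that] that by fastforce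
    have "\<forall>\<^sub>F n in sequentially. \<forall>i\<in>{..<N}. \<forall>j\<in>{..<N}. norm (C n i j) < \<delta>"
      by (intro eventually_ball_finite ballI finite_lessThan tendstoD[OF C0 \<delta>, unfolded dist_norm diff_0_right]) auto
    moreover have "(\<lambda>n. mat_trace (A n)) \<longlonglongrightarrow> l"
      unfolding mat_trace_def carrier_matD(1)[OF A] tr[symmetric] by (intro tendsto_sum lim) auto
    from tendstoD[OF this \<epsilon>0] have "\<forall>\<^sub>F n in sequentially. norm (mat_trace (A n) - l) < \<epsilon>" unfolding dist_norm .
    ultimately show ?thesis
    proof eventually_elim
      case (elim n)
      have small: "norm (a * (a - l)) < \<epsilon>\<^sup>2" if a: "a \<in> set (as n)" for a
      proof -
        have "poly (char_poly (A n)) a = 0" unfolding as(1) using a by (rule linear_poly_root)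
        then have "eigenvalue (A n) a" using eigenvalue_root_char_poly[OF A] by blast
        then obtain v where v: "v \<in> carrier_vec N" "v \<noteq> 0\<^sub>v N" "A n *\<^sub>v v = a \<cdot>\<^sub>v v"
          using carrier_matD[OF A] unfolding eigenvalue_def eigenvector_def by auto
        have "\<exists>i<N. v $ i \<noteq> 0"
        proof (rule ccontr)
          assume "\<not> (\<exists>i<N. v $ i \<noteq> 0)"
          then have "v = 0\<^sub>v N" using v(1) by (intro eq_vecI) auto
          then show False using v(2) by simp
        qed
        then obtain j0 where j0: "j0 < N" "v $ j0 \<noteq> 0" by blast
        have av: "(\<Sum>j<N. A n $$ (i, j) * v $ j) = a * v $ i" if i: "i < N" for i
        proof -
          have "(\<Sum>j<N. A n $$ (i, j) * v $ j) = (A n *\<^sub>v v) $ i"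
            using i v(1) carrier_matD[OF A[of n]] by (auto simp: scalar_prod_def lessThan_atLeast0 intro!: sum.cong)
          then show ?thesis unfolding v(3) using i v(1) by simp
        qed
        have "(\<Sum>j<N. C n i j * v $ j) = (a * (a - l)) * v $ i" if i: "i < N" for i
        proof -
          have "(\<Sum>j<N. C n i j * v $ j) = (\<Sum>j<N. \<Sum>r<N. A n $$ (i, r) * (A n $$ (r, j) * v $ j)) - l * (\<Sum>j<N. A n $$ (i, j) * v $ j)"
            unfolding C_def by (simp add: left_diff_distrib sum_subtractf sum_distrib_left sum_distrib_right mult.assoc)
          also have "(\<Sum>j<N. \<Sum>r<N. A n $$ (i, r) * (A n $$ (r, j) * v $ j)) = (\<Sum>r<N. A n $$ (i, r) * (\<Sum>j<N. A n $$ (r, j) * v $ j))"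
            unfolding sum_distrib_left by (rule sum.swap)
          also have "\<dots> = (\<Sum>r<N. a * (A n $$ (i, r) * v $ r))" by (rule sum.cong) (auto simp: av)
          also have "\<dots> = a * (a * v $ i)" unfolding sum_distrib_left[symmetric] av[OF i] ..
          finally show ?thesis unfolding av[OF i] by (simp add: algebra_simps)
        qed
        then have "norm (a * (a - l)) \<le> N * \<delta>"
          by (rule norm_eigenvalue_le[where v = "($) v", OF j0]) (use elim(1) in \<open>auto intro: less_imp_le\<close>)
        also have "N * \<delta> = \<epsilon>\<^sup>2 / 2" unfolding \<delta>_def using N by simp
        also have "\<dots> < \<epsilon>\<^sup>2" using \<epsilon>0 by simp
        finally show ?thesis .
      qed
      have tr': "norm (sum_list (as n) - l) < \<epsilon>"
        using elim(2) unfolding mat_trace_eq_sum_list[OF A as(1)] .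
      have first: "norm (as n ! 0 - l) \<le> norm (as n ! i - l)" if "i < length (as n)" for i
        using as(2,3) that by simp
      note split = near_idempotent_split[OF \<epsilon>0 _ small tr' first, unfolded as(2), OF \<epsilon>1]
      have "\<epsilon> \<le> e" unfolding \<epsilon>_def by simp
      show ?case
      proof (intro conjI ballI)
        show "norm (as n ! 0 - l) < e" using split(1) \<open>\<epsilon> \<le> e\<close> by linarith
        show "norm (as n ! i) < e" if "i \<in> {1..<N}" for i
          using split(2)[of i] that \<open>\<epsilon> \<le> e\<close> by fastforce
      qed
    qed
  qed
  show ?thesis
  proof (intro exI[of _ "\<lambda>n i. as n ! i"] conjI allI ballI)
    show "eigenvalue_mset (A n) = image_mset (\<lambda>i. as n ! i) (mset_set {..<N})" for n by (rule mset)
    show "(\<lambda>n. as n ! 0) \<longlonglongrightarrow> l"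
    proof (rule tendstoI)
      fix e :: real assume "0 < e"
      from conv[OF this] show "\<forall>\<^sub>F n in sequentially. dist (as n ! 0) l < e"
        unfolding dist_norm by (rule eventually_mono) simp
    qed
    show "(\<lambda>n. as n ! i) \<longlonglongrightarrow> 0" if "i \<in> {1..<N}" for i
    proof (rule tendstoI)
      fix e :: real assume "0 < e"
      from conv[OF this] show "\<forall>\<^sub>F n in sequentially. dist (as n ! i) 0 < e"
        unfolding dist_norm diff_0_right by (rule eventually_mono) (use that in blast)
    qed
  qed
qed

subsection \<open>Asymptotics of the matrices\<close>

text \<open>The bijection between \<open>NC\<close> and the diagrams turns the cycle number into a
  count of strands of the summation diagram.\<close>

lemma M_mat_entry:
  assumes m: "even m" and ij: "i < dim_std m k" "j < dim_std m k"
  shows "M_mat m k \<chi> q $$ (i, j) = (\<Sum>D\<in>diagrams m. complex_of_real (inverse q ^ odd_arcs (to_line m D)) *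
    action_coeff m \<chi> D (link_basis m k ! j) (link_basis m k ! i))"
proof -
  have "M_mat m k \<chi> q $$ (i, j) = (\<Sum>h\<in>NC m. complex_of_real (inverse q ^ odd_arcs (to_line m (diagram_of m h))) *
    action_coeff m \<chi> (diagram_of m h) (link_basis m k ! j) (link_basis m k ! i))"
    unfolding M_mat_def diagram_rep_def using ij num_cycles_diagram_of[OF m]
    by (simp add: power_int_minus power_inverse)
  also have "\<dots> = (\<Sum>D\<in>diagrams m. complex_of_real (inverse q ^ odd_arcs (to_line m D)) *
    action_coeff m \<chi> D (link_basis m k ! j) (link_basis m k ! i))"
    by (rule sum.reindex_bij_betw[OF bij_betw_diagram_of[OF m]])
  finally show ?thesis .
qed

lemma tendsto_power_ratio:
  assumes "e < a"
  shows "(\<lambda>n. (of_nat n :: complex) ^ e / of_nat n ^ a) \<longlonglongrightarrow> 0"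
proof -
  have "(\<lambda>n. inverse (of_nat n :: complex) ^ (a - e)) \<longlonglongrightarrow> 0 ^ (a - e)"
    by (intro tendsto_power lim_inverse_n)
  then have "(\<lambda>n. inverse (of_nat n :: complex) ^ (a - e)) \<longlonglongrightarrow> 0" using assms by (simp add: power_0_left)
  then show ?thesis
  proof (rule Lim_transform_eventually)
    show "\<forall>\<^sub>F n in sequentially. inverse (of_nat n) ^ (a - e) = (of_nat n :: complex) ^ e / of_nat n ^ a"
      using eventually_gt_at_top[of 0]
    proof eventually_elim
      case (elim n)
      have "(of_nat n :: complex) ^ a = of_nat n ^ e * of_nat n ^ (a - e)"
        using assms by (simp add: power_add[symmetric])
      then show ?case using elim by (simp add: field_simps)
    qed
  qed
qed

text \<open>After division by the largest possible power of the loop parameter only the leading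
  diagram keeps a nonzero limit, and its odd arcs give the exponent.\<close>

lemma tendsto_M_mat:
  assumes m: "even m" and ij: "i < dim_std m k" "j < dim_std m k"
  shows "(\<lambda>n. M_mat m k (of_nat n) q $$ (i, j) / of_nat n ^ (m div 2 - k)) \<longlonglongrightarrow>
    complex_of_real (inverse q ^ (odd_arcs (link_basis m k ! i) + odd_arcs (link_basis m k ! j) + k))"
proof -
  let ?a = "m div 2 - k" and ?x = "link_basis m k ! j" and ?y = "link_basis m k ! i"
  obtain D where D: "D \<in> diagrams m" "\<And>\<chi>. action_coeff m \<chi> D ?x ?y = \<chi> ^ ?a"
    "\<And>D'. D' \<in> diagrams m \<Longrightarrow> D' \<noteq> D \<Longrightarrow>
      (\<exists>e<?a. \<forall>\<chi>. action_coeff m \<chi> D' ?x ?y = \<chi> ^ e) \<or> (\<forall>\<chi>. action_coeff m \<chi> D' ?x ?y = 0)"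
    "odd_arcs (to_line m D) = odd_arcs ?y + odd_arcs ?x + k"
    by (rule leading_diagram[OF link_basis_mem[OF ij(2)] link_basis_mem[OF ij(1)]]) blast
  have "(\<lambda>n. action_coeff m (of_nat n) D' ?x ?y / of_nat n ^ ?a) \<longlonglongrightarrow> (if D' = D then 1 else 0)"
    if D': "D' \<in> diagrams m" for D'
  proof (cases "D' = D")
    case True
    have "\<forall>\<^sub>F n in sequentially. 1 = (of_nat n :: complex) ^ ?a / of_nat n ^ ?a"
      using eventually_gt_at_top[of 0] by eventually_elim simp
    then have "(\<lambda>n. (of_nat n :: complex) ^ ?a / of_nat n ^ ?a) \<longlonglongrightarrow> 1"
      by (rule Lim_transform_eventually[OF tendsto_const])
    then show ?thesis using True D(2) by simp
  next
    case False
    from D(3)[OF D' False] show ?thesis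
    proof
      assume "\<exists>e<?a. \<forall>\<chi>. action_coeff m \<chi> D' ?x ?y = \<chi> ^ e"
      then obtain e where "e < ?a" "\<And>\<chi>. action_coeff m \<chi> D' ?x ?y = \<chi> ^ e" by blast
      then show ?thesis using False tendsto_power_ratio by simp
    next
      assume "\<forall>\<chi>. action_coeff m \<chi> D' ?x ?y = 0"
      then show ?thesis using False by simp
    qed
  qed
  then have "(\<lambda>n. \<Sum>D'\<in>diagrams m. complex_of_real (inverse q ^ odd_arcs (to_line m D')) *
       (action_coeff m (of_nat n) D' ?x ?y / of_nat n ^ ?a)) \<longlonglongrightarrow>
     (\<Sum>D'\<in>diagrams m. complex_of_real (inverse q ^ odd_arcs (to_line m D')) * (if D' = D then 1 else 0))"
    by (intro tendsto_sum tendsto_mult tendsto_const)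
  also have "(\<Sum>D'\<in>diagrams m. complex_of_real (inverse q ^ odd_arcs (to_line m D')) * (if D' = D then 1 else 0)) =
     complex_of_real (inverse q ^ (odd_arcs ?y + odd_arcs ?x + k))"
    using D(1,4) finite_diagrams by (simp add: if_distrib[of "\<lambda>z. _ * z"] cong: if_cong)
  finally show ?thesis unfolding M_mat_entry[OF m ij] sum_divide_distrib by simp
qed

theorem corollary3:
  fixes m k :: nat and qA qB qAB :: real
  assumes "even m" and "m > 0" and "k \<le> m div 2"
    and "qA > 0" and "qB > 0" and "qAB = qA * qB"
  shows "(\<exists>ev :: nat \<Rightarrow> nat \<Rightarrow> complex.
            (\<forall>n>0. eigenvalue_mset
                (inverse (of_nat n ^ (m - 2 * k)) \<cdot>\<^sub>m (M_mat m k (of_nat n) qA * M_mat m k (of_nat n) qB))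
              = image_mset (ev n) (mset_set {..<dim_std m k}))
          \<and> (\<lambda>n. ev n 0) \<longlonglongrightarrow> complex_of_real (qAB powi (- int k) * (g_poly (m div 2) k (inverse qAB))\<^sup>2)
          \<and> (\<forall>i\<in>{1..<dim_std m k}. (\<lambda>n. ev n i) \<longlonglongrightarrow> 0))
       \<and> (\<lambda>n. trace_coeffs m (of_nat n) k / of_nat n ^ (2 * k)) \<longlonglongrightarrow> 1"
proof
  let ?N = "dim_std m k" and ?a = "m div 2 - k" and ?b = "link_basis m k"
  define w where "w i = odd_arcs (?b ! i)" for i
  define s where "s = complex_of_real (inverse qA)"
  define t where "t = complex_of_real (inverse qB)"
  define g where "g = (\<Sum>r<?N. (s * t) ^ w r)"
  define l where "l = (s * t) ^ k * g\<^sup>2"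
  define A :: "nat \<Rightarrow> complex mat" where
    "A n = inverse (of_nat n ^ (m - 2 * k)) \<cdot>\<^sub>m (M_mat m k (of_nat n) qA * M_mat m k (of_nat n) qB)" for n
  have dim: "dim_row (M_mat m k \<chi> q) = ?N" "dim_col (M_mat m k \<chi> q) = ?N" for \<chi> q
    unfolding M_mat_def by simp_all
  have carrier: "A n \<in> carrier_mat ?N ?N" for n
    unfolding A_def by (intro carrier_matI) (simp_all add: dim)
  have loops: "num_loops (e0 m) x = odd_arcs x" if "x \<in> link_states m k" for x
    using half_diagram_parity(2)[of m x] that assms(1) unfolding link_states_eq half_diagrams_def by blast
  have "complex_of_real (g_poly (m div 2) k (inverse qAB)) = (\<Sum>x\<in>link_states m k. (s * t) ^ odd_arcs x)"
    unfolding g_poly_def s_def t_def using assms(1,6) loops by simp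
  then have g_eq: "complex_of_real (g_poly (m div 2) k (inverse qAB)) = g"
    unfolding g_def w_def sum_link_basis[of "\<lambda>x. (s * t) ^ odd_arcs x"] .
  have l_eq: "l = complex_of_real (qAB powi (- int k) * (g_poly (m div 2) k (inverse qAB))\<^sup>2)"
    unfolding l_def g_eq[symmetric] using assms(6)
    by (simp add: s_def t_def power_int_minus power_inverse power_mult_distrib)
  have N: "0 < ?N"
    using half_diagrams_nonempty[OF assms(1,3)] finite_link_states[of m k]
    unfolding dim_std_def link_states_eq by (simp add: card_gt_0_iff)
  \<comment> \<open>All summands are positive and a link state exists, so \<open>l\<close> is
    nonzero and the distinguished eigenvalue stays separated from the others in the limit.\<close>
  have "0 < g_poly (m div 2) k (inverse qAB)"
    unfolding g_poly_def
  proof (rule sum_pos)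
    show "link_states (2 * (m div 2)) k \<noteq> {}"
      using half_diagrams_nonempty[OF assms(1,3)] assms(1) unfolding link_states_eq by simp
  qed (use assms(4-6) finite_link_states in auto)
  then have l0: "l \<noteq> 0" unfolding l_eq using assms(4-6) by simp
  \<comment> \<open>The limit of the scaled product is a column times a row: the exponents of both
    limit matrices are sums over row and column, so \<open>i\<close> and \<open>j\<close> separate
    and the contracted index contributes the factor \<open>g\<close>.\<close>
  define B where "B i j = s ^ (w i + k) * t ^ (w j + k) * g" for i j
  have B_sum: "(\<Sum>r<?N. s ^ (w i + w r + k) * t ^ (w r + w j + k)) = B i j" for i j
    unfolding B_def g_def sum_distrib_left
    by (rule sum.cong) (simp_all add: power_add power_mult_distrib mult_ac)
  have "(\<lambda>n. A n $$ (i, j)) \<longlonglongrightarrow> B i j" if ij: "i < ?N" "j < ?N" for i j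
  proof -
    have "(\<lambda>n. \<Sum>r<?N. (M_mat m k (of_nat n) qA $$ (i, r) / of_nat n ^ ?a) * (M_mat m k (of_nat n) qB $$ (r, j) / of_nat n ^ ?a))
        \<longlonglongrightarrow> (\<Sum>r<?N. s ^ (w i + w r + k) * t ^ (w r + w j + k))"
      using tendsto_M_mat[OF assms(1)] ij unfolding w_def s_def t_def of_real_power[symmetric]
      by (intro tendsto_sum tendsto_mult) auto
    moreover have "(\<Sum>r<?N. (M_mat m k (of_nat n) qA $$ (i, r) / of_nat n ^ ?a) * (M_mat m k (of_nat n) qB $$ (r, j) / of_nat n ^ ?a))
        = A n $$ (i, j)" for n
    proof -
      \<comment> \<open>Each factor is scaled by the power \<open>m div 2 - k\<close>; evenness of
        \<open>m\<close> makes the two scalings combine to the stated one.\<close>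
      have "?a + ?a = m - 2 * k" using assms(1) by (auto elim!: evenE)
      then have "(of_nat n :: complex) ^ (m - 2 * k) = of_nat n ^ ?a * of_nat n ^ ?a" by (metis power_add)
      moreover have "(M_mat m k (of_nat n) qA * M_mat m k (of_nat n) qB) $$ (i, j) =
          (\<Sum>r<?N. M_mat m k (of_nat n) qA $$ (i, r) * M_mat m k (of_nat n) qB $$ (r, j))"
        using ij by (auto simp: dim scalar_prod_def lessThan_atLeast0 intro!: sum.cong)
      ultimately show ?thesis unfolding A_def using ij
        by (simp add: dim sum_distrib_left divide_inverse mult_ac)
    qed
    ultimately show ?thesis unfolding B_sum by simp
  qed
  moreover have "(\<Sum>r<?N. B i r * B r j) = l * B i j" for i j
  proof -
    have "(\<Sum>r<?N. B i r * B r j) = (\<Sum>r<?N. ((s * t) ^ k * g * B i j) * (s * t) ^ w r)"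
      unfolding B_def by (rule sum.cong) (simp_all add: power_add power_mult_distrib mult_ac)
    also have "\<dots> = ((s * t) ^ k * g * B i j) * g" unfolding g_def sum_distrib_left ..
    finally show ?thesis unfolding l_def by (simp add: power2_eq_square mult_ac)
  qed
  moreover have "(\<Sum>i<?N. B i i) = l"
  proof -
    have "(\<Sum>i<?N. B i i) = (\<Sum>i<?N. ((s * t) ^ k * g) * (s * t) ^ w i)"
      unfolding B_def by (rule sum.cong) (simp_all add: power_add power_mult_distrib mult_ac)
    also have "\<dots> = ((s * t) ^ k * g) * g" unfolding g_def sum_distrib_left ..
    finally show ?thesis unfolding l_def by (simp add: power2_eq_square mult_ac)
  qed
  ultimately have "\<exists>ev. (\<forall>n. eigenvalue_mset (A n) = image_mset (ev n) (mset_set {..<?N})) \<and>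
    (\<lambda>n. ev n 0) \<longlonglongrightarrow> l \<and> (\<forall>i\<in>{1..<?N}. (\<lambda>n. ev n i) \<longlonglongrightarrow> 0)"
    by (intro eigenvalues_of_rank_one_limit[OF carrier N _ _ _ l0])
  then show "\<exists>ev :: nat \<Rightarrow> nat \<Rightarrow> complex.
            (\<forall>n>0. eigenvalue_mset
                (inverse (of_nat n ^ (m - 2 * k)) \<cdot>\<^sub>m (M_mat m k (of_nat n) qA * M_mat m k (of_nat n) qB))
              = image_mset (ev n) (mset_set {..<dim_std m k}))
          \<and> (\<lambda>n. ev n 0) \<longlonglongrightarrow> complex_of_real (qAB powi (- int k) * (g_poly (m div 2) k (inverse qAB))\<^sup>2)
          \<and> (\<forall>i\<in>{1..<dim_std m k}. (\<lambda>n. ev n i) \<longlonglongrightarrow> 0)"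
    unfolding A_def l_eq by blast
  show "(\<lambda>n. trace_coeffs m (of_nat n) k / of_nat n ^ (2 * k)) \<longlonglongrightarrow> 1"
    by (rule tendsto_trace_coeffs[OF assms(1,3)])
qed

end
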